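(* For any positive integers $r,n$ there exist positive integers $M_1,M_2$ such that the following holds. If $A=\mathbb{C}^{a}$, $B=\mathbb{C}^{b}$ and $E\subset A\otimes B$ is a concise linear subspace with $\mathrm{codim}(E_r)\leq n$, then at least one of the following holds: (1) $a\leq M_1$ or $b\leq M_1$; (2) $a\leq M_2$ and $b\leq M_2$; (3) there exists a hyperplane $F\subset E$ such that $\mathrm{codim}_F(F_r)\leq n-1$; (4) there exists $1\leq i\leq r$ such that $E=H+H'$, where $\mathrm{codim}(H'_{r-i})\leq n$ and $H\subset \mathbb{C}^i\otimes B$ or $H\subset A\otimes\mathbb{C}^i$.
   Context: For a linear space of matrices $E\subset A\otimes B$, $E_k\subset E$ is the algebraic subset of matrices of rank at most $k$, and $\mathrm{codim}(E_k)$ is its codimension in $E$; for a linear subspace $F\subset E$, $F_k$ is defined likewise and $\mathrm{codim}_F(F_k)$ is its codimension in $F$. A hyperplane of $E$ is a linear subspace of codimension $1$. $E$ is concise if there are no changes of bases in $A$ or $B$ after which some row or column of $E$ consists only of zero entries; i.e. $E\not\subset A'\otimes B$ and $E\not\subset A\otimes B'$ for all proper subspaces $A'\subsetneq A$, $B'\subsetneq B$. Fixing a basis of $E$, $E$ is represented by the $a\times b$ matrix of linear forms in coordinates $x_1,\dots,x_c$ on $E$ ($c=\dim E$) corresponding to the general point of $E$. "$E=H+H'$" means that this matrix of linear forms is the sum of two $a\times b$ matrices of linear forms in $x_1,\dots,x_c$, representing linear spaces of matrices $H$ and $H'$. The codimension of $H'_{k}$ is the codimension of the locus where the matrix $H'$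 has rank at most $k$. "$H\subset\mathbb{C}^i\otimes B$" (resp. "$H\subset A\otimes\mathbb{C}^i$") means $H\subset A'\otimes B$ (resp. $H\subset A\otimes B'$) for some $i$-dimensional subspace $A'\subset A$ (resp. $B'\subset B$). *)

theory Defs
  imports
    "Jordan_Normal_Form.DL_Rank"
    "HOL-Analysis.Abstract_Topology"
    "HOL-Library.Extended_Nat"
begin

text \<open>Polynomial functions in a given set \<open>G\<close> of coordinate functions: the complex subalgebra
  of functions generated by \<open>G\<close>.\<close>

inductive_set poly_fun :: "('x \<Rightarrow> complex) set \<Rightarrow> ('x \<Rightarrow> complex) set"
  for G :: "('x \<Rightarrow> complex) set" where
  coord: "g \<in> G \<Longrightarrow> g \<in> poly_fun G"
| const: "(\<lambda>_. z) \<in> poly_fun G"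
| add: "p \<in> poly_fun G \<Longrightarrow> q \<in> poly_fun G \<Longrightarrow> (\<lambda>x. p x + q x) \<in> poly_fun G"
| mult: "p \<in> poly_fun G \<Longrightarrow> q \<in> poly_fun G \<Longrightarrow> (\<lambda>x. p x * q x) \<in> poly_fun G"

text \<open>The open sets are the complements of common zero sets of families of polynomial functions.
  The topology lives on the whole type; it is only ever used through its subtopologies on sets
  on which \<open>G\<close> is a system of coordinates.\<close>

definition zariski :: "('x \<Rightarrow> complex) set \<Rightarrow> 'x topology" where
  "zariski G = topology (\<lambda>U. \<exists>P \<subseteq> poly_fun G. U = - {x. \<forall>p\<in>P. p x = 0})"

lemma istopology_zariski:
  "istopology (\<lambda>U. \<exists>P \<subseteq> poly_fun G. U = - {x. \<forall>p\<in>P. p x = 0})"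
  unfolding istopology_def
proof (intro conjI allI impI)
  fix S T
  assume "\<exists>P \<subseteq> poly_fun G. S = - {x. \<forall>p\<in>P. p x = 0}"
    and "\<exists>P \<subseteq> poly_fun G. T = - {x. \<forall>p\<in>P. p x = 0}"
  then obtain P Q where P: "P \<subseteq> poly_fun G" "S = - {x. \<forall>p\<in>P. p x = 0}"
    and Q: "Q \<subseteq> poly_fun G" "T = - {x. \<forall>q\<in>Q. q x = 0}"
    by blast
  define R where "R = (\<lambda>(p, q) x. p x * q x) ` (P \<times> Q)"
  have "R \<subseteq> poly_fun G"
    using P(1) Q(1) unfolding R_def by (auto intro: poly_fun.mult)
  moreover have "x \<in> S \<inter> T \<longleftrightarrow> (\<exists>p\<in>R. p x \<noteq> 0)" for x
    unfolding P(2) Q(2) R_def by auto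
  then have "S \<inter> T = - {x. \<forall>p\<in>R. p x = 0}"
    by auto
  ultimately show "\<exists>P \<subseteq> poly_fun G. S \<inter> T = - {x. \<forall>p\<in>P. p x = 0}"
    by blast
next
  fix K
  assume "\<forall>S\<in>K. \<exists>P \<subseteq> poly_fun G. S = - {x. \<forall>p\<in>P. p x = 0}"
  then obtain P where P: "\<forall>S\<in>K. P S \<subseteq> poly_fun G \<and> S = - {x. \<forall>p\<in>P S. p x = 0}"
    unfolding bchoice_iff by (rule exE)
  have sub: "\<And>S. S \<in> K \<Longrightarrow> P S \<subseteq> poly_fun G"
    using P by blast
  have mem: "x \<in> S \<longleftrightarrow> (\<exists>p\<in>P S. p x \<noteq> 0)" if "S \<in> K" for S x
  proof -
    have "S = - {x. \<forall>p\<in>P S. p x = 0}"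
      using P that by blast
    then have "x \<in> S \<longleftrightarrow> x \<in> - {x. \<forall>p\<in>P S. p x = 0}"
      by (rule arg_cong)
    then show ?thesis
      by simp
  qed
  have "(\<Union>S\<in>K. P S) \<subseteq> poly_fun G"
    using sub by auto
  moreover have "\<Union>K = - {x. \<forall>p\<in>(\<Union>S\<in>K. P S). p x = 0}"
    using mem by auto
  ultimately show "\<exists>P \<subseteq> poly_fun G. \<Union>K = - {x. \<forall>p\<in>P. p x = 0}"
    by blast
qed

lemma openin_zariski:
  "openin (zariski G) U \<longleftrightarrow> (\<exists>P \<subseteq> poly_fun G. U = - {x. \<forall>p\<in>P. p x = 0})"
  unfolding zariski_def by (simp add: topology_inverse'[OF istopology_zariski])

definition irreducible_closedin :: "'x topology \<Rightarrow> 'x set \<Rightarrow> bool" where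
  "irreducible_closedin T Y \<longleftrightarrow> closedin T Y \<and> Y \<noteq> {} \<and>
     (\<forall>C D. closedin T C \<and> closedin T D \<and> Y = C \<union> D \<longrightarrow> C = Y \<or> D = Y)"

text \<open>The supremum of the lengths of chains of irreducible closed subsets
  (the value on the empty space is \<open>0\<close>, but all spaces considered contain the origin).\<close>

definition krull_dim :: "'x topology \<Rightarrow> enat" where
  "krull_dim T = Sup {enat d | d. \<exists>Y :: nat \<Rightarrow> 'x set.
     (\<forall>k\<le>d. irreducible_closedin T (Y k)) \<and> (\<forall>k<d. Y k \<subset> Y (Suc k))}"

text \<open>Codimension of \<open>X\<close> in \<open>V\<close>, for \<open>X \<subseteq> V\<close>. Truncated subtraction is harmless:
  the dimension is monotone, and finite on affine space.\<close>

definition codim :: "'x topology \<Rightarrow> 'x set \<Rightarrow> 'x set \<Rightarrow> enat" where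
  "codim T V X = krull_dim (subtopology T V) - krull_dim (subtopology T X)"

definition zariski_mat :: "nat \<Rightarrow> nat \<Rightarrow> complex mat topology" where
  "zariski_mat a b = zariski {\<lambda>M. M $$ (i, j) | i j. i < a \<and> j < b}"

definition zariski_vec :: "nat \<Rightarrow> complex vec topology" where
  "zariski_vec c = zariski {\<lambda>x. x $ k | k. k < c}"

abbreviation vec_sp :: "nat \<Rightarrow> (complex, complex vec) module" where
  "vec_sp m \<equiv> module_vec TYPE(complex) m"

abbreviation mat_sp :: "nat \<Rightarrow> nat \<Rightarrow> (complex, complex mat) module" where
  "mat_sp a b \<equiv> module_mat TYPE(complex) a b"

abbreviation linear_subspace :: "(complex, 'v) module \<Rightarrow> 'v set \<Rightarrow> bool" where
  "linear_subspace V W \<equiv> VectorSpace.subspace class_ring W V"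

abbreviation lin_dim :: "(complex, 'v) module \<Rightarrow> 'v set \<Rightarrow> nat" where
  "lin_dim V W \<equiv> vectorspace.dim class_ring (V\<lparr>carrier := W\<rparr>)"

text \<open>\<open>\<complex>\<^sup>a \<otimes> \<complex>\<^sup>b\<close> is the space of \<open>a \<times> b\<close> matrices; for \<open>A' \<subseteq> \<complex>\<^sup>a\<close> and \<open>B' \<subseteq> \<complex>\<^sup>b\<close>,
  the subspace \<open>A' \<otimes> \<complex>\<^sup>b\<close> consists of the matrices with all columns in \<open>A'\<close>, and
  \<open>\<complex>\<^sup>a \<otimes> B'\<close> of those with all rows in \<open>B'\<close>.\<close>

definition tensor_left :: "nat \<Rightarrow> nat \<Rightarrow> complex vec set \<Rightarrow> complex mat set" where
  "tensor_left a b A' = {M \<in> carrier_mat a b. \<forall>j<b. col M j \<in> A'}"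

definition tensor_right :: "nat \<Rightarrow> nat \<Rightarrow> complex vec set \<Rightarrow> complex mat set" where
  "tensor_right a b B' = {M \<in> carrier_mat a b. \<forall>i<a. row M i \<in> B'}"

definition concise :: "nat \<Rightarrow> nat \<Rightarrow> complex mat set \<Rightarrow> bool" where
  "concise a b E \<longleftrightarrow>
     (\<forall>A'. linear_subspace (vec_sp a) A' \<and> A' \<subset> carrier_vec a \<longrightarrow> \<not> E \<subseteq> tensor_left a b A') \<and>
     (\<forall>B'. linear_subspace (vec_sp b) B' \<and> B' \<subset> carrier_vec b \<longrightarrow> \<not> E \<subseteq> tensor_right a b B')"

definition hyperplane :: "nat \<Rightarrow> nat \<Rightarrow> complex mat set \<Rightarrow> complex mat set \<Rightarrow> bool" where
  "hyperplane a b E F \<longleftrightarrow> linear_subspace (mat_sp a b) F \<and> F \<subseteq> E \<and>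
     lin_dim (mat_sp a b) E = lin_dim (mat_sp a b) F + 1"

definition rank_locus :: "nat \<Rightarrow> complex mat set \<Rightarrow> nat \<Rightarrow> complex mat set" where
  "rank_locus a E k = {M \<in> E. vec_space.rank a M \<le> k}"

text \<open>An \<open>a \<times> b\<close> matrix of linear forms in \<open>x\<^sub>0, \<dots>, x\<^sub>c\<^sub>-\<^sub>1\<close> is given by the coefficient
  matrices \<open>P k\<close> (\<open>k < c\<close>) of the variables; \<open>lin_mat a b c P x\<close> is its value at \<open>x\<close>.\<close>

definition lin_mat :: "nat \<Rightarrow> nat \<Rightarrow> nat \<Rightarrow> (nat \<Rightarrow> complex mat) \<Rightarrow> complex vec \<Rightarrow> complex mat" where
  "lin_mat a b c P x = mat a b (\<lambda>(i, j). \<Sum>k<c. x $ k * P k $$ (i, j))"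

definition lin_mat_locus ::
  "nat \<Rightarrow> nat \<Rightarrow> nat \<Rightarrow> (nat \<Rightarrow> complex mat) \<Rightarrow> nat \<Rightarrow> complex vec set" where
  "lin_mat_locus a b c P k = {x \<in> carrier_vec c. vec_space.rank a (lin_mat a b c P x) \<le> k}"

definition lin_mat_space :: "nat \<Rightarrow> nat \<Rightarrow> nat \<Rightarrow> (nat \<Rightarrow> complex mat) \<Rightarrow> complex mat set" where
  "lin_mat_space a b c P = lin_mat a b c P ` carrier_vec c"

definition basis_of :: "nat \<Rightarrow> nat \<Rightarrow> complex mat set \<Rightarrow> nat \<Rightarrow> (nat \<Rightarrow> complex mat) \<Rightarrow> bool" where
  "basis_of a b E c e \<longleftrightarrow> inj_on e {..<c} \<and>
     vectorspace.basis class_ring ((mat_sp a b)\<lparr>carrier := E\<rparr>) (e ` {..<c})"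

end

theory Submission
  imports Defs
begin

text \<open>Let \<open>X\<close> be the top member of a maximal chain of irreducible closed subsets of \<open>E\<^sub>r\<close>, so that \<open>X\<close> has
  codimension at most \<open>n\<close>. If \<open>X\<close> lies in a hyperplane \<open>F\<close>, then \<open>F\<close> satisfies (3). Otherwise let \<open>s \<le> r\<close> be the
  generic rank on \<open>X\<close>. At a generic point \<open>M\<close> of \<open>X\<close> the tangent space has codimension at most \<open>n\<close> in
  \<open>E\<close>, and each tangent vector \<open>N\<close> maps \<open>ker M\<close> into \<open>im M\<close>, because the minors of size \<open>s + 1\<close> vanish on \<open>X\<close>.
  If the images of the generic \<open>M\<close> share a nonzero vector \<open>w\<close>, projecting \<open>w\<close> away lowers the rank on
  \<open>X\<close>, which gives (4) with \<open>i = 1\<close>. If they do not, then already \<open>r + 1\<close> of the images intersect in \<open>0\<close>. Every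
  \<open>z\<close> in the kernel of these \<open>r + 1\<close> matrices is killed by the intersection of their tangent
  spaces, which has codimension at most \<open>(r + 1) n\<close>; as \<open>X\<close> spans \<open>E\<close>, this many further points of
  \<open>X\<close> span \<open>E\<close> modulo that intersection. So \<open>(r + 1) (n + 1)\<close> matrices of rank at most \<open>r\<close> have no common
  kernel vector by conciseness, whence \<open>b \<le> (r + 1) (n + 1) r\<close>; \<open>a\<close> is bounded by transposing.
  The bound on the tangent space needs no transcendence degrees: eliminating one coordinate after the other by
  pseudo-division writes the ideal of \<open>X\<close>, away from a hypersurface, with as many equations as
  there are eliminated coordinates, and comparing Hilbert functions shows that a chain of primes is
  no longer than the number of remaining coordinates.\<close>

section \<open>Linear algebra over function spaces\<close>

text \<open>Of \<open>X\<close> only the length of a chain below it is known, not its equations. A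
  bound for the tangent space from above requires that few equations generate the ideal of
  \<open>X\<close> near a generic point. Elimination with \<open>d\<close> free coordinates gives
  \<open>c - d\<close> equations and leaves, up to a denominator, at most
  \<open>B * (D + 1) ^ d\<close> independent functions of degree at most \<open>D\<close> in each
  coordinate, whereas a chain of length \<open>k\<close> forces \<open>(j + k choose k)\<close>
  independent ones of degree linear in \<open>j\<close>. So \<open>k \<le> d\<close>.

  One image has dimension at most \<open>r\<close>, and while the intersection is nonzero some
  further image lowers its dimension; hence the number \<open>r + 1\<close>. If \<open>z\<close> is
  killed by these matrices and \<open>N\<close> is tangent at all of them, then \<open>N z\<close>
  lies in every image and is \<open>0\<close>.

  Irreducibility enters only as primeness of the ideal of functions vanishing on a set. Sets in
  chains can therefore be moved by polynomial maps and cut down to open parts without taking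
  closures, and a polynomial condition checked on a nonempty open part holds on the whole
  set.\<close>

lemma homogeneous_solution:
  fixes c :: "'i \<Rightarrow> 'j \<Rightarrow> complex"
  assumes "finite J" and "finite I" and "card J < card I"
  shows "\<exists>u. (\<exists>i\<in>I. u i \<noteq> 0) \<and> (\<forall>j\<in>J. (\<Sum>i\<in>I. u i * c i j) = 0)"
  using assms
proof (induction J arbitrary: I c rule: finite_induct)
  case empty
  then have "I \<noteq> {}" by auto
  then show ?case by (intro exI[of _ "\<lambda>_. 1"]) auto
next
  case (insert n J)
  show ?case
  proof (cases "\<forall>i\<in>I. c i n = 0")
    case True
    have "card J < card I" using insert by simp
    from insert.IH[OF \<open>finite I\<close> this, of c] True show ?thesis by auto
  next
    case False
    then obtain i0 where i0: "i0 \<in> I" "c i0 n \<noteq> 0" by blast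
    define I' where "I' = I - {i0}"
    have fin: "finite I'" and ni: "i0 \<notin> I'" and I: "I = insert i0 I'"
      using insert.prems i0 by (auto simp: I'_def)
    have "card J < card I'" using insert.prems insert.hyps fin ni by (simp add: I)
    from insert.IH[OF fin this, of "\<lambda>i j. c i j - c i n / c i0 n * c i0 j"]
    obtain u where u: "\<exists>i\<in>I'. u i \<noteq> 0"
      "\<And>j. j \<in> J \<Longrightarrow> (\<Sum>i\<in>I'. u i * (c i j - c i n / c i0 n * c i0 j)) = 0" by blast
    define w where "w = - (\<Sum>i\<in>I'. u i * c i n) / c i0 n"
    define u' where "u' = u(i0 := w)"
    have s: "(\<Sum>i\<in>I. u' i * c i j) = w * c i0 j + (\<Sum>i\<in>I'. u i * c i j)" for j
      unfolding I using fin ni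
      by (simp add: u'_def) (intro sum.cong refl, auto)
    have "(\<Sum>i\<in>I. u' i * c i j) = 0" if "j \<in> insert n J" for j
    proof (cases "j = n")
      case True
      then show ?thesis using i0 by (simp add: s w_def)
    next
      case False
      then have "j \<in> J" using that by simp
      from u(2)[OF this]
      have "(\<Sum>i\<in>I'. u i * c i j) = (\<Sum>i\<in>I'. u i * c i n) / c i0 n * c i0 j"
        by (simp add: algebra_simps sum_subtractf sum_distrib_left sum_divide_distrib)
      then show ?thesis by (simp add: s w_def)
    qed
    moreover have "\<exists>i\<in>I. u' i \<noteq> 0" using u(1) ni by (auto simp: u'_def I)
    ultimately show ?thesis by blast
  qed
qed

text \<open>A bilinear pairing without conjugation, used both for vectors with vectors and for
  functionals with vectors. Vectors are functions of which only the first \<open>n\<close> values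
  count.\<close>

definition dot :: "nat \<Rightarrow> (nat \<Rightarrow> complex) \<Rightarrow> (nat \<Rightarrow> complex) \<Rightarrow> complex" where
  "dot n x y = (\<Sum>i<n. x i * y i)"

lemma dot_commute: "dot n x y = dot n y x"
  by (simp add: dot_def mult.commute)

lemma dot_add: "dot n x (\<lambda>i. y i + z i) = dot n x y + dot n x z"
  and dot_diff: "dot n x (\<lambda>i. y i - z i) = dot n x y - dot n x z"
  and dot_scale: "dot n x (\<lambda>i. t * y i) = t * dot n x y"
  and dot_sum: "dot n x (\<lambda>i. \<Sum>j\<in>J. w j * v j i) = (\<Sum>j\<in>J. w j * dot n x (v j))"
      apply (simp_all add: dot_def algebra_simps sum.distrib sum_subtractf sum_distrib_left)
  by (subst sum.swap) simp

lemma dot_unit: "i < n \<Longrightarrow> dot n x (\<lambda>k. if k = i then w else 0) = x i * w"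
  by (simp add: dot_def if_distrib cong: if_cong)

text \<open>If \<open>l m\<close> is nonzero at some \<open>v0\<close> in the common kernel of the
  other functionals, subtracting the multiple of \<open>l m\<close> that makes \<open>\<psi>\<close>
  vanish at \<open>v0\<close> reduces to those others. If there is no such \<open>v0\<close>, then
  \<open>l m\<close> imposes no new condition and gets the coefficient \<open>0\<close>.\<close>

lemma functional_in_span:
  assumes "finite J"
    and "\<And>v. (\<forall>j\<in>J. dot n (l j) v = 0) \<Longrightarrow> dot n \<psi> v = 0"
  shows "\<exists>\<gamma>. \<forall>k<n. \<psi> k = (\<Sum>j\<in>J. \<gamma> j * l j k)"
  using assms
proof (induction J arbitrary: \<psi> rule: finite_induct)
  case empty
  have "\<psi> k = 0" if "k < n" for k
    using empty(1)[of "\<lambda>i. if i = k then 1 else 0"] dot_unit[OF that, of \<psi> 1] by simp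
  then show ?case by simp
next
  case (insert m J)
  show ?case
  proof (cases "\<exists>v. (\<forall>j\<in>J. dot n (l j) v = 0) \<and> dot n (l m) v \<noteq> 0")
    case False
    then have "dot n \<psi> v = 0" if "\<forall>j\<in>J. dot n (l j) v = 0" for v
      using insert.prems[of v] that by auto
    from insert.IH[OF this] obtain \<gamma> where "\<forall>k<n. \<psi> k = (\<Sum>j\<in>J. \<gamma> j * l j k)" by blast
    moreover have "(\<Sum>j\<in>J. \<gamma> j * l j k) = (\<Sum>j\<in>J. (\<gamma>(m := 0)) j * l j k)" for k
      using insert.hyps by (intro sum.cong) auto
    ultimately show ?thesis using insert.hyps by (intro exI[of _ "\<gamma>(m := 0)"]) simp
  next
    case True
    then obtain v0 where v0: "\<And>j. j \<in> J \<Longrightarrow> dot n (l j) v0 = 0" "dot n (l m) v0 \<noteq> 0" by blast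
    define t where "t = dot n \<psi> v0 / dot n (l m) v0"
    have "dot n (\<lambda>k. \<psi> k - t * l m k) v = 0" if v: "\<forall>j\<in>J. dot n (l j) v = 0" for v
    proof -
      define v' where "v' = (\<lambda>i. v i - (dot n (l m) v / dot n (l m) v0) * v0 i)"
      have d: "dot n x v' = dot n x v - (dot n (l m) v / dot n (l m) v0) * dot n x v0" for x
        unfolding v'_def by (simp only: dot_diff dot_scale)
      have "\<forall>j\<in>insert m J. dot n (l j) v' = 0" using v v0 by (simp add: d)
      then have "dot n \<psi> v' = 0" by (rule insert.prems)
      moreover have "dot n (\<lambda>k. \<psi> k - t * l m k) v = dot n \<psi> v - t * dot n (l m) v"
        by (subst (1 2 3) dot_commute) (simp only: dot_diff dot_scale)
      ultimately show ?thesis by (simp add: d t_def)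
    qed
    from insert.IH[OF this] obtain \<gamma>
      where g: "\<And>k. k < n \<Longrightarrow> \<psi> k - t * l m k = (\<Sum>j\<in>J. \<gamma> j * l j k)" by blast
    have "(\<Sum>j\<in>J. \<gamma> j * l j k) = (\<Sum>j\<in>J. (\<gamma>(m := t)) j * l j k)" for k
      using insert.hyps by (intro sum.cong) auto
    then have "\<psi> k = (\<Sum>j\<in>insert m J. (\<gamma>(m := t)) j * l j k)" if "k < n" for k
      using insert.hyps g[OF that] by (simp add: algebra_simps)
    then show ?thesis by blast
  qed
qed

text \<open>The indices run over \<open>i \<le> p\<close>, so the condition concerns
  \<open>p + 1\<close> members, repetitions allowed. \<open>W\<close> need not be a subspace, which
  permits imposing conditions on its members one after the other.\<close>

definition dim_le :: "nat \<Rightarrow> (nat \<Rightarrow> complex) set \<Rightarrow> nat \<Rightarrow> bool" where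
  "dim_le n W p \<longleftrightarrow> (\<forall>f. (\<forall>i\<le>p. f i \<in> W) \<longrightarrow>
     (\<exists>u. (\<exists>i\<le>p. u i \<noteq> 0) \<and> (\<forall>t<n. (\<Sum>i\<le>p. u i * f i t) = 0)))"

lemma dim_le_spanned:
  assumes "finite J" and "card J \<le> p"
    and "\<And>w. w \<in> W \<Longrightarrow> \<exists>\<gamma>. \<forall>t<n. w t = (\<Sum>j\<in>J. \<gamma> j * b j t)"
  shows "dim_le n W p"
  unfolding dim_le_def
proof (intro allI impI)
  fix f assume "\<forall>i\<le>p. f i \<in> W"
  then have "\<forall>i\<in>{..p}. \<exists>\<gamma>. \<forall>t<n. f i t = (\<Sum>j\<in>J. \<gamma> j * b j t)" using assms(3) by blast
  then obtain \<gamma> where g: "\<And>i t. i \<le> p \<Longrightarrow> t < n \<Longrightarrow> f i t = (\<Sum>j\<in>J. \<gamma> i j * b j t)"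
    by (auto dest!: bchoice)
  obtain u where u: "\<exists>i\<in>{..p}. u i \<noteq> 0" "\<And>j. j \<in> J \<Longrightarrow> (\<Sum>i\<le>p. u i * \<gamma> i j) = 0"
    using homogeneous_solution[OF assms(1), of "{..p}" \<gamma>] assms(2) by auto
  have "(\<Sum>i\<le>p. u i * f i t) = 0" if "t < n" for t
  proof -
    have "(\<Sum>i\<le>p. u i * f i t) = (\<Sum>i\<le>p. \<Sum>j\<in>J. u i * \<gamma> i j * b j t)"
      using g that by (simp add: sum_distrib_left mult.assoc)
    also have "\<dots> = (\<Sum>j\<in>J. (\<Sum>i\<le>p. u i * \<gamma> i j) * b j t)"
      by (subst sum.swap) (simp add: sum_distrib_right)
    finally show ?thesis by (simp add: u)
  qed
  then show "\<exists>u. (\<exists>i\<le>p. u i \<noteq> 0) \<and> (\<forall>t<n. (\<Sum>i\<le>p. u i * f i t) = 0)" using u(1) by auto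
qed

text \<open>Each chosen point lowers the dimension. If \<open>y \<in> L x\<close> is nonzero at
  \<open>w0\<close>, then a relation between \<open>w0\<close> and members of \<open>W\<close>
  killed by \<open>L x\<close>, paired with \<open>y\<close>, has coefficient \<open>0\<close> at
  \<open>w0\<close>. The lemma serves twice: for vectors in an image, tested by left kernels, and
  for functionals, tested at points.\<close>

lemma dim_le_separate:
  assumes "dim_le n W p" and "U \<noteq> {}"
    and "\<And>w. w \<in> W \<Longrightarrow> \<exists>t<n. w t \<noteq> 0 \<Longrightarrow> \<exists>x\<in>U. \<exists>y\<in>L x. dot n y w \<noteq> 0"
  shows "\<exists>xs. (\<forall>l<p. xs l \<in> U) \<and>
    (\<forall>w\<in>W. (\<forall>l<p. \<forall>y\<in>L (xs l). dot n y w = 0) \<longrightarrow> (\<forall>t<n. w t = 0))"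
  using assms
proof (induction p arbitrary: W)
  case 0
  have "w t = 0" if "w \<in> W" "t < n" for w t
    using 0(1)[unfolded dim_le_def, rule_format, of "\<lambda>_. w"] that by auto
  then show ?case by auto
next
  case (Suc p)
  show ?case
  proof (cases "\<exists>w\<in>W. \<exists>t<n. w t \<noteq> 0")
    case False
    obtain x where "x \<in> U" using \<open>U \<noteq> {}\<close> by blast
    then show ?thesis using False by (intro exI[of _ "\<lambda>_. x"]) auto
  next
    case True
    then obtain w0 where w0: "w0 \<in> W" "\<exists>t<n. w0 t \<noteq> 0" by blast
    then obtain x y where x: "x \<in> U" "y \<in> L x" "dot n y w0 \<noteq> 0" using Suc.prems(3) by blast
    define W' where "W' = {w\<in>W. \<forall>y\<in>L x. dot n y w = 0}"
    have "dim_le n W' p"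
      unfolding dim_le_def
    proof (intro allI impI)
      fix f assume f: "\<forall>i\<le>p. f i \<in> W'"
      define f' where "f' = f(Suc p := w0)"
      have "\<forall>i\<le>Suc p. f' i \<in> W" using f w0 by (auto simp: f'_def W'_def le_Suc_eq)
      then obtain u where u: "\<exists>i\<le>Suc p. u i \<noteq> 0" "\<And>t. t < n \<Longrightarrow> (\<Sum>i\<le>Suc p. u i * f' i t) = 0"
        using Suc.prems(1) unfolding dim_le_def by blast
      have s: "(\<Sum>i\<le>p. u i * f' i t) = (\<Sum>i\<le>p. u i * f i t)" for t
        by (intro sum.cong) (auto simp: f'_def)
      have "dot n y (\<lambda>t. \<Sum>i\<le>Suc p. u i * f' i t) = 0"
        using u(2) by (simp add: dot_def)
      then have "(\<Sum>i\<le>p. u i * dot n y (f' i)) + u (Suc p) * dot n y w0 = 0"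
        by (subst (asm) dot_sum) (simp add: f'_def)
      moreover have "dot n y (f' i) = 0" if "i \<le> p" for i
        using f that x(2) by (auto simp: f'_def W'_def)
      ultimately have u0: "u (Suc p) = 0" using x(3) by simp
      with u(1) have "\<exists>i\<le>p. u i \<noteq> 0" by (metis le_Suc_eq)
      moreover have "\<forall>t<n. (\<Sum>i\<le>p. u i * f i t) = 0" using u(2) u0 s by simp
      ultimately show "\<exists>u. (\<exists>i\<le>p. u i \<noteq> 0) \<and> (\<forall>t<n. (\<Sum>i\<le>p. u i * f i t) = 0)" by blast
    qed
    moreover have "\<exists>x\<in>U. \<exists>y\<in>L x. dot n y w \<noteq> 0" if "w \<in> W'" "\<exists>t<n. w t \<noteq> 0" for w
      using Suc.prems(3) that by (simp add: W'_def)
    ultimately obtain xs where xs: "\<forall>l<p. xs l \<in> U"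
      "\<forall>w\<in>W'. (\<forall>l<p. \<forall>y\<in>L (xs l). dot n y w = 0) \<longrightarrow> (\<forall>t<n. w t = 0)"
      using Suc.IH[OF _ \<open>U \<noteq> {}\<close>] by blast
    define ys where "ys = xs(p := x)"
    have "\<forall>l<Suc p. ys l \<in> U" using xs(1) x(1) by (auto simp: ys_def less_Suc_eq)
    moreover have "\<forall>t<n. w t = 0"
      if w: "w \<in> W" and z: "\<forall>l<Suc p. \<forall>y\<in>L (ys l). dot n y w = 0" for w
    proof -
      have "w \<in> W'" using w z[rule_format, of p] by (simp add: W'_def ys_def)
      moreover have "\<forall>l<p. \<forall>y\<in>L (xs l). dot n y w = 0"
      proof (intro allI impI ballI)
        fix l y assume "l < p" "y \<in> L (xs l)"
        then show "dot n y w = 0" using z[rule_format, of l y] by (simp add: ys_def)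
      qed
      ultimately show ?thesis using xs(2) by blast
    qed
    ultimately show ?thesis by blast
  qed
qed

section \<open>Bilinear forms and the rank of a matrix given as a function\<close>

definition bil :: "nat \<Rightarrow> nat \<Rightarrow> (nat \<Rightarrow> nat \<Rightarrow> complex) \<Rightarrow> (nat \<Rightarrow> complex) \<Rightarrow> (nat \<Rightarrow> complex) \<Rightarrow> complex"
  where "bil a b m y z = (\<Sum>i<a. \<Sum>j<b. y i * m i j * z j)"

lemma bil_swap: "bil b a (\<lambda>j i. m i j) z y = bil a b m y z"
  unfolding bil_def by (subst sum.swap) (simp add: mult_ac)

lemma bil_left: "bil a b m y z = dot a y (\<lambda>i. \<Sum>j<b. m i j * z j)"
  by (simp add: bil_def dot_def sum_distrib_left mult.assoc)

lemma bil_right: "bil a b m y z = dot b z (\<lambda>j. \<Sum>i<a. m i j * y i)"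
  unfolding bil_swap[symmetric, of a b] by (rule bil_left)

lemma bil_diff_right: "bil a b m y (\<lambda>j. z j - z' j) = bil a b m y z - bil a b m y z'"
  and bil_sum_right: "bil a b m y (\<lambda>j. \<Sum>q\<in>Q. t' q * zs q j) = (\<Sum>q\<in>Q. t' q * bil a b m y (zs q))"
  by (simp_all only: bil_right dot_commute[of b _ "\<lambda>j. \<Sum>i<a. m i j * y i"] dot_diff dot_sum)

lemma bil_diff_left: "bil a b m (\<lambda>j. z j - z' j) y = bil a b m z y - bil a b m z' y"
  and bil_scale_left: "bil a b m (\<lambda>j. t * z j) y = t * bil a b m z y"
  and bil_sum_left: "bil a b m (\<lambda>j. \<Sum>q\<in>Q. t' q * zs q j) y = (\<Sum>q\<in>Q. t' q * bil a b m (zs q) y)"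
  by (simp_all only: bil_left dot_commute[of a _ "\<lambda>i. \<Sum>j<b. m i j * y j"] dot_diff dot_scale dot_sum)

abbreviation unitf :: "nat \<Rightarrow> nat \<Rightarrow> complex" where
  "unitf i \<equiv> \<lambda>k. if k = i then 1 else 0"

lemma bil_unit_left: "i < a \<Longrightarrow> bil a b m (unitf i) z = (\<Sum>j<b. m i j * z j)"
  by (subst bil_left, subst dot_commute, subst dot_unit) auto

lemma bil_unit: "i < a \<Longrightarrow> j < b \<Longrightarrow> bil a b m (unitf i) (unitf j) = m i j"
  by (simp add: bil_unit_left if_distrib cong: if_cong)

text \<open>Rank in factored form: upper bounds and invariance under transposition are immediate.
  Lower bounds come from \<open>dual_sys\<close>.\<close>

definition rk_le :: "nat \<Rightarrow> nat \<Rightarrow> nat \<Rightarrow> (nat \<Rightarrow> nat \<Rightarrow> complex) \<Rightarrow> bool" where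
  "rk_le a b k m \<longleftrightarrow> (\<exists>\<alpha> \<beta>. \<forall>i<a. \<forall>j<b. m i j = (\<Sum>l<k. \<alpha> l i * \<beta> l j))"

lemma rk_le_swap:
  assumes "rk_le a b k m"
  shows "rk_le b a k (\<lambda>j i. m i j)"
proof -
  obtain \<alpha> \<beta> where "\<forall>i<a. \<forall>j<b. m i j = (\<Sum>l<k. \<alpha> l i * \<beta> l j)"
    using assms unfolding rk_le_def by blast
  then show ?thesis
    unfolding rk_le_def by (intro exI[of _ \<beta>] exI[of _ \<alpha>]) (simp add: mult.commute)
qed

lemma rk_le_mono:
  assumes "rk_le a b k m" and "k \<le> k'"
  shows "rk_le a b k' m"
proof -
  obtain \<alpha> \<beta> where ab: "\<And>i j. i < a \<Longrightarrow> j < b \<Longrightarrow> m i j = (\<Sum>l<k. \<alpha> l i * \<beta> l j)"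
    using assms(1) unfolding rk_le_def by blast
  have "(\<Sum>l<k. \<alpha> l i * \<beta> l j) = (\<Sum>l<k'. (if l < k then \<alpha> l i else 0) * \<beta> l j)" for i j
    using assms(2) by (intro sum.mono_neutral_cong_left) auto
  then show ?thesis
    unfolding rk_le_def using ab by (intro exI[of _ "\<lambda>l i. if l < k then \<alpha> l i else 0"] exI[of _ \<beta>]) simp
qed

text \<open>A certificate for rank at least \<open>k\<close>: an identity block found after
  arbitrary changes of bases. It replaces nonzero minors, so that no rows and columns have to be
  selected.\<close>

definition dual_sys :: "nat \<Rightarrow> nat \<Rightarrow> nat \<Rightarrow> (nat \<Rightarrow> nat \<Rightarrow> complex) \<Rightarrow>
    (nat \<Rightarrow> nat \<Rightarrow> complex) \<Rightarrow> (nat \<Rightarrow> nat \<Rightarrow> complex) \<Rightarrow> bool" where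
  "dual_sys a b k m Y Z \<longleftrightarrow> (\<forall>p<k. \<forall>q<k. bil a b m (Y p) (Z q) = (if p = q then 1 else 0))"

lemma rk_le_bil:
  assumes "\<forall>i<a. \<forall>j<b. m i j = (\<Sum>l<k. \<alpha> l i * \<beta> l j)"
  shows "bil a b m y z = (\<Sum>l<k. dot a y (\<alpha> l) * dot b z (\<beta> l))"
proof -
  have "bil a b m y z = (\<Sum>i<a. \<Sum>j<b. \<Sum>l<k. (y i * \<alpha> l i) * (z j * \<beta> l j))"
    unfolding bil_def using assms
    by (intro sum.cong) (auto simp: sum_distrib_left sum_distrib_right mult_ac)
  also have "\<dots> = (\<Sum>l<k. \<Sum>i<a. \<Sum>j<b. (y i * \<alpha> l i) * (z j * \<beta> l j))"
    by (simp only: sum.swap[of _ _ "{..<k}"])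
  finally show ?thesis by (simp add: dot_def sum_product)
qed

lemma rk_le_dependent:
  assumes "rk_le a b k m" and "k < k'"
  shows "\<exists>u. (\<exists>p<k'. u p \<noteq> 0) \<and> (\<forall>z. (\<Sum>p<k'. u p * bil a b m (Y p) z) = 0)"
proof -
  obtain \<alpha> \<beta> where ab: "\<forall>i<a. \<forall>j<b. m i j = (\<Sum>l<k. \<alpha> l i * \<beta> l j)"
    using assms(1) unfolding rk_le_def by blast
  obtain u where u: "\<exists>p\<in>{..<k'}. u p \<noteq> 0" "\<And>l. l < k \<Longrightarrow> (\<Sum>p<k'. u p * dot a (Y p) (\<alpha> l)) = 0"
    using homogeneous_solution[of "{..<k}" "{..<k'}" "\<lambda>p l. dot a (Y p) (\<alpha> l)"] assms(2) by auto
  have "(\<Sum>p<k'. u p * bil a b m (Y p) z) = 0" for z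
  proof -
    have "(\<Sum>p<k'. u p * bil a b m (Y p) z)
        = (\<Sum>p<k'. \<Sum>l<k. u p * dot a (Y p) (\<alpha> l) * dot b z (\<beta> l))"
      by (simp add: rk_le_bil[OF ab] sum_distrib_left mult.assoc)
    also have "\<dots> = (\<Sum>l<k. (\<Sum>p<k'. u p * dot a (Y p) (\<alpha> l)) * dot b z (\<beta> l))"
      by (subst sum.swap) (simp add: sum_distrib_right)
    finally show ?thesis by (simp add: u)
  qed
  then show ?thesis using u(1) by auto
qed

lemma rk_le_no_dual_sys:
  assumes "rk_le a b k m" and "k < k'"
  shows "\<not> dual_sys a b k' m Y Z"
proof
  assume d: "dual_sys a b k' m Y Z"
  obtain u p where u: "p < k'" "u p \<noteq> 0" "(\<Sum>p<k'. u p * bil a b m (Y p) (Z p')) = 0" for p'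
    using rk_le_dependent[OF assms, of Y] by auto
  have "(\<Sum>p'<k'. u p' * bil a b m (Y p') (Z p)) = (\<Sum>p'<k'. if p' = p then u p' else 0)"
    using d u(1) by (intro sum.cong) (auto simp: dual_sys_def)
  then show False using u by simp
qed

text \<open>A Gram-Schmidt step: \<open>y'\<close> and \<open>z'\<close> are \<open>y\<close> and
  \<open>z\<close> without their components along the system. If they paired to a nonzero value,
  scaling it to \<open>1\<close> would extend the system.\<close>

lemma dual_sys_maximal:
  assumes d: "dual_sys a b k m Y Z" and no: "\<And>Y Z. \<not> dual_sys a b (Suc k) m Y Z"
  shows "bil a b m y z = (\<Sum>p<k. bil a b m y (Z p) * bil a b m (Y p) z)"
proof (rule ccontr)
  assume ne: "bil a b m y z \<noteq> (\<Sum>p<k. bil a b m y (Z p) * bil a b m (Y p) z)"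
  have Ypq: "bil a b m (Y p) (Z q) = (if p = q then 1 else 0)" if "p < k" "q < k" for p q
    using d that by (simp add: dual_sys_def)
  define y' where "y' = (\<lambda>i. y i - (\<Sum>p<k. bil a b m y (Z p) * Y p i))"
  define z' where "z' = (\<lambda>j. z j - (\<Sum>p<k. bil a b m (Y p) z * Z p j))"
  have y': "bil a b m y' w = bil a b m y w - (\<Sum>p<k. bil a b m y (Z p) * bil a b m (Y p) w)" for w
    unfolding y'_def by (simp only: bil_diff_left bil_sum_left)
  have z': "bil a b m w z' = bil a b m w z - (\<Sum>p<k. bil a b m (Y p) z * bil a b m w (Z p))" for w
    unfolding z'_def by (simp only: bil_diff_right bil_sum_right)
  have y0: "bil a b m y' (Z q) = 0" if "q < k" for q
  proof -
    have "(\<Sum>p<k. bil a b m y (Z p) * bil a b m (Y p) (Z q))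
       = (\<Sum>p<k. if p = q then bil a b m y (Z p) else 0)"
      using that by (intro sum.cong) (auto simp: Ypq)
    then show ?thesis using that by (simp add: y')
  qed
  have z0: "bil a b m (Y q) z' = 0" if "q < k" for q
  proof -
    have "(\<Sum>p<k. bil a b m (Y p) z * bil a b m (Y q) (Z p))
       = (\<Sum>p<k. if p = q then bil a b m (Y p) z else 0)"
      using that by (intro sum.cong) (auto simp: Ypq)
    then show ?thesis using that by (simp add: z')
  qed
  define \<delta> where "\<delta> = bil a b m y' z'"
  have "\<delta> \<noteq> 0"
    using ne y0 by (simp add: \<delta>_def z' y'[of z])
  define \<epsilon> where "\<epsilon> = 1 / \<delta>"
  have "\<epsilon> * \<delta> = 1" using \<open>\<delta> \<noteq> 0\<close> by (simp add: \<epsilon>_def)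
  then have "dual_sys a b (Suc k) m (Y(k := (\<lambda>i. \<epsilon> * y' i))) (Z(k := z'))"
    unfolding dual_sys_def
    by (auto simp: less_Suc_eq Ypq y0 z0 bil_scale_left simp flip: \<delta>_def)
  then show False using no by blast
qed

text \<open>A dual system of the largest size \<open>s\<close> expands the form completely, and this
  expansion is a factorization of length \<open>s\<close>. Failure of a rank bound thus has a
  witness, at which a Gram determinant equals \<open>1\<close>; this turns rank into a polynomial
  condition.\<close>

lemma rk_le_iff_no_dual_sys: "rk_le a b k m \<longleftrightarrow> (\<forall>Y Z. \<not> dual_sys a b (Suc k) m Y Z)"
proof
  assume no: "\<forall>Y Z. \<not> dual_sys a b (Suc k) m Y Z"
  have "\<exists>s\<le>k. (\<exists>Y Z. dual_sys a b s m Y Z) \<and> (\<forall>Y Z. \<not> dual_sys a b (Suc s) m Y Z)"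
    using no
  proof (induction k)
    case 0
    have "dual_sys a b 0 m Y Z" for Y Z by (simp add: dual_sys_def)
    then show ?case using 0 by blast
  next
    case (Suc k)
    then show ?case by (cases "\<forall>Y Z. \<not> dual_sys a b (Suc k) m Y Z") (blast intro: le_SucI)+
  qed
  then obtain s Y Z where s: "s \<le> k" "dual_sys a b s m Y Z" "\<And>Y Z. \<not> dual_sys a b (Suc s) m Y Z"
    by blast
  have "m i j = (\<Sum>p<s. bil a b m (unitf i) (Z p) * bil a b m (Y p) (unitf j))" if "i < a" "j < b" for i j
    using dual_sys_maximal[OF s(2,3), of "unitf i" "unitf j"] bil_unit[OF that] by simp
  then have "rk_le a b s m"
    unfolding rk_le_def
    by (intro exI[of _ "\<lambda>p i. bil a b m (unitf i) (Z p)"] exI[of _ "\<lambda>p j. bil a b m (Y p) (unitf j)"]) simp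
  then show "rk_le a b k m" using s(1) by (rule rk_le_mono)
next
  assume "rk_le a b k m"
  then show "\<forall>Y Z. \<not> dual_sys a b (Suc k) m Y Z" using rk_le_no_dual_sys by blast
qed

lemma rk_le_expand:
  assumes "rk_le a b k m" and "dual_sys a b k m Y Z"
  shows "bil a b m y z = (\<Sum>p<k. bil a b m y (Z p) * bil a b m (Y p) z)"
  using dual_sys_maximal[OF assms(2)] rk_le_no_dual_sys[OF assms(1)] by blast

section \<open>Polynomial functions and Hilbert functions\<close>

text \<open>Points are functions on all of \<open>nat\<close>, so the rings for different numbers of
  coordinates are nested and coordinates can be eliminated without changing the space.\<close>

abbreviation pf :: "nat \<Rightarrow> ((nat \<Rightarrow> complex) \<Rightarrow> complex) set" where
  "pf c \<equiv> poly_fun {\<lambda>x. x k | k. k < c}"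

lemma poly_fun_mono:
  assumes "G \<subseteq> G'"
  shows "poly_fun G \<subseteq> poly_fun G'"
proof
  fix p assume "p \<in> poly_fun G"
  then show "p \<in> poly_fun G'" using assms by induction (auto intro: poly_fun.intros)
qed

lemma pf_mono: "k \<le> c \<Longrightarrow> p \<in> pf k \<Longrightarrow> p \<in> pf c"
  using poly_fun_mono[of "{\<lambda>x. x i | i. i < k}" "{\<lambda>x. x i | i. i < c}"] by fastforce

lemma pf_coord: "k < c \<Longrightarrow> (\<lambda>x. x k) \<in> pf c"
  by (rule poly_fun.coord) auto

lemma poly_fun_sum:
  "(\<And>i. i \<in> I \<Longrightarrow> f i \<in> poly_fun G) \<Longrightarrow> (\<lambda>x. \<Sum>i\<in>I. f i x) \<in> poly_fun G"
  by (induction I rule: infinite_finite_induct) (auto intro: poly_fun.intros)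

lemma poly_fun_prod:
  "(\<And>i. i \<in> I \<Longrightarrow> f i \<in> poly_fun G) \<Longrightarrow> (\<lambda>x. \<Prod>i\<in>I. f i x) \<in> poly_fun G"
  by (induction I rule: infinite_finite_induct) (auto intro: poly_fun.intros)

lemma poly_fun_power: "f \<in> poly_fun G \<Longrightarrow> (\<lambda>x. f x ^ n) \<in> poly_fun G"
  by (induction n) (auto intro: poly_fun.intros)

lemma poly_fun_scale: "f \<in> poly_fun G \<Longrightarrow> (\<lambda>x. t * f x) \<in> poly_fun G"
  by (intro poly_fun.mult poly_fun.const)

text \<open>Degree at most \<open>D\<close> in each coordinate below \<open>k\<close> separately.
  The recursion on the last coordinate hands its coefficients to pseudo-division, and membership
  asks only for some coefficients, so their uniqueness is never an issue.\<close>

fun box :: "nat \<Rightarrow> nat \<Rightarrow> ((nat \<Rightarrow> complex) \<Rightarrow> complex) set" where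
  "box 0 D = range (\<lambda>z _. z)"
| "box (Suc k) D = {\<lambda>x. \<Sum>i\<le>D. g i x * x k ^ i | g. \<forall>i\<le>D. g i \<in> box k D}"

lemma box_SucI: "(\<And>i. i \<le> D \<Longrightarrow> g i \<in> box k D) \<Longrightarrow> (\<lambda>x. \<Sum>i\<le>D. g i x * x k ^ i) \<in> box (Suc k) D"
  by auto

lemma box_SucD:
  "f \<in> box (Suc k) D \<Longrightarrow> \<exists>g. (\<forall>i\<le>D. g i \<in> box k D) \<and> (\<forall>x. f x = (\<Sum>i\<le>D. g i x * x k ^ i))"
  by auto

lemma box_scale: "f \<in> box k D \<Longrightarrow> (\<lambda>x. t * f x) \<in> box k D"
proof (induction k arbitrary: f)
  case 0
  then show ?case by auto
next
  case (Suc k)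
  obtain g
    where g: "\<And>i. i \<le> D \<Longrightarrow> g i \<in> box k D" "\<And>x. f x = (\<Sum>i\<le>D. g i x * x k ^ i)"
    using box_SucD[OF Suc.prems] by blast
  have "(\<lambda>x. \<Sum>i\<le>D. (t * g i x) * x k ^ i) \<in> box (Suc k) D"
    by (intro box_SucI Suc.IH g(1))
  then show ?case by (simp add: g(2) sum_distrib_left mult.assoc)
qed

lemma box_add: "f \<in> box k D \<Longrightarrow> f' \<in> box k D \<Longrightarrow> (\<lambda>x. f x + f' x) \<in> box k D"
proof (induction k arbitrary: f f')
  case 0
  then show ?case by auto
next
  case (Suc k)
  obtain g
    where g: "\<And>i. i \<le> D \<Longrightarrow> g i \<in> box k D" "\<And>x. f x = (\<Sum>i\<le>D. g i x * x k ^ i)"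
    using box_SucD[OF Suc.prems(1)] by blast
  obtain g'
    where g': "\<And>i. i \<le> D \<Longrightarrow> g' i \<in> box k D" "\<And>x. f' x = (\<Sum>i\<le>D. g' i x * x k ^ i)"
    using box_SucD[OF Suc.prems(2)] by blast
  have "(\<lambda>x. \<Sum>i\<le>D. (g i x + g' i x) * x k ^ i) \<in> box (Suc k) D"
    by (intro box_SucI Suc.IH g(1) g'(1))
  then show ?case by (simp add: g(2) g'(2) sum.distrib algebra_simps)
qed

lemma box_const: "(\<lambda>_. z) \<in> box k D"
proof (induction k arbitrary: z)
  case (Suc k)
  have "(\<lambda>x. \<Sum>i\<le>D. (\<lambda>x. if i = 0 then z else 0) x * x k ^ i) \<in> box (Suc k) D"
    using Suc by (intro box_SucI)
  moreover have "(\<lambda>x. \<Sum>i\<le>D. (\<lambda>x. if i = 0 then z else 0) x * x k ^ i) = (\<lambda>_. z)"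
    by (auto simp: if_distrib[of "\<lambda>t. t * _"] cong: if_cong)
  ultimately show ?case by simp
qed auto

lemma box_diff: "f \<in> box k D \<Longrightarrow> f' \<in> box k D \<Longrightarrow> (\<lambda>x. f x - f' x) \<in> box k D"
  using box_add[OF _ box_scale[of f' k D "-1"], of f] by simp

lemma box_sum: "(\<And>i. i \<in> I \<Longrightarrow> f i \<in> box k D) \<Longrightarrow> (\<lambda>x. \<Sum>i\<in>I. f i x) \<in> box k D"
  by (induction I rule: infinite_finite_induct) (auto intro: box_add box_const)

lemma box_mono: "D \<le> D' \<Longrightarrow> f \<in> box k D \<Longrightarrow> f \<in> box k D'"
proof (induction k arbitrary: f)
  case (Suc k)
  obtain g
    where g: "\<And>i. i \<le> D \<Longrightarrow> g i \<in> box k D" "\<And>x. f x = (\<Sum>i\<le>D. g i x * x k ^ i)"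
    using box_SucD[OF Suc.prems(2)] by blast
  have "(\<lambda>x. \<Sum>i\<le>D'. (if i \<le> D then g i else (\<lambda>_. 0)) x * x k ^ i) \<in> box (Suc k) D'"
    using g(1) Suc.IH Suc.prems(1) by (intro box_SucI) (auto intro: box_const)
  moreover have "(\<lambda>x. \<Sum>i\<le>D'. (if i \<le> D then g i else (\<lambda>_. 0)) x * x k ^ i) = f"
    using Suc.prems(1) by (intro ext, simp only: g(2)) (rule sum.mono_neutral_cong_right, auto)
  ultimately show ?case by simp
qed auto

lemma box_mult: "f \<in> box k D \<Longrightarrow> f' \<in> box k D' \<Longrightarrow> (\<lambda>x. f x * f' x) \<in> box k (D + D')"
proof (induction k arbitrary: f f')
  case (Suc k)
  obtain g
    where g: "\<And>i. i \<le> D \<Longrightarrow> g i \<in> box k D" "\<And>x. f x = (\<Sum>i\<le>D. g i x * x k ^ i)"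
    using box_SucD[OF Suc.prems(1)] by blast
  obtain g'
    where g': "\<And>i. i \<le> D' \<Longrightarrow> g' i \<in> box k D'" "\<And>x. f' x = (\<Sum>i\<le>D'. g' i x * x k ^ i)"
    using box_SucD[OF Suc.prems(2)] by blast
  define h where "h = (\<lambda>i. if i \<le> D then g i else (\<lambda>_. 0))"
  define h' where "h' = (\<lambda>i. if i \<le> D' then g' i else (\<lambda>_. 0))"
  have h: "h i \<in> box k D" "h' i \<in> box k D'" for i
    using g(1) g'(1) by (auto simp: h_def h'_def intro: box_const)
  have "(\<lambda>x. \<Sum>r\<le>D + D'. (\<Sum>i\<le>r. h i x * h' (r - i) x) * x k ^ r) \<in> box (Suc k) (D + D')"
    by (intro box_SucI box_sum Suc.IH h)
  moreover have "(\<Sum>r\<le>D + D'. (\<Sum>i\<le>r. h i x * h' (r - i) x) * x k ^ r) = f x * f' x" for x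
  proof -
    have "(\<Sum>i\<le>D. h i x * x k ^ i) * (\<Sum>i\<le>D'. h' i x * x k ^ i)
        = (\<Sum>r\<le>D + D'. (\<Sum>i\<le>r. h i x * h' (r - i) x) * x k ^ r)"
      by (rule polynomial_product) (auto simp: h_def h'_def)
    then show ?thesis by (simp add: g(2) g'(2) h_def h'_def)
  qed
  ultimately show ?case by simp
qed auto

lemma box_lift:
  assumes "f \<in> box k D"
  shows "f \<in> box (Suc k) D"
proof -
  have "(\<lambda>x. \<Sum>i\<le>D. (if i = 0 then f else (\<lambda>_. 0)) x * x k ^ i) \<in> box (Suc k) D"
    using assms by (intro box_SucI) (auto intro: box_const)
  moreover have "(\<lambda>x. \<Sum>i\<le>D. (if i = 0 then f else (\<lambda>_. 0)) x * x k ^ i) = f"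
    by (auto simp: if_distrib[of "\<lambda>t. t _ * _"] cong: if_cong)
  ultimately show ?thesis by simp
qed

lemma box_coord: "i < k \<Longrightarrow> (\<lambda>x. x i) \<in> box k 1"
proof (induction k)
  case (Suc k)
  show ?case
  proof (cases "i = k")
    case True
    have "(\<lambda>x. \<Sum>j\<le>1. (\<lambda>x. if j = 1 then 1 else 0) x * x k ^ j) \<in> box (Suc k) 1"
      using box_const by (intro box_SucI)
    then show ?thesis by (simp add: True)
  next
    case False
    then show ?thesis using Suc by (intro box_lift) simp
  qed
qed simp

lemma box_subset_pf: "f \<in> box k D \<Longrightarrow> f \<in> pf k"
proof (induction k arbitrary: f)
  case 0
  then show ?case by (auto intro: poly_fun.const)
next
  case (Suc k)
  obtain g
    where g: "\<And>i. i \<le> D \<Longrightarrow> g i \<in> box k D" "\<And>x. f x = (\<Sum>i\<le>D. g i x * x k ^ i)"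
    using box_SucD[OF Suc.prems] by blast
  have "(\<lambda>x. \<Sum>i\<le>D. g i x * x k ^ i) \<in> pf (Suc k)"
    using g(1) Suc.IH by (intro poly_fun_sum poly_fun.mult poly_fun_power pf_coord) (auto intro: pf_mono[of k])
  then show ?case by (simp add: g(2)[symmetric])
qed

lemma pf_in_box: "f \<in> pf k \<Longrightarrow> \<exists>D. f \<in> box k D"
proof (induction rule: poly_fun.induct)
  case (coord g)
  then show ?case using box_coord by blast
next
  case (const z)
  then show ?case using box_const by blast
next
  case (add p q)
  then obtain D D' where "p \<in> box k D" "q \<in> box k D'" by blast
  then have "p \<in> box k (D + D')" "q \<in> box k (D + D')" using box_mono le_add1 le_add2 by blast+
  then show ?case using box_add by blast
next
  case (mult p q)
  then show ?case using box_mult by blast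
qed

lemma pf_in_common_box:
  assumes "finite I" and "\<And>i. i \<in> I \<Longrightarrow> f i \<in> pf k"
  shows "\<exists>D. \<forall>i\<in>I. f i \<in> box k D"
proof -
  have "\<forall>i\<in>I. \<exists>D. f i \<in> box k D" using assms(2) pf_in_box by blast
  then obtain D where D: "\<And>i. i \<in> I \<Longrightarrow> f i \<in> box k (D i)" by (auto dest!: bchoice)
  have "f i \<in> box k (\<Sum>i\<in>I. D i)" if "i \<in> I" for i
    using D[OF that] member_le_sum[of i I D] that assms(1) by (auto intro: box_mono)
  then show ?thesis by blast
qed

section \<open>Primeness and the Hilbert function of the top of a chain\<close>

definition vanish :: "'x set \<Rightarrow> ('x \<Rightarrow> complex) \<Rightarrow> bool" where
  "vanish X p \<longleftrightarrow> (\<forall>x\<in>X. p x = 0)"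

text \<open>The ideal of functions vanishing on \<open>X\<close> is prime; nothing is said about
  \<open>X\<close> being closed.\<close>

definition prime_on :: "('x \<Rightarrow> complex) set \<Rightarrow> 'x set \<Rightarrow> bool" where
  "prime_on R X \<longleftrightarrow> X \<noteq> {} \<and>
     (\<forall>p\<in>R. \<forall>q\<in>R. vanish X (\<lambda>x. p x * q x) \<longrightarrow> vanish X p \<or> vanish X q)"

lemma prime_onD:
  "prime_on R X \<Longrightarrow> p \<in> R \<Longrightarrow> q \<in> R \<Longrightarrow> vanish X (\<lambda>x. p x * q x) \<Longrightarrow> \<not> vanish X p \<Longrightarrow> vanish X q"
  unfolding prime_on_def by blast

definition indep_on :: "nat \<Rightarrow> 'x set \<Rightarrow> (nat \<Rightarrow> 'x \<Rightarrow> complex) \<Rightarrow> bool" where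
  "indep_on N X f \<longleftrightarrow> (\<forall>u. vanish X (\<lambda>x. \<Sum>i<N. u i * f i x) \<longrightarrow> (\<forall>i<N. u i = 0))"

text \<open>On \<open>Y\<close>, where \<open>g\<close> vanishes, a relation involves only the
  \<open>w i\<close>, so their coefficients are \<open>0\<close>. What remains is a multiple of
  \<open>g\<close>, and primeness cancels \<open>g\<close>. In terms of Hilbert functions: that of
  \<open>X\<close> is at least that of \<open>Y\<close> plus that of \<open>X\<close> shifted by the
  degree of \<open>g\<close>.\<close>

lemma indep_on_extend:
  assumes X: "prime_on R X" and "Y \<subseteq> X"
    and g: "g \<in> R" "vanish Y g" "\<not> vanish X g"
    and W: "indep_on q Y w" and S: "indep_on p X s"
    and R: "\<And>u. (\<lambda>x. \<Sum>i<p. u i * s i x) \<in> R"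
  shows "indep_on (q + p) X (\<lambda>i x. if i < q then w i x else g x * s (i - q) x)"
  unfolding indep_on_def
proof (intro allI impI)
  fix u i
  have split: "sum f {..<q + p} = sum f {..<q} + (\<Sum>i<p. f (q + i))" for f :: "nat \<Rightarrow> complex"
    by (induction p) (simp_all add: add.assoc)
  assume "vanish X (\<lambda>x. \<Sum>i<q + p. u i * (if i < q then w i x else g x * s (i - q) x))"
    and i: "i < q + p"
  then have v: "vanish X (\<lambda>x. (\<Sum>i<q. u i * w i x) + g x * (\<Sum>i<p. u (q + i) * s i x))"
    by (simp add: vanish_def split sum_distrib_left mult.left_commute)
  have "vanish Y (\<lambda>x. \<Sum>i<q. u i * w i x)"
    unfolding vanish_def
  proof
    fix x assume "x \<in> Y"
    then have "x \<in> X" "g x = 0" using \<open>Y \<subseteq> X\<close> g(2) by (auto simp: vanish_def)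
    then show "(\<Sum>i<q. u i * w i x) = 0" using v[unfolded vanish_def, rule_format, of x] by simp
  qed
  then have u0: "u i = 0" if "i < q" for i using W that by (auto simp: indep_on_def)
  with v have "vanish X (\<lambda>x. g x * (\<Sum>i<p. u (q + i) * s i x))" by simp
  from prime_onD[OF X g(1) R this g(3)] have "u (q + i) = 0" if "i < p" for i
    using S that by (auto simp: indep_on_def)
  from this[of "i - q"] u0 i show "u i = 0" by (cases "i < q") auto
qed

text \<open>Pascal's rule. Let \<open>L'\<close> be at least \<open>L\<close> and at least the
  degree of a function \<open>g\<close> separating \<open>Y k\<close> from \<open>Y (Suc k)\<close>.
  The count for \<open>Y (Suc k)\<close> at \<open>Suc j\<close> is then at least the count for
  \<open>Y k\<close> at \<open>Suc j\<close> plus the count for \<open>Y (Suc k)\<close> at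
  \<open>j\<close>, whence an induction on \<open>j\<close> inside the one on
  \<open>k\<close>.\<close>

lemma chain_hilbert_lower_bound:
  assumes "\<And>i. i \<le> k \<Longrightarrow> prime_on (pf c) (Y i)"
    and "\<And>i. i < k \<Longrightarrow> Y i \<subseteq> Y (Suc i)"
    and "\<And>i. i < k \<Longrightarrow> \<exists>g\<in>pf c. vanish (Y i) g \<and> \<not> vanish (Y (Suc i)) g"
  shows "\<exists>L. \<forall>j. \<exists>N f. (j + k choose k) \<le> N \<and> (\<forall>i<N. f i \<in> box c (L * j)) \<and> indep_on N (Y k) f"
  using assms
proof (induction k)
  case 0
  have "indep_on 1 (Y 0) (\<lambda>_ _. 1)"
    using 0(1)[of 0] by (auto simp: indep_on_def prime_on_def vanish_def)
  then have "\<exists>N f. (j + 0 choose 0) \<le> N \<and> (\<forall>i<N. f i \<in> box c (0 * j)) \<and> indep_on N (Y 0) f" for j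
    by (intro exI[of _ 1] exI[of _ "\<lambda>_ _. 1"]) (simp add: box_const)
  then show ?case by blast
next
  case (Suc k)
  note chain = Suc.prems
  have "\<exists>L. \<forall>j. \<exists>N f. (j + k choose k) \<le> N \<and> (\<forall>i<N. f i \<in> box c (L * j)) \<and> indep_on N (Y k) f"
    using Suc.prems by (intro Suc.IH) simp_all
  then obtain L where L: "\<And>j. \<exists>N f. (j + k choose k) \<le> N \<and> (\<forall>i<N. f i \<in> box c (L * j)) \<and> indep_on N (Y k) f"
    by blast
  obtain g where g: "g \<in> pf c" "vanish (Y k) g" "\<not> vanish (Y (Suc k)) g"
    using Suc.prems(3)[of k] by auto
  obtain e where e: "g \<in> box c e" using pf_in_box[OF g(1)] by blast
  define L' where "L' = max L e"
  have "\<exists>N f. (j + Suc k choose Suc k) \<le> N \<and> (\<forall>i<N. f i \<in> box c (L' * j)) \<and> indep_on N (Y (Suc k)) f" for j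
  proof (induction j)
    case 0
    have "indep_on 1 (Y (Suc k)) (\<lambda>_ _. 1)"
      using Suc.prems(1)[of "Suc k"] by (auto simp: indep_on_def prime_on_def vanish_def)
    then show ?case by (intro exI[of _ 1] exI[of _ "\<lambda>_ _. 1"]) (simp add: box_const)
  next
    case (Suc j)
    then obtain p s where s: "(j + Suc k choose Suc k) \<le> p" "\<And>i. i < p \<Longrightarrow> s i \<in> box c (L' * j)"
      "indep_on p (Y (Suc k)) s" by blast
    obtain q w where w: "(Suc j + k choose k) \<le> q" "\<And>i. i < q \<Longrightarrow> w i \<in> box c (L * Suc j)"
      "indep_on q (Y k) w" using L[of "Suc j"] by blast
    have "indep_on (q + p) (Y (Suc k)) (\<lambda>i x. if i < q then w i x else g x * s (i - q) x)"
    proof (rule indep_on_extend[OF _ _ g w(3) s(3)])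
      show "prime_on (pf c) (Y (Suc k))" by (rule chain(1)) simp
      show "Y k \<subseteq> Y (Suc k)" by (rule chain(2)) simp
      show "(\<lambda>x. \<Sum>i<p. u i * s i x) \<in> pf c" for u
        using s(2) by (intro poly_fun_sum poly_fun_scale) (auto intro: box_subset_pf)
    qed
    moreover have "(\<lambda>x. if i < q then w i x else g x * s (i - q) x) \<in> box c (L' * Suc j)" if "i < q + p" for i
    proof (cases "i < q")
      case True
      have "L * Suc j \<le> L' * Suc j" by (intro mult_right_mono) (simp_all add: L'_def)
      then show ?thesis using True w(2) box_mono by simp
    next
      case False
      then have "(\<lambda>x. g x * s (i - q) x) \<in> box c (e + L' * j)"
        using that by (intro box_mult e s(2)) simp
      moreover have "e + L' * j \<le> L' * Suc j" by (simp add: L'_def)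
      ultimately have "(\<lambda>x. g x * s (i - q) x) \<in> box c (L' * Suc j)" by (rule box_mono[rotated])
      then show ?thesis using False by simp
    qed
    moreover have "(Suc j + Suc k choose Suc k) \<le> q + p" using s(1) w(1) by simp
    ultimately show ?case
      by (intro exI[of _ "q + p"] exI[of _ "\<lambda>i x. if i < q then w i x else g x * s (i - q) x"] conjI allI impI)
  qed
  then show ?case by blast
qed

text \<open>The top \<open>N\<close> coefficients are removed one at a time. Each removal multiplies
  by the leading coefficient \<open>p m\<close> where ordinary division would divide by it, hence
  the factor \<open>p m x ^ N\<close> and the degree growth \<open>N * e\<close>.\<close>

lemma pseudo_division:
  assumes p: "\<And>i. i \<le> m \<Longrightarrow> p i \<in> box k e"
    and P: "\<And>x. P x = (\<Sum>i\<le>m. p i x * x k ^ i)"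
    and g: "\<And>i. i < N + m \<Longrightarrow> g i \<in> box k D"
  shows "\<exists>h q. (\<forall>i<m. h i \<in> box k (D + N * e)) \<and> q \<in> pf (Suc k) \<and>
    (\<forall>x. p m x ^ N * (\<Sum>i<N + m. g i x * x k ^ i) = (\<Sum>i<m. h i x * x k ^ i) + q x * P x)"
  using g
proof (induction N arbitrary: g D)
  case 0
  then show ?case by (intro exI[of _ g] exI[of _ "\<lambda>_. 0"]) (simp add: poly_fun.const)
next
  case (Suc N)
  \<comment> \<open>Coefficients of \<open>p m\<close> times the dividend minus
    \<open>g (N + m) * x k ^ N\<close> times \<open>P\<close>, in which the power
    \<open>x k ^ (N + m)\<close> cancels.\<close>
  define g' where "g' = (\<lambda>i x. p m x * g i x - (if N \<le> i then g (N + m) x * p (i - N) x else 0))"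
  have "g' i \<in> box k (D + e)" if "i < N + m" for i
  proof -
    have "(\<lambda>x. p m x * g i x) \<in> box k (e + D)" using that by (intro box_mult p Suc.prems) simp_all
    moreover have "(\<lambda>x. if N \<le> i then g (N + m) x * p (i - N) x else 0) \<in> box k (D + e)"
    proof (cases "N \<le> i")
      case True
      have "(\<lambda>x. g (N + m) x * p (i - N) x) \<in> box k (D + e)"
        using that by (intro box_mult p Suc.prems) simp_all
      then show ?thesis using True by simp
    qed (simp add: box_const)
    ultimately show ?thesis unfolding g'_def by (intro box_diff) (simp_all add: add.commute)
  qed
  from Suc.IH[of g' "D + e", OF this] obtain h q where h: "\<forall>i<m. h i \<in> box k (D + e + N * e)" "q \<in> pf (Suc k)"
    "\<And>x. p m x ^ N * (\<Sum>i<N + m. g' i x * x k ^ i) = (\<Sum>i<m. h i x * x k ^ i) + q x * P x" by blast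
  define q' where "q' = (\<lambda>x. p m x ^ N * (g (N + m) x * x k ^ N) + q x)"
  have "q' \<in> pf (Suc k)"
    unfolding q'_def
    by (intro poly_fun.add poly_fun.mult poly_fun_power pf_coord h(2))
       (auto intro!: pf_mono[of k "Suc k"] box_subset_pf[OF p] box_subset_pf[OF Suc.prems])
  moreover have "p m x ^ Suc N * (\<Sum>i<Suc N + m. g i x * x k ^ i) = (\<Sum>i<m. h i x * x k ^ i) + q' x * P x" for x
  proof -
    have "(\<Sum>i<N + m. (if N \<le> i then g (N + m) x * p (i - N) x else 0) * x k ^ i)
        = (\<Sum>i\<in>{N..<N + m}. g (N + m) x * p (i - N) x * x k ^ i)"
      by (rule sum.mono_neutral_cong_right) auto
    also have "\<dots> = (\<Sum>i<m. g (N + m) x * p i x * x k ^ (i + N))"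
      by (rule sum.reindex_bij_witness[of _ "\<lambda>i. i + N" "\<lambda>i. i - N"]) auto
    also have "\<dots> = g (N + m) x * x k ^ N * (\<Sum>i<m. p i x * x k ^ i)"
      by (simp add: sum_distrib_left power_add mult_ac)
    also have "(\<Sum>i<m. p i x * x k ^ i) = P x - p m x * x k ^ m"
      unfolding P by (simp flip: lessThan_Suc_atMost)
    finally have "(\<Sum>i<N + m. g' i x * x k ^ i)
       = p m x * (\<Sum>i<N + m. g i x * x k ^ i) - g (N + m) x * x k ^ N * (P x - p m x * x k ^ m)"
      by (simp add: g'_def left_diff_distrib sum_subtractf sum_distrib_left mult.assoc)
    also have "\<dots> = p m x * (\<Sum>i<Suc N + m. g i x * x k ^ i) - g (N + m) x * x k ^ N * P x"
      by (simp add: algebra_simps power_add)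
    finally have *: "p m x * (\<Sum>i<Suc N + m. g i x * x k ^ i)
        = (\<Sum>i<N + m. g' i x * x k ^ i) + g (N + m) x * x k ^ N * P x" by simp
    have "p m x ^ Suc N * (\<Sum>i<Suc N + m. g i x * x k ^ i)
        = p m x ^ N * (p m x * (\<Sum>i<Suc N + m. g i x * x k ^ i))" by simp
    also have "\<dots> = p m x ^ N * (\<Sum>i<N + m. g' i x * x k ^ i) + p m x ^ N * (g (N + m) x * x k ^ N) * P x"
      unfolding * by (simp add: algebra_simps)
    finally show ?thesis by (simp add: h(3) q'_def algebra_simps)
  qed
  ultimately show ?case using h(1)
    by (intro exI[of _ h] exI[of _ q']) (auto simp: algebra_simps)
qed

section \<open>Local equations of prime sets\<close>

text \<open>Independence modulo the ideal of \<open>X\<close>, weakened so that identical relations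
  among the \<open>F i\<close> are allowed. The index lists are exponents of monomials, the head
  belonging to the coordinate treated last.\<close>

definition free_family :: "(nat \<Rightarrow> complex) set \<Rightarrow> nat \<Rightarrow> nat list set \<Rightarrow>
    (nat list \<Rightarrow> (nat \<Rightarrow> complex) \<Rightarrow> complex) \<Rightarrow> bool" where
  "free_family X k I F \<longleftrightarrow> finite I \<and> (\<forall>i\<in>I. F i \<in> pf k) \<and>
     (\<forall>u. vanish X (\<lambda>x. \<Sum>i\<in>I. u i * F i x) \<longrightarrow> (\<forall>x. (\<Sum>i\<in>I. u i * F i x) = 0))"

lemma free_familyD:
  assumes "free_family X k I F"
  shows "finite I" and "i \<in> I \<Longrightarrow> F i \<in> pf k"
    and "vanish X (\<lambda>x. \<Sum>i\<in>I. u i * F i x) \<Longrightarrow> (\<Sum>i\<in>I. u i * F i x) = 0"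
  using assms unfolding free_family_def by blast+

text \<open>Normal forms: modulo the equations \<open>Q\<close>, functions of degree at most
  \<open>D\<close> lie in the span of \<open>F\<close> after multiplication by one denominator
  \<open>A\<close> that serves for all of them.\<close>

definition reduces :: "(nat \<Rightarrow> complex) set \<Rightarrow> nat \<Rightarrow> nat \<Rightarrow> nat \<Rightarrow> (nat \<Rightarrow> (nat \<Rightarrow> complex) \<Rightarrow> complex) \<Rightarrow>
    ((nat \<Rightarrow> complex) \<Rightarrow> complex) \<Rightarrow> nat list set \<Rightarrow> (nat list \<Rightarrow> (nat \<Rightarrow> complex) \<Rightarrow> complex) \<Rightarrow> bool" where
  "reduces X k D m Q A I F \<longleftrightarrow> free_family X k I F \<and> (\<forall>g\<in>box k D. \<exists>u q. (\<forall>j<m. q j \<in> pf k) \<and>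
        (\<forall>x. A x * g x = (\<Sum>i\<in>I. u i * F i x) + (\<Sum>j<m. q j x * Q j x)))"

text \<open>The state of elimination after \<open>k\<close> coordinates. The number \<open>d\<close>
  of free coordinates shows only as the growth exponent of the number of normal forms.
  \<open>a\<close> collects the leading coefficients of the equations; the denominators
  \<open>A\<close> depend on \<open>D\<close> but are nonzero wherever \<open>a\<close> is.\<close>

definition triangular :: "(nat \<Rightarrow> complex) set \<Rightarrow> nat \<Rightarrow> nat \<Rightarrow> nat \<Rightarrow> (nat \<Rightarrow> (nat \<Rightarrow> complex) \<Rightarrow> complex) \<Rightarrow>
    ((nat \<Rightarrow> complex) \<Rightarrow> complex) \<Rightarrow> nat \<Rightarrow> bool" where
  "triangular X k d m Q a B \<longleftrightarrow> (\<forall>j<m. Q j \<in> pf k \<and> vanish X (Q j)) \<and> a \<in> pf k \<and> \<not> vanish X a \<and>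
     (\<forall>D. \<exists>A\<in>pf k. (\<forall>x. a x \<noteq> 0 \<longrightarrow> A x \<noteq> 0) \<and>
       (\<exists>I F. card I \<le> B * (D + 1) ^ d \<and> reduces X k D m Q A I F))"

text \<open>Independence of the first \<open>E\<close> powers of \<open>x k\<close> over the
  functions of the earlier coordinates. If it holds for all \<open>E\<close>, the coordinate is
  transcendental; otherwise the least failing \<open>E\<close> exceeds by one the degree of a
  minimal equation.\<close>

definition powers_free :: "(nat \<Rightarrow> complex) set \<Rightarrow> nat \<Rightarrow> nat \<Rightarrow> bool" where
  "powers_free X k E \<longleftrightarrow> (\<forall>p. (\<forall>e<E. p e \<in> pf k) \<and> vanish X (\<lambda>x. \<Sum>e<E. p e x * x k ^ e) \<longrightarrow>
     (\<forall>e<E. vanish X (p e)))"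

text \<open>The normal form for the earlier coordinates is applied to each coefficient of a
  polynomial in \<open>x k\<close>. Since \<open>powers_free\<close> separates the powers, the
  products of \<open>F\<close> with powers of \<open>x k\<close> stay free. Free and algebraic
  coordinates both rely on this step.\<close>

lemma reduces_coefficients:
  assumes r: "reduces X k D m Q A I F" and sep: "powers_free X k E"
    and "A \<in> pf k"
  shows "\<exists>I' F'. card I' \<le> E * card I \<and> free_family X (Suc k) I' F' \<and>
     (\<forall>h. (\<forall>e<E. h e \<in> box k D) \<longrightarrow> (\<exists>u q. (\<forall>j<m. q j \<in> pf (Suc k)) \<and>
        (\<forall>x. A x * (\<Sum>e<E. h e x * x k ^ e) = (\<Sum>i\<in>I'. u i * F' i x) + (\<Sum>j<m. q j x * Q j x))))"
proof -
  have free: "free_family X k I F"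
    and red: "\<And>g. g \<in> box k D \<Longrightarrow> \<exists>u q. (\<forall>j<m. q j \<in> pf k) \<and>
        (\<forall>x. A x * g x = (\<Sum>i\<in>I. u i * F i x) + (\<Sum>j<m. q j x * Q j x))"
    using r unfolding reduces_def by blast+
  note finI = free_familyD(1)[OF free] and F = free_familyD(2)[OF free] and ind = free_familyD(3)[OF free]
  define I' where "I' = (\<lambda>(e, l). e # l) ` ({..<E} \<times> I)"
  define F' where "F' = (\<lambda>l x. F (tl l) x * x k ^ hd l :: complex)"
  have inj: "inj_on (\<lambda>(e, l). e # l) ({..<E} \<times> I)" by (auto simp: inj_on_def)
  have sum_I': "(\<Sum>i\<in>I'. u i * F' i x) = (\<Sum>e<E. (\<Sum>l\<in>I. u (e # l) * F l x) * x k ^ e)" for u x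
    unfolding I'_def
    by (subst sum.reindex[OF inj], subst sum.cartesian_product')
       (simp add: F'_def sum_distrib_right mult.assoc)
  have "card I' \<le> E * card I" unfolding I'_def by (subst card_image[OF inj]) (simp add: card_cartesian_product)
  moreover have "free_family X (Suc k) I' F'"
    unfolding free_family_def
  proof (intro conjI allI impI)
    show "finite I'" using finI by (simp add: I'_def)
    show "\<forall>i\<in>I'. F' i \<in> pf (Suc k)"
    by (auto simp: I'_def F'_def intro!: poly_fun.mult poly_fun_power pf_coord intro: pf_mono[of k] F)
    fix u x assume van: "vanish X (\<lambda>x. \<Sum>i\<in>I'. u i * F' i x)"
    have "(\<lambda>x. \<Sum>l\<in>I. u (e # l) * F l x) \<in> pf k" for e
      by (intro poly_fun_sum poly_fun_scale F)
    with sep van[unfolded sum_I'] have "\<forall>e<E. vanish X (\<lambda>x. \<Sum>l\<in>I. u (e # l) * F l x)"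
      unfolding powers_free_def by (elim allE[of _ "\<lambda>e x. \<Sum>l\<in>I. u (e # l) * F l x"]) blast
    then have "(\<Sum>l\<in>I. u (e # l) * F l x) = 0" if "e < E" for e
      using that by (intro ind) simp
    then show "(\<Sum>i\<in>I'. u i * F' i x) = 0" by (simp add: sum_I')
  qed
  moreover have "\<exists>u q. (\<forall>j<m. q j \<in> pf (Suc k)) \<and>
        (\<forall>x. A x * (\<Sum>e<E. h e x * x k ^ e) = (\<Sum>i\<in>I'. u i * F' i x) + (\<Sum>j<m. q j x * Q j x))"
    if h: "\<forall>e<E. h e \<in> box k D" for h
  proof -
    have "\<forall>e\<in>{..<E}. \<exists>u q. (\<forall>j<m. q j \<in> pf k) \<and>
        (\<forall>x. A x * h e x = (\<Sum>i\<in>I. u i * F i x) + (\<Sum>j<m. q j x * Q j x))"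
      using h red by blast
    from bchoice[OF this] obtain u where "\<forall>e\<in>{..<E}. \<exists>q. (\<forall>j<m. q j \<in> pf k) \<and>
        (\<forall>x. A x * h e x = (\<Sum>i\<in>I. u e i * F i x) + (\<Sum>j<m. q j x * Q j x))" ..
    from bchoice[OF this] obtain q where uq: "\<forall>e\<in>{..<E}. (\<forall>j<m. q e j \<in> pf k) \<and>
        (\<forall>x. A x * h e x = (\<Sum>i\<in>I. u e i * F i x) + (\<Sum>j<m. q e j x * Q j x))" ..
    have q: "q e j \<in> pf k" if "e < E" "j < m" for e j using uq that by blast
    have eq: "A x * h e x = (\<Sum>i\<in>I. u e i * F i x) + (\<Sum>j<m. q e j x * Q j x)" if "e < E" for e x
      using uq that by blast
    define q' where "q' = (\<lambda>j x. \<Sum>e<E. q e j x * x k ^ e)"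
    have "q' j \<in> pf (Suc k)" if "j < m" for j
      unfolding q'_def using that
      by (intro poly_fun_sum poly_fun.mult poly_fun_power pf_coord) (auto intro: pf_mono[of k] q)
    moreover have "A x * (\<Sum>e<E. h e x * x k ^ e)
        = (\<Sum>i\<in>I'. u (hd i) (tl i) * F' i x) + (\<Sum>j<m. q' j x * Q j x)" for x
    proof -
      have "A x * (\<Sum>e<E. h e x * x k ^ e) = (\<Sum>e<E. (A x * h e x) * x k ^ e)"
        by (simp add: sum_distrib_left mult.assoc)
      also have "\<dots> = (\<Sum>e<E. (\<Sum>i\<in>I. u e i * F i x) * x k ^ e)
          + (\<Sum>e<E. \<Sum>j<m. q e j x * x k ^ e * Q j x)"
        by (simp add: eq distrib_left distrib_right sum.distrib sum_distrib_left sum_distrib_right mult_ac)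
      also have "(\<Sum>e<E. \<Sum>j<m. q e j x * x k ^ e * Q j x) = (\<Sum>j<m. q' j x * Q j x)"
        by (subst sum.swap) (simp add: q'_def sum_distrib_right)
      finally show ?thesis by (simp add: sum_I')
    qed
    ultimately show ?thesis by (intro exI[of _ "\<lambda>i. u (hd i) (tl i)"] exI[of _ q']) simp
  qed
  ultimately show ?thesis by (intro exI[of _ I'] exI[of _ F']) blast
qed

text \<open>A polynomial of degree \<open>D\<close> in a free coordinate has \<open>D + 1\<close>
  coefficients, which raises the growth exponent by one and calls for no new equation.\<close>

lemma triangular_transcendental:
  assumes t: "triangular X k d m Q a B"
    and sep: "\<And>E. powers_free X k E"
  shows "triangular X (Suc k) (Suc d) m Q a B"
  unfolding triangular_def
proof (intro conjI allI impI)
  fix D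
  obtain A I F where A: "A \<in> pf k" "\<And>x. a x \<noteq> 0 \<Longrightarrow> A x \<noteq> 0"
    and I: "card I \<le> B * (D + 1) ^ d" and r: "reduces X k D m Q A I F"
    using t unfolding triangular_def by meson
  from reduces_coefficients[OF r sep[of "Suc D"] A(1)]
  obtain I' F' where I': "card I' \<le> Suc D * card I" "free_family X (Suc k) I' F'"
     "\<And>h. (\<forall>e<Suc D. h e \<in> box k D) \<Longrightarrow> (\<exists>u q. (\<forall>j<m. q j \<in> pf (Suc k)) \<and>
        (\<forall>x. A x * (\<Sum>e<Suc D. h e x * x k ^ e) = (\<Sum>i\<in>I'. u i * F' i x) + (\<Sum>j<m. q j x * Q j x)))"
    by blast
  have "\<exists>u q. (\<forall>j<m. q j \<in> pf (Suc k)) \<and>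
        (\<forall>x. A x * g x = (\<Sum>i\<in>I'. u i * F' i x) + (\<Sum>j<m. q j x * Q j x))" if g: "g \<in> box (Suc k) D" for g
  proof -
    obtain h where h: "\<forall>i\<le>D. h i \<in> box k D" "\<And>x. g x = (\<Sum>i\<le>D. h i x * x k ^ i)"
      using box_SucD[OF g] by blast
    show ?thesis using I'(3)[of h] h by (simp add: lessThan_Suc_atMost less_Suc_eq_le)
  qed
  then have "reduces X (Suc k) D m Q A I' F'" unfolding reduces_def using I'(2) by blast
  moreover have "card I' \<le> B * (D + 1) ^ Suc d"
    using I'(1) mult_left_mono[OF I, of "Suc D"] by (simp add: mult_ac)
  ultimately show "\<exists>A\<in>pf (Suc k). (\<forall>x. a x \<noteq> 0 \<longrightarrow> A x \<noteq> 0) \<and>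
       (\<exists>I F. card I \<le> B * (D + 1) ^ Suc d \<and> reduces X (Suc k) D m Q A I F)"
    using A pf_mono[of k "Suc k" A] by (intro bexI[of _ A] conjI) auto
qed (use t in \<open>auto simp: triangular_def intro: pf_mono[of k "Suc k"]\<close>)

text \<open>Pseudo-division by the new equation leaves only powers of \<open>x k\<close> below
  \<open>M\<close>, a number that does not depend on \<open>D\<close>. The growth exponent therefore
  stays \<open>d\<close>, and only the constant grows.\<close>

lemma triangular_algebraic:
  assumes t: "triangular X k d m Q a B" and X: "prime_on (pf c) X" and "k < c"
    and p: "\<And>i. i \<le> M \<Longrightarrow> p i \<in> pf k" and P: "vanish X (\<lambda>x. \<Sum>i\<le>M. p i x * x k ^ i)"
    and lead: "\<not> vanish X (p M)"
    and sep: "powers_free X k M"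
  shows "\<exists>Q a B. triangular X (Suc k) d (Suc m) Q a B"
proof -
  have "\<exists>E. \<forall>i\<in>{..M}. p i \<in> box k E" using p by (intro pf_in_common_box) simp_all
  then obtain E where E: "\<And>i. i \<le> M \<Longrightarrow> p i \<in> box k E" by auto
  define R where "R = (\<lambda>x. \<Sum>i\<le>M. p i x * x k ^ i)"
  define Q' where "Q' = Q(m := R)"
  define a' where "a' = (\<lambda>x. a x * p M x)"
  have R_pf: "R \<in> pf (Suc k)"
    unfolding R_def using p
    by (intro poly_fun_sum poly_fun.mult poly_fun_power pf_coord) (auto intro: pf_mono[of k])
  have a: "a \<in> pf k" "\<not> vanish X a" and Q: "\<And>j. j < m \<Longrightarrow> Q j \<in> pf k" "\<And>j. j < m \<Longrightarrow> vanish X (Q j)"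
    using t by (auto simp: triangular_def)
  have "\<not> vanish X a'"
    using prime_onD[OF X _ _ _ a(2), of "p M"] lead p[of M] a(1) \<open>k < c\<close> pf_mono[of k c]
    by (auto simp: a'_def)
  have red: "\<exists>A\<in>pf (Suc k). (\<forall>x. a' x \<noteq> 0 \<longrightarrow> A x \<noteq> 0) \<and>
       (\<exists>I F. card I \<le> M * B * (E + 2) ^ d * (D + 1) ^ d \<and> reduces X (Suc k) D (Suc m) Q' A I F)" for D
  proof -
    \<comment> \<open>Degree of the remainder after \<open>Suc D\<close> division steps. It is
      linear in \<open>D\<close>, so replacing \<open>D\<close> by \<open>D'\<close> costs only the
      factor \<open>(E + 2) ^ d\<close>.\<close>
    define D' where "D' = D + Suc D * E"
    obtain A I F where A: "A \<in> pf k" "\<And>x. a x \<noteq> 0 \<Longrightarrow> A x \<noteq> 0"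
      and I: "card I \<le> B * (D' + 1) ^ d" and r: "reduces X k D' m Q A I F"
      using t unfolding triangular_def by meson
    from reduces_coefficients[OF r sep A(1)]
    obtain I' F' where I': "card I' \<le> M * card I" "free_family X (Suc k) I' F'"
       "\<And>h. (\<forall>e<M. h e \<in> box k D') \<Longrightarrow> (\<exists>u q. (\<forall>j<m. q j \<in> pf (Suc k)) \<and>
          (\<forall>x. A x * (\<Sum>e<M. h e x * x k ^ e) = (\<Sum>i\<in>I'. u i * F' i x) + (\<Sum>j<m. q j x * Q j x)))"
      by blast
    define A' where "A' = (\<lambda>x. A x * p M x ^ Suc D)"
    have A'_pf: "A' \<in> pf (Suc k)"
      unfolding A'_def using A(1) p[of M] pf_mono[of k "Suc k"]
      by (intro poly_fun.mult poly_fun_power) simp_all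
    have "\<exists>u q. (\<forall>j<Suc m. q j \<in> pf (Suc k)) \<and>
        (\<forall>x. A' x * g x = (\<Sum>i\<in>I'. u i * F' i x) + (\<Sum>j<Suc m. q j x * Q' j x))" if g: "g \<in> box (Suc k) D" for g
    proof -
      obtain h where h: "\<forall>i\<le>D. h i \<in> box k D" "\<And>x. g x = (\<Sum>i\<le>D. h i x * x k ^ i)"
        using box_SucD[OF g] by blast
      define h' where "h' = (\<lambda>i. if i \<le> D then h i else (\<lambda>_. 0))"
      have "h' i \<in> box k D" for i using h(1) box_const by (auto simp: h'_def)
      from pseudo_division[of M p k E R "Suc D" h' D, OF E _ this]
      obtain s q where s: "\<forall>i<M. s i \<in> box k D'" "q \<in> pf (Suc k)"
        "\<And>x. p M x ^ Suc D * (\<Sum>i<Suc D + M. h' i x * x k ^ i) = (\<Sum>i<M. s i x * x k ^ i) + q x * R x"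
        unfolding R_def D'_def by blast
      have g': "(\<Sum>i<Suc D + M. h' i x * x k ^ i) = g x" for x
        unfolding h(2) by (rule sum.mono_neutral_cong_right) (auto simp: h'_def)
      obtain u q' where q': "\<forall>j<m. q' j \<in> pf (Suc k)"
        "\<And>x. A x * (\<Sum>e<M. s e x * x k ^ e) = (\<Sum>i\<in>I'. u i * F' i x) + (\<Sum>j<m. q' j x * Q j x)"
        using I'(3)[OF s(1)] by blast
      define q'' where "q'' = q'(m := (\<lambda>x. A x * q x))"
      have "\<forall>j<Suc m. q'' j \<in> pf (Suc k)"
        using q'(1) s(2) A(1) pf_mono[of k "Suc k" A] by (auto simp: q''_def less_Suc_eq intro!: poly_fun.mult)
      moreover have "A' x * g x = (\<Sum>i\<in>I'. u i * F' i x) + (\<Sum>j<Suc m. q'' j x * Q' j x)" for x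
      proof -
        have "A' x * g x = A x * ((\<Sum>i<M. s i x * x k ^ i) + q x * R x)"
          by (simp only: A'_def s(3)[symmetric] g' mult.assoc)
        also have "\<dots> = (\<Sum>i\<in>I'. u i * F' i x) + ((\<Sum>j<m. q' j x * Q j x) + A x * q x * R x)"
          by (simp add: distrib_left q'(2))
        also have "(\<Sum>j<m. q' j x * Q j x) + A x * q x * R x = (\<Sum>j<Suc m. q'' j x * Q' j x)"
          by (simp add: q''_def Q'_def)
        finally show ?thesis .
      qed
      ultimately show ?thesis by blast
    qed
    then have "reduces X (Suc k) D (Suc m) Q' A' I' F'" unfolding reduces_def using I'(2) by blast
    moreover have "card I' \<le> M * B * (E + 2) ^ d * (D + 1) ^ d"
    proof -
      have "D' + 1 \<le> (E + 2) * (D + 1)" by (simp add: D'_def algebra_simps)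
      then have "(D' + 1) ^ d \<le> (E + 2) ^ d * (D + 1) ^ d"
        unfolding power_mult_distrib[symmetric] by (rule power_mono) simp
      then have "B * (D' + 1) ^ d \<le> B * ((E + 2) ^ d * (D + 1) ^ d)" by (rule mult_left_mono) simp
      then have "card I \<le> B * ((E + 2) ^ d * (D + 1) ^ d)" using I by linarith
      then have "M * card I \<le> M * (B * ((E + 2) ^ d * (D + 1) ^ d))" by (rule mult_left_mono) simp
      then have "card I' \<le> M * (B * ((E + 2) ^ d * (D + 1) ^ d))" using I'(1) by (rule order_trans[rotated])
      then show ?thesis by (simp only: mult.assoc)
    qed
    moreover have "\<forall>x. a' x \<noteq> 0 \<longrightarrow> A' x \<noteq> 0" using A(2) by (auto simp: a'_def A'_def)
    ultimately show ?thesis using A'_pf by blast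
  qed
  have "triangular X (Suc k) d (Suc m) Q' a' (M * B * (E + 2) ^ d)"
    unfolding triangular_def
  proof (intro conjI)
    show "\<forall>j<Suc m. Q' j \<in> pf (Suc k) \<and> vanish X (Q' j)"
      using Q R_pf P pf_mono[of k "Suc k"] by (auto simp: Q'_def less_Suc_eq R_def)
    show "a' \<in> pf (Suc k)"
      unfolding a'_def using a(1) p[of M] pf_mono[of k "Suc k"] by (intro poly_fun.mult) simp_all
  qed (use red \<open>\<not> vanish X a'\<close> in blast)+
  then show ?thesis by blast
qed

lemma triangular_exists:
  assumes X: "prime_on (pf c) X" and "k \<le> c"
  shows "\<exists>d m Q a B. d + m = k \<and> triangular X k d m Q a B"
  using \<open>k \<le> c\<close>
proof (induction k)
  case 0
  have "reduces X 0 D 0 (\<lambda>_ _. 0) (\<lambda>_. 1) {[]} (\<lambda>_ _. 1)" for D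
    unfolding reduces_def free_family_def
  proof (intro conjI allI impI ballI)
    fix g :: "(nat \<Rightarrow> complex) \<Rightarrow> complex" assume "g \<in> box 0 D"
    then obtain z where "g = (\<lambda>_. z)" by auto
    then show "\<exists>u q. (\<forall>j<(0::nat). q j \<in> pf 0) \<and>
        (\<forall>x. 1 * g x = (\<Sum>i\<in>{[]}. u i * 1) + (\<Sum>j<0. q j x * 0))"
      by (intro exI[of _ "\<lambda>_. z"] exI[of _ "\<lambda>_ _. 0"]) simp
  next
    fix u :: "nat list \<Rightarrow> complex" and x :: "nat \<Rightarrow> complex"
    assume "vanish X (\<lambda>x. \<Sum>i\<in>{[]}. u i * 1)"
    then show "(\<Sum>i\<in>{[]}. u i * 1) = 0" using X by (auto simp: vanish_def prime_on_def)
  qed (simp_all add: poly_fun.const)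
  then have "triangular X 0 0 0 (\<lambda>_ _. 0) (\<lambda>_. 1) 1"
    unfolding triangular_def using X
    by (intro conjI allI bexI[of _ "\<lambda>_. 1"] exI[of _ "{[]}"] exI[of _ "\<lambda>_ _. 1"])
       (auto simp: vanish_def prime_on_def poly_fun.const)
  then show ?case by (metis add_0)
next
  case (Suc k)
  then obtain d m Q a B where dm: "d + m = k" and t: "triangular X k d m Q a B" by auto
  show ?case
  proof (cases "\<forall>E. powers_free X k E")
    case True
    then have "triangular X (Suc k) (Suc d) m Q a B" by (intro triangular_transcendental[OF t]) blast
    then show ?thesis using dm by (metis add_Suc)
  next
    case False
    then have ex: "\<exists>E. \<not> powers_free X k E" by blast
    \<comment> \<open>Minimality of \<open>E = Suc M\<close> gives both requirements on the
      equation: the powers below \<open>M\<close> are free, and hence the leading coefficient does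
      not vanish on \<open>X\<close>.\<close>
    define E where "E = (LEAST E. \<not> powers_free X k E)"
    have "\<not> powers_free X k E" unfolding E_def by (rule LeastI_ex[OF ex])
    then obtain p where p: "\<And>e. e < E \<Longrightarrow> p e \<in> pf k" "vanish X (\<lambda>x. \<Sum>e<E. p e x * x k ^ e)"
      "\<exists>e<E. \<not> vanish X (p e)"
      unfolding powers_free_def by blast
    obtain M where M: "E = Suc M" using p(3) by (cases E) auto
    have free: "powers_free X k M"
      using not_less_Least[of M "\<lambda>E. \<not> powers_free X k E"] M by (auto simp: E_def)
    have lead: "\<not> vanish X (p M)"
    proof
      assume v: "vanish X (p M)"
      then have "vanish X (\<lambda>x. \<Sum>e<M. p e x * x k ^ e)" using p(2) by (simp add: vanish_def M)
      with free p(1) have "\<forall>e<M. vanish X (p e)" unfolding powers_free_def M by auto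
      then show False using p(3) v by (auto simp: M less_Suc_eq)
    qed
    have "\<exists>Q a B. triangular X (Suc k) d (Suc m) Q a B"
    proof (rule triangular_algebraic[where p = p and M = M, OF t X _ _ _ lead free])
      show "k < c" using Suc.prems by simp
      show "p i \<in> pf k" if "i \<le> M" for i using p(1) that by (simp add: M)
      show "vanish X (\<lambda>x. \<Sum>i\<le>M. p i x * x k ^ i)"
        using p(2) by (simp add: M lessThan_Suc_atMost)
    qed
    then show ?thesis using dm by (metis add_Suc_right)
  qed
qed

text \<open>The two sides grow like \<open>j ^ k\<close> and \<open>j ^ d\<close>. At
  \<open>j = k * C\<close> the binomial coefficient is at least \<open>(C + 1) ^ k\<close>, and
  \<open>C\<close> is chosen such that the right side is at most \<open>C * (C + 1) ^ d\<close>;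
  this is impossible for \<open>k > d\<close>.\<close>

lemma binomial_growth_le:
  assumes "\<And>j. (j + k choose k) \<le> B * (L * j + 1) ^ d"
  shows "k \<le> d"
proof (rule ccontr)
  assume "\<not> k \<le> d"
  then obtain i where k: "k = d + Suc i" by (metis add_Suc_right less_imp_Suc_add not_le_imp_less)
  define C where "C = B * (L * k + 1) ^ d"
  have "(real (C + 1)) ^ k \<le> real (k * C + k choose k)"
  proof -
    have "(real (k * C + k) / real k) ^ k \<le> real (k * C + k choose k)"
      using binomial_ge_n_over_k_pow_k[of k "k * C + k", where 'a = real] by simp
    moreover have "real (k * C + k) / real k = real (C + 1)" using k by (simp add: field_simps)
    ultimately show ?thesis by simp
  qed
  then have "(C + 1) ^ k \<le> (k * C + k choose k)"
    by (metis (mono_tags, lifting) of_nat_le_iff of_nat_power)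
  also have "\<dots> \<le> B * (L * (k * C) + 1) ^ d" by (rule assms)
  also have "\<dots> \<le> B * ((L * k + 1) * (C + 1)) ^ d"
    by (intro mult_left_mono power_mono) (simp_all add: algebra_simps)
  also have "\<dots> = C * (C + 1) ^ d" by (simp only: C_def power_mult_distrib mult.assoc)
  finally have "(C + 1) ^ Suc i * (C + 1) ^ d \<le> C * (C + 1) ^ d"
    by (simp only: k power_add mult.commute)
  then have "0 < (C + 1) ^ d \<longrightarrow> (C + 1) ^ Suc i \<le> C" by (simp only: mult_le_cancel2)
  then have "(C + 1) ^ Suc i \<le> C" by simp
  moreover have "C + 1 \<le> (C + 1) ^ Suc i" by (rule self_le_power) simp_all
  ultimately show False by linarith
qed

text \<open>Multiplication by \<open>A\<close> carries the restrictions of the \<open>f i\<close> to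
  \<open>X\<close> into the span of \<open>F\<close>, because the equations vanish on
  \<open>X\<close>. By primeness it is injective there.\<close>

lemma reduces_indep_le:
  assumes r: "reduces X k D m Q A I F" and Q: "\<And>j. j < m \<Longrightarrow> vanish X (Q j)"
    and X: "prime_on (pf k) X" and A: "A \<in> pf k" "\<not> vanish X A"
    and f: "\<And>i. i < N \<Longrightarrow> f i \<in> box k D" and ind: "indep_on N X f"
  shows "N \<le> card I"
proof (rule ccontr)
  assume "\<not> N \<le> card I"
  have "\<forall>i\<in>{..<N}. \<exists>u. \<forall>x\<in>X. A x * f i x = (\<Sum>l\<in>I. u l * F l x)"
  proof
    fix i assume "i \<in> {..<N}"
    then obtain u q where "\<And>x. A x * f i x = (\<Sum>l\<in>I. u l * F l x) + (\<Sum>j<m. q j x * Q j x)"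
      using r f[of i] unfolding reduces_def by blast
    then show "\<exists>u. \<forall>x\<in>X. A x * f i x = (\<Sum>l\<in>I. u l * F l x)"
      using Q by (intro exI[of _ u]) (auto simp: vanish_def)
  qed
  then obtain u where u: "\<And>i x. i < N \<Longrightarrow> x \<in> X \<Longrightarrow> A x * f i x = (\<Sum>l\<in>I. u i l * F l x)"
    by (auto dest!: bchoice)
  have "finite I" using r by (simp add: reduces_def free_family_def)
  then obtain w where w: "\<exists>i\<in>{..<N}. w i \<noteq> 0" "\<And>l. l \<in> I \<Longrightarrow> (\<Sum>i<N. w i * u i l) = 0"
    using homogeneous_solution[of I "{..<N}" u] \<open>\<not> N \<le> card I\<close> by auto
  have "vanish X (\<lambda>x. A x * (\<Sum>i<N. w i * f i x))"
    unfolding vanish_def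
  proof
    fix x assume "x \<in> X"
    have "A x * (\<Sum>i<N. w i * f i x) = (\<Sum>i<N. w i * (A x * f i x))"
      by (simp add: sum_distrib_left mult_ac)
    also have "\<dots> = (\<Sum>i<N. \<Sum>l\<in>I. w i * u i l * F l x)"
      using u \<open>x \<in> X\<close> by (simp add: sum_distrib_left mult.assoc)
    also have "\<dots> = (\<Sum>l\<in>I. (\<Sum>i<N. w i * u i l) * F l x)"
      by (subst sum.swap) (simp add: sum_distrib_right)
    finally show "A x * (\<Sum>i<N. w i * f i x) = 0" by (simp add: w(2))
  qed
  moreover have "(\<lambda>x. \<Sum>i<N. w i * f i x) \<in> pf k"
    using f box_subset_pf by (intro poly_fun_sum poly_fun_scale) blast
  ultimately have "vanish X (\<lambda>x. \<Sum>i<N. w i * f i x)" using prime_onD[OF X A(1) _ _ A(2)] by blast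
  then show False using ind w(1) by (auto simp: indep_on_def)
qed

text \<open>Generation of the ideal of \<open>X\<close> on the open set where \<open>a\<close> is
  nonzero, with the denominator cleared by an \<open>A\<close> that may depend on
  \<open>g\<close>.\<close>

definition locally_generated :: "nat \<Rightarrow> (nat \<Rightarrow> complex) set \<Rightarrow> nat \<Rightarrow>
    (nat \<Rightarrow> (nat \<Rightarrow> complex) \<Rightarrow> complex) \<Rightarrow> ((nat \<Rightarrow> complex) \<Rightarrow> complex) \<Rightarrow> bool" where
  "locally_generated c X m Q a \<longleftrightarrow> (\<forall>g\<in>pf c. vanish X g \<longrightarrow>
     (\<exists>A\<in>pf c. (\<forall>x. a x \<noteq> 0 \<longrightarrow> A x \<noteq> 0) \<and>
       (\<exists>q. (\<forall>j<m. q j \<in> pf c) \<and> (\<forall>x. A x * g x = (\<Sum>j<m. q j x * Q j x)))))"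

text \<open>The lower and upper counts of independent functions on \<open>Y k\<close> give
  \<open>k \<le> d\<close>, where \<open>d + m = c\<close>. The equations generate because the
  normal form of a function vanishing on \<open>Y k\<close> vanishes there as well and is then
  identically \<open>0\<close>.\<close>

lemma chain_locally_few_equations:
  assumes prime: "\<And>i. i \<le> k \<Longrightarrow> prime_on (pf c) (Y i)"
    and sub: "\<And>i. i < k \<Longrightarrow> Y i \<subseteq> Y (Suc i)"
    and sep: "\<And>i. i < k \<Longrightarrow> \<exists>g\<in>pf c. vanish (Y i) g \<and> \<not> vanish (Y (Suc i)) g"
  shows "\<exists>m Q a. m + k \<le> c \<and> (\<forall>j<m. Q j \<in> pf c \<and> vanish (Y k) (Q j)) \<and> a \<in> pf c \<and> \<not> vanish (Y k) a \<and>
    locally_generated c (Y k) m Q a"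
proof -
  have X: "prime_on (pf c) (Y k)" by (rule prime) simp
  obtain d m Q a B where dm: "d + m = c" and t: "triangular (Y k) c d m Q a B"
    using triangular_exists[OF X order_refl] by blast
  have Q: "\<And>j. j < m \<Longrightarrow> Q j \<in> pf c \<and> vanish (Y k) (Q j)" and a: "a \<in> pf c" "\<not> vanish (Y k) a"
    and red: "\<And>D. \<exists>A\<in>pf c. (\<forall>x. a x \<noteq> 0 \<longrightarrow> A x \<noteq> 0) \<and>
       (\<exists>I F. card I \<le> B * (D + 1) ^ d \<and> reduces (Y k) c D m Q A I F)"
    using t unfolding triangular_def by blast+
  obtain L where L: "\<And>j. \<exists>N f. (j + k choose k) \<le> N \<and> (\<forall>i<N. f i \<in> box c (L * j)) \<and> indep_on N (Y k) f"
    using chain_hilbert_lower_bound[of k c Y, OF prime sub sep] by blast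
  have "(j + k choose k) \<le> B * (L * j + 1) ^ d" for j
  proof -
    obtain N f where f: "(j + k choose k) \<le> N" "\<And>i. i < N \<Longrightarrow> f i \<in> box c (L * j)" "indep_on N (Y k) f"
      using L by blast
    obtain A I F where A: "A \<in> pf c" "\<And>x. a x \<noteq> 0 \<Longrightarrow> A x \<noteq> 0"
      "card I \<le> B * (L * j + 1) ^ d" "reduces (Y k) c (L * j) m Q A I F"
      using red[of "L * j"] by blast
    have "\<not> vanish (Y k) A" using a(2) A(2) by (auto simp: vanish_def)
    then have "N \<le> card I" using reduces_indep_le[OF A(4) _ X A(1) _ f(2,3)] Q by blast
    then show ?thesis using f(1) A(3) by linarith
  qed
  then have "k \<le> d" by (rule binomial_growth_le)
  moreover have "locally_generated c (Y k) m Q a"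
    unfolding locally_generated_def
  proof (intro ballI impI)
    fix g assume g: "g \<in> pf c" "vanish (Y k) g"
    obtain D where D: "g \<in> box c D" using pf_in_box[OF g(1)] by blast
    obtain A I F where A: "A \<in> pf c" "\<forall>x. a x \<noteq> 0 \<longrightarrow> A x \<noteq> 0" and r: "reduces (Y k) c D m Q A I F"
      using red[of D] by blast
    obtain u q where q: "\<forall>j<m. q j \<in> pf c"
      and eq: "\<And>x. A x * g x = (\<Sum>i\<in>I. u i * F i x) + (\<Sum>j<m. q j x * Q j x)"
      using r D unfolding reduces_def by blast
    have "vanish (Y k) (\<lambda>x. \<Sum>i\<in>I. u i * F i x)"
      unfolding vanish_def
    proof
      fix x assume "x \<in> Y k"
      then have "g x = 0" "(\<Sum>j<m. q j x * Q j x) = 0" using g(2) Q by (auto simp: vanish_def)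
      then show "(\<Sum>i\<in>I. u i * F i x) = 0" using eq[of x] by simp
    qed
    then have "(\<Sum>i\<in>I. u i * F i x) = 0" for x using r unfolding reduces_def free_family_def by blast
    then show "\<exists>A\<in>pf c. (\<forall>x. a x \<noteq> 0 \<longrightarrow> A x \<noteq> 0) \<and>
       (\<exists>q. (\<forall>j<m. q j \<in> pf c) \<and> (\<forall>x. A x * g x = (\<Sum>j<m. q j x * Q j x)))"
      using A q eq by (intro bexI[of _ A] conjI exI[of _ q]) simp_all
  qed
  ultimately show ?thesis using Q a dm by (intro exI[of _ m] exI[of _ Q] exI[of _ a]) auto
qed

section \<open>Tangent spaces and determinants\<close>

text \<open>\<open>l\<close> is the gradient at \<open>x\<close>. That it does not depend on
  \<open>v\<close> makes tangency a system of linear conditions.\<close>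

lemma poly_fun_derivative:
  assumes "g \<in> pf c"
  shows "\<exists>l. \<forall>v. ((\<lambda>t. g (\<lambda>i. x i + t * v i)) has_field_derivative dot c l v) (at 0)"
  using assms
proof (induction rule: poly_fun.induct)
  case (coord g)
  then obtain k where k: "k < c" "g = (\<lambda>x. x k)" by blast
  have "((\<lambda>t. x k + t * v k) has_field_derivative v k) (at 0)" for v :: "nat \<Rightarrow> complex"
    by (auto intro!: derivative_eq_intros)
  moreover have "dot c (unitf k) v = v k" for v
    by (subst dot_commute) (simp add: dot_unit k(1))
  ultimately show ?case by (intro exI[of _ "unitf k"]) (simp add: k(2))
next
  case (const z)
  show ?case by (intro exI[of _ "\<lambda>_. 0"]) (simp add: dot_def)
next
  case (add p q)
  then obtain l l' where
    "\<And>v. ((\<lambda>t. p (\<lambda>i. x i + t * v i)) has_field_derivative dot c l v) (at 0)"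
    "\<And>v. ((\<lambda>t. q (\<lambda>i. x i + t * v i)) has_field_derivative dot c l' v) (at 0)" by blast
  then have "((\<lambda>t. p (\<lambda>i. x i + t * v i) + q (\<lambda>i. x i + t * v i)) has_field_derivative
      dot c (\<lambda>i. l i + l' i) v) (at 0)" for v
    by (subst dot_commute, subst dot_add, subst (1 2) dot_commute[of _ v]) (intro DERIV_add)
  then show ?case by blast
next
  case (mult p q)
  then obtain l l' where
    D: "\<And>v. ((\<lambda>t. p (\<lambda>i. x i + t * v i)) has_field_derivative dot c l v) (at 0)"
    "\<And>v. ((\<lambda>t. q (\<lambda>i. x i + t * v i)) has_field_derivative dot c l' v) (at 0)" by blast
  have "((\<lambda>t. p (\<lambda>i. x i + t * v i) * q (\<lambda>i. x i + t * v i)) has_field_derivative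
      dot c (\<lambda>i. q x * l i + p x * l' i) v) (at 0)" for v
  proof -
    have "dot c (\<lambda>i. q x * l i + p x * l' i) v = dot c l v * q x + dot c l' v * p x"
      by (subst dot_commute) (simp add: dot_add dot_scale dot_commute[of _ v])
    then show ?thesis using DERIV_mult[OF D[of v]] by simp
  qed
  then show ?case by blast
qed

text \<open>Differentiating \<open>A * g = (\<Sum>j<m. q j * Q j)\<close> at a point of
  \<open>Y k\<close>, where \<open>g\<close> and all \<open>Q j\<close> vanish, expresses
  \<open>A x\<close> times the derivative of \<open>g\<close> by the derivatives of the
  \<open>Q j\<close>. Their gradients, at most \<open>n\<close> of them, thus decide tangency
  wherever \<open>a\<close> is nonzero.\<close>

theorem chain_tangent_space:
  assumes prime: "\<And>i. i \<le> k \<Longrightarrow> prime_on (pf c) (Y i)"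
    and sub: "\<And>i. i < k \<Longrightarrow> Y i \<subseteq> Y (Suc i)"
    and sep: "\<And>i. i < k \<Longrightarrow> \<exists>g\<in>pf c. vanish (Y i) g \<and> \<not> vanish (Y (Suc i)) g"
    and codim: "c \<le> k + n"
  shows "\<exists>a\<in>pf c. \<not> vanish (Y k) a \<and> (\<forall>x\<in>Y k. a x \<noteq> 0 \<longrightarrow>
    (\<exists>l. \<forall>v. (\<forall>j<n. dot c (l j) v = 0) \<longrightarrow> (\<forall>g\<in>pf c. vanish (Y k) g \<longrightarrow>
       ((\<lambda>t. g (\<lambda>i. x i + t * v i)) has_field_derivative 0) (at 0))))"
proof -
  obtain m Q a where mk: "m + k \<le> c" and Q: "\<And>j. j < m \<Longrightarrow> Q j \<in> pf c \<and> vanish (Y k) (Q j)"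
    and a: "a \<in> pf c" "\<not> vanish (Y k) a"
    and gen: "locally_generated c (Y k) m Q a"
    using chain_locally_few_equations[of k c Y, OF prime sub sep] by blast
  have "\<exists>l. \<forall>v. (\<forall>j<n. dot c (l j) v = 0) \<longrightarrow> (\<forall>g\<in>pf c. vanish (Y k) g \<longrightarrow>
       ((\<lambda>t. g (\<lambda>i. x i + t * v i)) has_field_derivative 0) (at 0))"
    if x: "x \<in> Y k" "a x \<noteq> 0" for x
  proof -
    have "\<forall>j\<in>{..<m}. \<exists>l. \<forall>v. ((\<lambda>t. Q j (\<lambda>i. x i + t * v i)) has_field_derivative dot c l v) (at 0)"
      using Q poly_fun_derivative by blast
    \<comment> \<open>Here \<open>m \<le> n\<close>. For \<open>m \<le> j < n\<close> the functional
      \<open>l j\<close> is arbitrary and only adds conditions on \<open>v\<close>.\<close>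
    from bchoice[OF this] obtain l where l: "\<And>j v. j < m \<Longrightarrow>
        ((\<lambda>t. Q j (\<lambda>i. x i + t * v i)) has_field_derivative dot c (l j) v) (at 0)" by auto
    have "((\<lambda>t. g (\<lambda>i. x i + t * v i)) has_field_derivative 0) (at 0)"
      if v: "\<forall>j<n. dot c (l j) v = 0" and g: "g \<in> pf c" "vanish (Y k) g" for v g
    proof -
      obtain A q where A: "A \<in> pf c" "A x \<noteq> 0" and q: "\<And>j. j < m \<Longrightarrow> q j \<in> pf c"
        and eq: "\<And>x. A x * g x = (\<Sum>j<m. q j x * Q j x)"
        using gen g x(2) unfolding locally_generated_def by blast
      define z where "z = (\<lambda>t i. x i + t * v i)"
      have z0: "z 0 = x" by (simp add: z_def)
      obtain A' where A': "((\<lambda>t. A (z t)) has_field_derivative A') (at 0)"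
        unfolding z_def using poly_fun_derivative[OF A(1)] by blast
      obtain g' where g': "((\<lambda>t. g (z t)) has_field_derivative g') (at 0)"
        unfolding z_def using poly_fun_derivative[OF g(1)] by blast
      have "((\<lambda>t. q j (z t) * Q j (z t)) has_field_derivative 0) (at 0)" if j: "j < m" for j
      proof -
        have "j < n" using j mk codim by linarith
        then have "dot c (l j) v = 0" using v by blast
        then have DQ: "((\<lambda>t. Q j (z t)) has_field_derivative 0) (at 0)"
          using l[OF j, of v] unfolding z_def by simp
        obtain q' where q': "((\<lambda>t. q j (z t)) has_field_derivative q') (at 0)"
          unfolding z_def using poly_fun_derivative[OF q[OF j]] by blast
        have "Q j x = 0" using Q[OF j] x(1) by (auto simp: vanish_def)
        then show ?thesis using DERIV_mult[OF q' DQ] by (simp add: z0)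
      qed
      then have "((\<lambda>t. \<Sum>j<m. q j (z t) * Q j (z t)) has_field_derivative (\<Sum>j<m. 0)) (at 0)"
        by (intro DERIV_sum) simp
      then have "((\<lambda>t. A (z t) * g (z t)) has_field_derivative 0) (at 0)" by (simp add: eq)
      moreover have "((\<lambda>t. A (z t) * g (z t)) has_field_derivative A x * g') (at 0)"
        using DERIV_mult[OF A' g'] g(2) x(1) by (simp add: z0 vanish_def mult.commute)
      ultimately have "A x * g' = 0" using DERIV_unique by blast
      then show ?thesis using g' A(2) by (simp add: z_def)
    qed
    then show ?thesis by blast
  qed
  then show ?thesis using a by blast
qed

text \<open>The transposition lets permutations act on the first index and turns a linear relation
  among the rows of \<open>F\<close> into a kernel vector.\<close>

definition fdet :: "nat \<Rightarrow> (nat \<Rightarrow> nat \<Rightarrow> complex) \<Rightarrow> complex" where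
  "fdet n F = det (mat n n (\<lambda>(i, j). F j i))"

lemma fdet_eq: "fdet n F = (\<Sum>p | p permutes {0..<n}. signof p * (\<Prod>i = 0..<n. F (p i) i))"
proof -
  have "(\<Prod>i = 0..<n. mat n n (\<lambda>(i, j). F j i) $$ (i, p i)) = (\<Prod>i = 0..<n. F (p i) i)"
    if "p permutes {0..<n}" for p
    using permutes_in_image[OF that] by (intro prod.cong) auto
  then show ?thesis
    unfolding fdet_def by (subst det_def'[of _ n]) (auto intro!: sum.cong)
qed

lemma fdet_dependent:
  assumes "i < n" and "u i \<noteq> 0" and "\<And>q. q < n \<Longrightarrow> (\<Sum>p<n. u p * F p q) = 0"
  shows "fdet n F = 0"
proof -
  have "mat n n (\<lambda>(i, j). F j i) *\<^sub>v vec n u = 0\<^sub>v n"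
    using assms(3) by (intro eq_vecI) (auto simp: scalar_prod_def mult.commute lessThan_atLeast0)
  moreover have "vec n u \<noteq> 0\<^sub>v n" using assms(1,2) by (metis index_vec index_zero_vec(1))
  ultimately show ?thesis
    unfolding fdet_def
    by (subst det_0_iff_vec_prod_zero_field[of _ n]) (auto intro!: exI[of _ "vec n u"])
qed

lemma fdet_unit:
  assumes "\<And>p q. p < n \<Longrightarrow> q < n \<Longrightarrow> F p q = (if p = q then 1 else 0)"
  shows "fdet n F = 1"
proof -
  have "mat n n (\<lambda>(i, j). F j i) = 1\<^sub>m n" using assms by (intro eq_matI) auto
  then show ?thesis by (simp add: fdet_def)
qed

lemma permutes_eq_id:
  assumes p: "p permutes {0..<Suc n}" and "\<And>i. i < n \<Longrightarrow> p i = i"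
  shows "p = id"
proof
  fix i
  show "p i = id i"
  proof (cases "i = n")
    case True
    have "p n < Suc n" using permutes_in_image[OF p, of n] by simp
    moreover have "p n \<noteq> j" if "j < n" for j
      using assms(2)[OF that] permutes_inj[OF p] that by (metis injD less_irrefl)
    ultimately show ?thesis using True by (metis id_apply less_Suc_eq)
  next
    case False
    then show ?thesis using assms(2) permutes_not_in[OF p, of i] by (cases "i < n") auto
  qed
qed

text \<open>\<open>G0\<close> is the identity with its last diagonal entry replaced by
  \<open>0\<close>, so in every summand of the Leibniz formula the factor with second index
  \<open>n\<close> is a multiple of \<open>t\<close>. Dividing by \<open>t\<close> leaves
  \<open>H\<close>, and in \<open>H 0\<close> only the identity permutation survives.\<close>

lemma fdet_derivative:
  assumes G0: "\<And>i j. i \<le> n \<Longrightarrow> j \<le> n \<Longrightarrow> G0 i j = (if i = j \<and> i < n then 1 else 0)"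
  shows "((\<lambda>t. fdet (Suc n) (\<lambda>i j. G0 i j + t * G1 i j)) has_field_derivative G1 n n) (at 0)"
proof -
  define P where "P = {p. p permutes {0..<Suc n}}"
  define H where "H = (\<lambda>t. \<Sum>p\<in>P. signof p * (\<Prod>i = 0..<n. G0 (p i) i + t * G1 (p i) i) * G1 (p n) n)"
  have P: "p i \<le> n" if "p \<in> P" "i \<le> n" for p i
    using permutes_in_image[of p "{0..<Suc n}" i] that by (simp add: P_def less_Suc_eq_le)
  have finP: "finite P" by (simp add: P_def finite_permutations)
  have factor: "fdet (Suc n) (\<lambda>i j. G0 i j + t * G1 i j) = t * H t" for t
  proof -
    have "fdet (Suc n) (\<lambda>i j. G0 i j + t * G1 i j)
        = (\<Sum>p\<in>P. signof p * (\<Prod>i = 0..<n. G0 (p i) i + t * G1 (p i) i) * (t * G1 (p n) n))"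
      unfolding fdet_eq P_def[symmetric]
      using P by (intro sum.cong) (auto simp: G0)
    then show ?thesis by (simp add: H_def sum_distrib_left mult_ac)
  qed
  have "H 0 = (\<Sum>p\<in>P. if p = id then G1 n n else 0)"
    unfolding H_def
  proof (intro sum.cong refl)
    fix p assume p: "p \<in> P"
    show "signof p * (\<Prod>i = 0..<n. G0 (p i) i + 0 * G1 (p i) i) * G1 (p n) n = (if p = id then G1 n n else 0)"
    proof (cases "p = id")
      case True
      then show ?thesis by (simp add: G0 signof_id)
    next
      case False
      then obtain i where i: "i < n" "p i \<noteq> i" using permutes_eq_id[of p n] p by (auto simp: P_def)
      then have "G0 (p i) i = 0" using P[OF p, of i] by (simp add: G0)
      then have "(\<Prod>i = 0..<n. G0 (p i) i + 0 * G1 (p i) i) = 0" using i(1) by (intro prod_zero) auto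
      then show ?thesis using False by simp
    qed
  qed
  also have "\<dots> = G1 n n" using finP by (simp add: P_def permutes_id)
  finally have H0: "H 0 = G1 n n" .
  have "isCont H 0" unfolding H_def by (intro continuous_intros)
  then show ?thesis
    unfolding factor CARAT_DERIV by (intro exI[of _ H]) (simp add: H0)
qed

section \<open>Linear matrices and their Gram determinants\<close>

definition pencil :: "nat \<Rightarrow> (nat \<Rightarrow> nat \<Rightarrow> nat \<Rightarrow> complex) \<Rightarrow> (nat \<Rightarrow> complex) \<Rightarrow> nat \<Rightarrow> nat \<Rightarrow> complex" where
  "pencil c T x i j = (\<Sum>k<c. x k * T k i j)"

lemma bil_pencil: "bil a b (pencil c T x) y z = dot c x (\<lambda>k. bil a b (T k) y z)"
proof -
  have "bil a b (pencil c T x) y z = (\<Sum>i<a. \<Sum>j<b. \<Sum>k<c. x k * (y i * T k i j * z j))"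
    by (simp add: bil_def pencil_def sum_distrib_left sum_distrib_right mult_ac)
  also have "\<dots> = (\<Sum>k<c. \<Sum>i<a. \<Sum>j<b. x k * (y i * T k i j * z j))"
    by (simp only: sum.swap[of _ _ "{..<c}"])
  finally show ?thesis by (simp add: bil_def dot_def sum_distrib_left)
qed

lemma bil_pencil_line:
  "bil a b (pencil c T (\<lambda>i. x i + t * v i)) y z
     = bil a b (pencil c T x) y z + t * bil a b (pencil c T v) y z"
  by (simp add: bil_pencil dot_commute[of c _ "\<lambda>k. bil a b (T k) y z"] dot_add dot_scale)

abbreviation gram :: "nat \<Rightarrow> nat \<Rightarrow> nat \<Rightarrow> (nat \<Rightarrow> nat \<Rightarrow> complex) \<Rightarrow>
    (nat \<Rightarrow> nat \<Rightarrow> complex) \<Rightarrow> (nat \<Rightarrow> nat \<Rightarrow> complex) \<Rightarrow> complex" where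
  "gram a b k m Y Z \<equiv> fdet k (\<lambda>p q. bil a b m (Y p) (Z q))"

lemma gram_pf: "(\<lambda>x. gram a b k (pencil c T x) Y Z) \<in> pf c"
proof -
  have "(\<lambda>x. bil a b (pencil c T x) y z) \<in> pf c" for y z
    unfolding bil_pencil dot_def
    by (intro poly_fun_sum poly_fun.mult poly_fun.const pf_coord) simp
  then show ?thesis
    unfolding fdet_eq by (intro poly_fun_sum poly_fun_scale poly_fun_prod)
qed

lemma gram_eq_0: "rk_le a b s m \<Longrightarrow> s < k \<Longrightarrow> gram a b k m Y Z = 0"
  using rk_le_dependent[of a b s m k Y] fdet_dependent[of _ k _ "\<lambda>p q. bil a b m (Y p) (Z q)"] by blast

lemma gram_eq_1: "dual_sys a b k m Y Z \<Longrightarrow> gram a b k m Y Z = 1"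
  by (rule fdet_unit) (simp add: dual_sys_def)

text \<open>Bordering a dual system at \<open>x\<close> by vectors of the left and right kernel
  gives an identity block with one zero appended. So if all determinants of size
  \<open>s + 1\<close> vanish on \<open>X\<close>, a tangent direction pairs the left kernel
  trivially with the right kernel, that is, it maps the kernel into the image.\<close>

lemma gram_line_derivative:
  assumes d: "dual_sys a b s (pencil c T x) Y Z"
    and y: "\<And>z. bil a b (pencil c T x) y z = 0" and z: "\<And>y. bil a b (pencil c T x) y z = 0"
  shows "((\<lambda>t. gram a b (Suc s) (pencil c T (\<lambda>i. x i + t * v i)) (Y(s := y)) (Z(s := z)))
    has_field_derivative bil a b (pencil c T v) y z) (at 0)"
proof -
  have "((\<lambda>t. gram a b (Suc s) (pencil c T (\<lambda>i. x i + t * v i)) (Y(s := y)) (Z(s := z)))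
    has_field_derivative bil a b (pencil c T v) ((Y(s := y)) s) ((Z(s := z)) s)) (at 0)"
    unfolding bil_pencil_line
    by (rule fdet_derivative) (use d y z in \<open>auto simp: dual_sys_def\<close>)
  then show ?thesis by simp
qed

section \<open>Pencils of bounded rank\<close>

text \<open>A larger rank at one point makes some Gram determinant nonzero there, while its product
  with \<open>a\<close> vanishes on all of \<open>X\<close>; primeness excludes this.\<close>

lemma rk_le_generic:
  assumes X: "prime_on (pf c) X" and a: "a \<in> pf c" "\<not> vanish X a"
    and U: "\<And>x. x \<in> X \<Longrightarrow> a x \<noteq> 0 \<Longrightarrow> rk_le m n k (pencil c T x)" and "x \<in> X"
  shows "rk_le m n k (pencil c T x)"
  unfolding rk_le_iff_no_dual_sys
proof (intro allI notI)
  fix Y Z assume d: "dual_sys m n (Suc k) (pencil c T x) Y Z"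
  have "vanish X (\<lambda>x. a x * gram m n (Suc k) (pencil c T x) Y Z)"
    using U gram_eq_0 unfolding vanish_def by fastforce
  then have "vanish X (\<lambda>x. gram m n (Suc k) (pencil c T x) Y Z)"
    using prime_onD[OF X a(1) gram_pf _ a(2)] by blast
  then show False using gram_eq_1[OF d] \<open>x \<in> X\<close> by (auto simp: vanish_def)
qed

text \<open>\<open>\<mu>\<close> is the Gram determinant of a dual system at one point of maximal
  rank. Where it is nonzero the rank is at least \<open>s\<close>, and the dual system witnessing
  this may vary with the point.\<close>

lemma generic_rank:
  assumes "\<And>x. x \<in> X \<Longrightarrow> rk_le a b r (pencil c T x)" and "X \<noteq> {}"
  shows "\<exists>s\<le>r. (\<forall>x\<in>X. rk_le a b s (pencil c T x)) \<and>
    (\<exists>\<mu>\<in>pf c. \<not> vanish X \<mu> \<and> (\<forall>x. \<mu> x \<noteq> 0 \<longrightarrow> (\<exists>Y Z. dual_sys a b s (pencil c T x) Y Z)))"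
proof -
  define s where "s = (LEAST s. \<forall>x\<in>X. rk_le a b s (pencil c T x))"
  have s: "\<forall>x\<in>X. rk_le a b s (pencil c T x)"
    unfolding s_def by (rule LeastI[of _ r]) (use assms(1) in blast)
  have "s \<le> r" unfolding s_def by (rule Least_le) (use assms(1) in blast)
  moreover have "\<exists>\<mu>\<in>pf c. \<not> vanish X \<mu> \<and> (\<forall>x. \<mu> x \<noteq> 0 \<longrightarrow> (\<exists>Y Z. dual_sys a b s (pencil c T x) Y Z))"
  proof (cases s)
    case 0
    then show ?thesis using \<open>X \<noteq> {}\<close>
      by (intro bexI[of _ "\<lambda>_. 1"]) (auto simp: vanish_def dual_sys_def poly_fun.const)
  next
    case (Suc k)
    then obtain x where "x \<in> X" "\<not> rk_le a b k (pencil c T x)"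
      using not_less_Least[of k "\<lambda>s. \<forall>x\<in>X. rk_le a b s (pencil c T x)"] by (auto simp: s_def)
    then obtain Y Z where d: "dual_sys a b s (pencil c T x) Y Z"
      unfolding rk_le_iff_no_dual_sys Suc by blast
    have "\<exists>Y Z. dual_sys a b s (pencil c T x) Y Z" if "gram a b s (pencil c T x) Y Z \<noteq> 0" for x
    proof -
      have "\<not> rk_le a b k (pencil c T x)" using that gram_eq_0[of a b k _ s] Suc by auto
      then show ?thesis unfolding rk_le_iff_no_dual_sys Suc by blast
    qed
    moreover have "\<not> vanish X (\<lambda>x. gram a b s (pencil c T x) Y Z)"
      using gram_eq_1[OF d] \<open>x \<in> X\<close> by (auto simp: vanish_def intro!: bexI[of _ x])
    ultimately show ?thesis
      by (intro bexI[of _ "\<lambda>x. gram a b s (pencil c T x) Y Z"] gram_pf) blast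
  qed
  ultimately show ?thesis using s by blast
qed

text \<open>By \<open>ker\<close>, the vector \<open>w\<close> lies in the image of
  \<open>m\<close>, and the projection along \<open>w\<close> to the kernel of \<open>\<phi>\<close>
  kills it. A dual system of size \<open>s\<close> for the result would, corrected by multiples of
  \<open>\<phi>\<close>, be one for \<open>m\<close> with all \<open>Y' p\<close> orthogonal to
  \<open>w\<close>. Expanding \<open>\<phi>\<close> in it gives a left kernel vector
  \<open>y\<close> with \<open>dot a y w = 1\<close>, against \<open>ker\<close>.\<close>

lemma rk_le_project_out:
  assumes r: "rk_le a b s m" and d: "dual_sys a b s m Y0 Z0" and w: "dot a \<phi> w = 1"
    and ker: "\<And>y. (\<And>z. bil a b m y z = 0) \<Longrightarrow> dot a y w = 0"
  shows "s \<noteq> 0" and "rk_le a b (s - 1) (\<lambda>i j. m i j - w i * (\<Sum>l<a. \<phi> l * m l j))"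
proof -
  show s: "s \<noteq> 0"
  proof
    assume "s = 0"
    then have "bil a b m \<phi> z = 0" for z using rk_le_expand[OF r d] by simp
    then show False using ker[of \<phi>] w by simp
  qed
  define m' where "m' = (\<lambda>i j. m i j - w i * (\<Sum>l<a. \<phi> l * m l j))"
  have bil': "bil a b m' y z = bil a b m (\<lambda>i. y i - dot a y w * \<phi> i) z" for y z
  proof -
    have "bil a b m' y z = bil a b m y z - dot a y w * bil a b m \<phi> z"
    proof -
      have "bil a b m' y z = (\<Sum>i<a. \<Sum>j<b. y i * m i j * z j)
          - (\<Sum>i<a. \<Sum>j<b. y i * w i * ((\<Sum>l<a. \<phi> l * m l j) * z j))"
        by (simp add: bil_def m'_def algebra_simps sum_subtractf)
      also have "(\<Sum>i<a. \<Sum>j<b. y i * w i * ((\<Sum>l<a. \<phi> l * m l j) * z j))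
          = dot a y w * (\<Sum>j<b. (\<Sum>l<a. \<phi> l * m l j) * z j)"
        by (simp add: dot_def sum_product)
      also have "(\<Sum>j<b. (\<Sum>l<a. \<phi> l * m l j) * z j) = bil a b m \<phi> z"
        unfolding bil_def by (subst sum.swap) (simp add: sum_distrib_right)
      finally show ?thesis by (simp add: bil_def)
    qed
    then show ?thesis by (simp only: bil_diff_left bil_scale_left)
  qed
  have "rk_le a b (s - 1) m'"
    unfolding rk_le_iff_no_dual_sys
  proof (intro allI notI)
    fix Y Z assume "dual_sys a b (Suc (s - 1)) m' Y Z"
    then have d': "dual_sys a b s m' Y Z" using s by simp
    define Y' where "Y' = (\<lambda>p i. Y p i - dot a (Y p) w * \<phi> i)"
    have dY: "dual_sys a b s m Y' Z" using d' by (simp add: dual_sys_def bil' Y'_def)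
    have Yw: "dot a (Y' p) w = 0" for p
      unfolding Y'_def using w
      by (subst dot_commute) (simp add: dot_diff dot_scale dot_commute[of _ w])
    define y where "y = (\<lambda>i. \<phi> i - (\<Sum>p<s. bil a b m \<phi> (Z p) * Y' p i))"
    have "bil a b m y z = 0" for z
      unfolding y_def
      by (simp only: bil_diff_left bil_sum_left rk_le_expand[OF r dY, of \<phi> z]) simp
    then have "dot a y w = 0" by (rule ker)
    moreover have "dot a y w = 1"
      unfolding y_def using w Yw
      by (subst dot_commute) (simp add: dot_diff dot_sum dot_commute[of _ w])
    ultimately show False by simp
  qed
  then show "rk_le a b (s - 1) (\<lambda>i j. m i j - w i * (\<Sum>l<a. \<phi> l * m l j))" by (simp add: m'_def)
qed

text \<open>The set is the image of \<open>m\<close>, described as the annihilator of the left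
  kernel. It is spanned by \<open>m\<close> applied to the \<open>Z p\<close>.\<close>

lemma dim_le_image:
  assumes r: "rk_le a b s m" and d: "dual_sys a b s m Y Z"
  shows "dim_le a {w. \<forall>y. (\<forall>z. bil a b m y z = 0) \<longrightarrow> dot a y w = 0} s"
proof (rule dim_le_spanned[of "{..<s}" _ _ _ "\<lambda>p i. \<Sum>j<b. m i j * Z p j"])
  fix w assume w: "w \<in> {w. \<forall>y. (\<forall>z. bil a b m y z = 0) \<longrightarrow> dot a y w = 0}"
  have "w i = (\<Sum>p<s. dot a (Y p) w * (\<Sum>j<b. m i j * Z p j))" if i: "i < a" for i
  proof -
    define y where "y = (\<lambda>l. unitf i l - (\<Sum>p<s. bil a b m (unitf i) (Z p) * Y p l))"
    have "bil a b m y z = 0" for z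
      unfolding y_def by (simp only: bil_diff_left bil_sum_left rk_le_expand[OF r d, of "unitf i" z]) simp
    then have "dot a w y = 0" using w by (subst dot_commute) blast
    then have "w i = (\<Sum>p<s. bil a b m (unitf i) (Z p) * dot a w (Y p))"
      unfolding y_def using i by (simp add: dot_diff dot_sum dot_unit)
    then show ?thesis using i by (simp add: bil_unit_left dot_commute[of _ w] mult.commute)
  qed
  then show "\<exists>\<gamma>. \<forall>i<a. w i = (\<Sum>p<s. \<gamma> p * (\<Sum>j<b. m i j * Z p j))"
    by (intro exI[of _ "\<lambda>p. dot a (Y p) w"] allI impI)
qed auto

text \<open>Each matrix of rank at most \<open>s\<close> imposes \<open>s\<close> linear equations
  on \<open>z\<close>, one for each term of its factorization.\<close>

lemma common_kernel_vector:
  assumes "finite S" and "\<And>x. x \<in> S \<Longrightarrow> rk_le a b s (N x)" and "card S * s < b"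
  shows "\<exists>z. (\<exists>j<b. z j \<noteq> 0) \<and> (\<forall>x\<in>S. \<forall>y. bil a b (N x) y z = 0)"
proof -
  have "\<forall>x\<in>S. \<exists>\<beta>. \<exists>\<alpha>. \<forall>i<a. \<forall>j<b. N x i j = (\<Sum>l<s. \<alpha> l i * \<beta> l j)"
    using assms(2) unfolding rk_le_def by blast
  from bchoice[OF this] obtain \<beta>
    where \<beta>: "\<forall>x\<in>S. \<exists>\<alpha>. \<forall>i<a. \<forall>j<b. N x i j = (\<Sum>l<s. \<alpha> l i * \<beta> x l j)" ..
  have "card (S \<times> {..<s}) < card {..<b}" using assms(3) by (simp add: card_cartesian_product)
  from homogeneous_solution[OF _ _ this, of "\<lambda>j (x, l). \<beta> x l j"] assms(1)
  obtain z where z: "\<exists>j\<in>{..<b}. z j \<noteq> 0"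
    "\<forall>xl\<in>S \<times> {..<s}. (\<Sum>j<b. z j * (case xl of (x, l) \<Rightarrow> \<beta> x l j)) = 0" by auto
  have "bil a b (N x) y z = 0" if "x \<in> S" for x y
  proof -
    obtain \<alpha> where "\<forall>i<a. \<forall>j<b. N x i j = (\<Sum>l<s. \<alpha> l i * \<beta> x l j)" using \<beta> \<open>x \<in> S\<close> by blast
    from rk_le_bil[OF this] have "bil a b (N x) y z = (\<Sum>l<s. dot a y (\<alpha> l) * dot b z (\<beta> x l))" .
    also have "\<dots> = 0" using z(2) \<open>x \<in> S\<close> by (intro sum.neutral) (auto simp: dot_def)
    finally show ?thesis .
  qed
  then show ?thesis using z(1) by auto
qed

lemma few_columns_or_common_image:
  assumes U: "U \<noteq> {}" "\<And>x. x \<in> U \<Longrightarrow> rk_le a b r (pencil c T x)"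
    and dual: "\<And>x. x \<in> U \<Longrightarrow> \<exists>s\<le>r. rk_le a b s (pencil c T x) \<and> (\<exists>Y Z. dual_sys a b s (pencil c T x) Y Z)"
    and tangent: "\<And>x. x \<in> U \<Longrightarrow> \<exists>l. \<forall>v. (\<forall>j<n. dot c (l j) v = 0) \<longrightarrow>
      (\<forall>y z. (\<forall>z. bil a b (pencil c T x) y z = 0) \<longrightarrow> (\<forall>y. bil a b (pencil c T x) y z = 0) \<longrightarrow>
        bil a b (pencil c T v) y z = 0)"
    and spanning: "\<And>\<phi>. \<exists>k<c. \<phi> k \<noteq> 0 \<Longrightarrow> \<exists>x\<in>U. dot c x \<phi> \<noteq> 0"
    and concise: "\<And>z. \<exists>j<b. z j \<noteq> 0 \<Longrightarrow> \<exists>v y. bil a b (pencil c T v) y z \<noteq> 0"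
  shows "b \<le> (r + 1) * (n + 1) * r \<or>
    (\<exists>w. (\<exists>i<a. w i \<noteq> 0) \<and> (\<forall>x\<in>U. \<forall>y. (\<forall>z. bil a b (pencil c T x) y z = 0) \<longrightarrow> dot a y w = 0))"
proof (rule ccontr)
  define N where "N = pencil c T"
  define L where "L = (\<lambda>x. {y. \<forall>z. bil a b (N x) y z = 0})"
  assume neg: "\<not> ?thesis"
  then have b: "(r + 1) * (n + 1) * r < b"
    and sepL: "\<And>w. \<exists>i<a. w i \<noteq> 0 \<Longrightarrow> \<exists>x\<in>U. \<exists>y\<in>L x. dot a y w \<noteq> 0"
    by (auto simp: L_def N_def)
  obtain x0 where x0: "x0 \<in> U" using U(1) by blast
  obtain s Y Z where s: "s \<le> r" "rk_le a b s (N x0)" "dual_sys a b s (N x0) Y Z"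
    using dual[OF x0] by (auto simp: N_def)
  \<comment> \<open>The image at \<open>x0\<close>. Its dimension is at most
    \<open>s \<le> r\<close>, so \<open>s\<close> further points reduce the common image to
    \<open>0\<close> and \<open>S\<close> has at most \<open>r + 1\<close> elements.\<close>
  define W where "W = {w. \<forall>y. (\<forall>z. bil a b (N x0) y z = 0) \<longrightarrow> dot a y w = 0}"
  have "dim_le a W s" unfolding W_def by (rule dim_le_image[OF s(2,3)])
  from dim_le_separate[OF this U(1), of L] sepL
  obtain xs where xs: "\<And>l. l < s \<Longrightarrow> xs l \<in> U"
    "\<And>w i. w \<in> W \<Longrightarrow> (\<forall>l<s. \<forall>y\<in>L (xs l). dot a y w = 0) \<Longrightarrow> i < a \<Longrightarrow> w i = 0" by blast
  define S where "S = insert x0 (xs ` {..<s})"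
  have S: "S \<subseteq> U" "finite S" using x0 xs(1) by (auto simp: S_def)
  have cardS: "card S \<le> r + 1"
    using card_insert_le_m1[of "s + 1" "xs ` {..<s}" x0] card_image_le[of "{..<s}" xs] s(1)
    by (simp add: S_def)
  have S0: "w i = 0" if "\<And>x y. x \<in> S \<Longrightarrow> y \<in> L x \<Longrightarrow> dot a y w = 0" "i < a" for w i
    using xs(2)[of w i] that by (auto simp: W_def S_def L_def)
  have "\<forall>x\<in>U. \<exists>l. \<forall>v. (\<forall>j<n. dot c (l j) v = 0) \<longrightarrow>
      (\<forall>y z. (\<forall>z. bil a b (N x) y z = 0) \<longrightarrow> (\<forall>y. bil a b (N x) y z = 0) \<longrightarrow> bil a b (N v) y z = 0)"
    using tangent by (simp add: N_def)
  from bchoice[OF this] obtain l where l: "\<And>x v y z. x \<in> U \<Longrightarrow> (\<And>j. j < n \<Longrightarrow> dot c (l x j) v = 0) \<Longrightarrow>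
      y \<in> L x \<Longrightarrow> (\<And>y. bil a b (N x) y z = 0) \<Longrightarrow> bil a b (N v) y z = 0"
    unfolding L_def by blast
  define J where "J = S \<times> {..<n}"
  define l' where "l' = (\<lambda>(x, j). l x j)"
  \<comment> \<open>The functionals vanishing on the intersection of the tangent spaces at
    \<open>S\<close>. They are spanned by the \<open>n\<close> functionals at each of these points,
    so \<open>(r + 1) * n\<close> points \<open>ys\<close> suffice to test them.\<close>
  define \<Psi> where "\<Psi> = {\<psi>. \<forall>v. (\<forall>xj\<in>J. dot c (l' xj) v = 0) \<longrightarrow> dot c \<psi> v = 0}"
  have "dim_le c \<Psi> ((r + 1) * n)"
  proof (rule dim_le_spanned)
    show "finite J" using S by (simp add: J_def)
    show "card J \<le> (r + 1) * n" using cardS by (simp add: J_def card_cartesian_product del: mult_Suc)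
    show "\<exists>\<gamma>. \<forall>k<c. \<psi> k = (\<Sum>j\<in>J. \<gamma> j * l' j k)" if "\<psi> \<in> \<Psi>" for \<psi>
      using functional_in_span[OF \<open>finite J\<close>, of c l' \<psi>] that by (auto simp: \<Psi>_def)
  qed
  then have "\<exists>ys. (\<forall>i<(r + 1) * n. ys i \<in> U) \<and>
      (\<forall>\<psi>\<in>\<Psi>. (\<forall>i<(r + 1) * n. \<forall>x\<in>{ys i}. dot c x \<psi> = 0) \<longrightarrow> (\<forall>k<c. \<psi> k = 0))"
    using spanning by (intro dim_le_separate[OF _ U(1)]) auto
  then obtain ys where ys: "\<And>i. i < (r + 1) * n \<Longrightarrow> ys i \<in> U"
    "\<And>\<psi> k. \<psi> \<in> \<Psi> \<Longrightarrow> (\<And>i. i < (r + 1) * n \<Longrightarrow> dot c (ys i) \<psi> = 0) \<Longrightarrow> k < c \<Longrightarrow> \<psi> k = 0"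
    by blast
  define S' where "S' = S \<union> ys ` {..<(r + 1) * n}"
  have "card S' \<le> (r + 1) * (n + 1)"
  proof -
    have "card S' \<le> card S + card (ys ` {..<(r + 1) * n})" unfolding S'_def by (rule card_Un_le)
    also have "\<dots> \<le> (r + 1) + (r + 1) * n"
      using cardS card_image_le[of "{..<(r + 1) * n}" ys] by simp
    finally show ?thesis by simp
  qed
  then have "card S' * r < b" using b mult_right_mono[of "card S'" "(r + 1) * (n + 1)" r] by linarith
  moreover have "finite S'" and S': "S' \<subseteq> U" using S ys(1) by (auto simp: S'_def)
  moreover have "rk_le a b r (N x)" if "x \<in> S'" for x using U(2) S' that by (auto simp: N_def)
  ultimately obtain z where z: "\<exists>j<b. z j \<noteq> 0" "\<And>x y. x \<in> S' \<Longrightarrow> bil a b (N x) y z = 0"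
    using common_kernel_vector[of S' a b r N] by blast
  have "bil a b (N v) y z = 0" for v y
  proof -
    \<comment> \<open>For fixed \<open>y\<close> and \<open>z\<close> the value of the form is
      linear in \<open>v\<close>. If \<open>v\<close> is tangent at every point of \<open>S\<close>,
      the vector \<open>N v\<close> applied to \<open>z\<close> is orthogonal to all left kernels
      there, so it lies in all images and is \<open>0\<close>. This puts \<open>\<psi>\<close> into
      \<open>\<Psi>\<close>, and the points \<open>ys\<close> then force it to vanish.\<close>
    define \<psi> where "\<psi> = (\<lambda>k. bil a b (T k) y z)"
    have \<psi>: "bil a b (N v) y z = dot c \<psi> v" for v
      unfolding N_def \<psi>_def by (subst dot_commute) (rule bil_pencil)
    have "dot c \<psi> v = 0" if v: "\<forall>xj\<in>J. dot c (l' xj) v = 0" for v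
    proof -
      have "(\<Sum>j<b. N v i j * z j) = 0" if "i < a" for i
      proof (rule S0[OF _ that])
        fix x y assume x: "x \<in> S" "y \<in> L x"
        then have "x \<in> U" "x \<in> S'" using S by (auto simp: S'_def)
        moreover have "dot c (l x j) v = 0" if "j < n" for j using v x that by (auto simp: J_def l'_def)
        ultimately have "bil a b (N v) y z = 0" using l x(2) z(2) by blast
        then show "dot a y (\<lambda>i. \<Sum>j<b. N v i j * z j) = 0" by (simp add: bil_left)
      qed
      then have "bil a b (N v) y z = 0" by (simp add: bil_left dot_def)
      then show ?thesis by (simp add: \<psi>)
    qed
    then have "\<psi> \<in> \<Psi>" by (auto simp: \<Psi>_def)
    moreover have "dot c (ys i) \<psi> = 0" if "i < (r + 1) * n" for i
    proof -
      have "ys i \<in> S'" using that by (auto simp: S'_def)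
      then show ?thesis using z(2)[of "ys i" y] by (subst dot_commute) (simp add: \<psi>)
    qed
    ultimately have "\<psi> k = 0" if "k < c" for k using ys(2) that by blast
    then show ?thesis by (simp add: \<psi> dot_def)
  qed
  then show False using concise[OF z(1)] by (auto simp: N_def)
qed

text \<open>The argument takes place on the open part \<open>U\<close> of \<open>X\<close> where the
  tangent bound holds and the rank is maximal. By primeness \<open>U\<close> still spans, and a rank
  bound obtained on \<open>U\<close> extends to \<open>X\<close>.\<close>

theorem few_columns_or_project:
  assumes prime: "\<And>i. i \<le> k \<Longrightarrow> prime_on (pf c) (Y i)"
    and sub: "\<And>i. i < k \<Longrightarrow> Y i \<subseteq> Y (Suc i)"
    and sep: "\<And>i. i < k \<Longrightarrow> \<exists>g\<in>pf c. vanish (Y i) g \<and> \<not> vanish (Y (Suc i)) g"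
    and codim: "c \<le> k + n"
    and rk: "\<And>x. x \<in> Y k \<Longrightarrow> rk_le a b r (pencil c T x)"
    and spanning: "\<And>\<phi>. \<exists>i<c. \<phi> i \<noteq> 0 \<Longrightarrow> \<exists>x\<in>Y k. dot c x \<phi> \<noteq> 0"
    and concise: "\<And>z. \<exists>j<b. z j \<noteq> 0 \<Longrightarrow> \<exists>v y. bil a b (pencil c T v) y z \<noteq> 0"
  shows "b \<le> (r + 1) * (n + 1) * r \<or>
    (\<exists>w \<phi>. dot a \<phi> w = 1 \<and> (\<forall>x\<in>Y k. rk_le a b (r - 1)
       (\<lambda>i j. pencil c T x i j - w i * (\<Sum>l<a. \<phi> l * pencil c T x l j))))"
proof -
  define X where "X = Y k"
  have X: "prime_on (pf c) X" unfolding X_def by (rule prime) simp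
  then have "X \<noteq> {}" by (simp add: prime_on_def)
  obtain \<rho> where \<rho>: "\<rho> \<in> pf c" "\<not> vanish X \<rho>"
    and tangent: "\<And>x. x \<in> X \<Longrightarrow> \<rho> x \<noteq> 0 \<Longrightarrow> \<exists>l. \<forall>v. (\<forall>j<n. dot c (l j) v = 0) \<longrightarrow>
      (\<forall>g\<in>pf c. vanish X g \<longrightarrow> ((\<lambda>t. g (\<lambda>i. x i + t * v i)) has_field_derivative 0) (at 0))"
    using chain_tangent_space[of k c Y n, OF prime sub sep codim] unfolding X_def by blast
  obtain s \<mu> where s: "s \<le> r" "\<And>x. x \<in> X \<Longrightarrow> rk_le a b s (pencil c T x)"
    and \<mu>: "\<mu> \<in> pf c" "\<not> vanish X \<mu>" "\<And>x. \<mu> x \<noteq> 0 \<Longrightarrow> \<exists>Y Z. dual_sys a b s (pencil c T x) Y Z"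
    using generic_rank[of X a b r c T] rk \<open>X \<noteq> {}\<close> unfolding X_def by blast
  define \<nu> where "\<nu> = (\<lambda>x. \<rho> x * \<mu> x)"
  have \<nu>: "\<nu> \<in> pf c" unfolding \<nu>_def using \<rho>(1) \<mu>(1) by (rule poly_fun.mult)
  have \<nu>_nz: "\<not> vanish X \<nu>"
    using prime_onD[OF X \<rho>(1) \<mu>(1) _ \<rho>(2)] \<mu>(2) unfolding \<nu>_def by blast
  define U where "U = {x \<in> X. \<nu> x \<noteq> 0}"
  have U: "x \<in> X" "\<rho> x \<noteq> 0" "\<mu> x \<noteq> 0" if "x \<in> U" for x using that by (auto simp: U_def \<nu>_def)
  have "b \<le> (r + 1) * (n + 1) * r \<or>
    (\<exists>w. (\<exists>i<a. w i \<noteq> 0) \<and> (\<forall>x\<in>U. \<forall>y. (\<forall>z. bil a b (pencil c T x) y z = 0) \<longrightarrow> dot a y w = 0))"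
  proof (rule few_columns_or_common_image)
    show "U \<noteq> {}" using \<nu>_nz by (auto simp: U_def vanish_def)
    show "rk_le a b r (pencil c T x)" if "x \<in> U" for x using rk U(1)[OF that] by (simp add: X_def)
    show "\<exists>s\<le>r. rk_le a b s (pencil c T x) \<and> (\<exists>Y Z. dual_sys a b s (pencil c T x) Y Z)" if "x \<in> U" for x
      using s(1) s(2)[OF U(1)[OF that]] \<mu>(3)[OF U(3)[OF that]] by blast
    show "\<exists>l. \<forall>v. (\<forall>j<n. dot c (l j) v = 0) \<longrightarrow>
      (\<forall>y z. (\<forall>z. bil a b (pencil c T x) y z = 0) \<longrightarrow> (\<forall>y. bil a b (pencil c T x) y z = 0) \<longrightarrow>
        bil a b (pencil c T v) y z = 0)" if x: "x \<in> U" for x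
    proof -
      obtain l where l: "\<And>v g. (\<forall>j<n. dot c (l j) v = 0) \<Longrightarrow> g \<in> pf c \<Longrightarrow> vanish X g \<Longrightarrow>
         ((\<lambda>t. g (\<lambda>i. x i + t * v i)) has_field_derivative 0) (at 0)"
        using tangent[OF U(1,2)[OF x]] by blast
      obtain Y' Z' where d: "dual_sys a b s (pencil c T x) Y' Z'" using \<mu>(3)[OF U(3)[OF x]] by blast
      have "bil a b (pencil c T v) y z = 0"
        if v: "\<forall>j<n. dot c (l j) v = 0"
          and y: "\<And>z. bil a b (pencil c T x) y z = 0" and z: "\<And>y. bil a b (pencil c T x) y z = 0" for v y z
      proof (rule DERIV_unique[OF gram_line_derivative[OF d y z]])
        \<comment> \<open>The bordered determinant vanishes on \<open>X\<close>, so its derivative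
          in a tangent direction is \<open>0\<close>; by \<open>gram_line_derivative\<close> this
          derivative is the pairing in question.\<close>
        have "vanish X (\<lambda>x. gram a b (Suc s) (pencil c T x) (Y'(s := y)) (Z'(s := z)))"
          unfolding vanish_def using gram_eq_0[OF s(2)] by blast
        from l[OF v gram_pf this]
        show "((\<lambda>t. gram a b (Suc s) (pencil c T (\<lambda>i. x i + t * v i)) (Y'(s := y)) (Z'(s := z)))
          has_field_derivative 0) (at 0)" .
      qed
      then show ?thesis by blast
    qed
    show "\<exists>x\<in>U. dot c x \<phi> \<noteq> 0" if \<phi>: "\<exists>i<c. \<phi> i \<noteq> 0" for \<phi>
    proof -
      have "\<not> vanish X (\<lambda>x. dot c x \<phi>)" using spanning[OF \<phi>] by (auto simp: vanish_def X_def)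
      moreover have "(\<lambda>x. dot c x \<phi>) \<in> pf c"
        unfolding dot_def by (intro poly_fun_sum poly_fun.mult poly_fun.const pf_coord) simp
      ultimately have "\<not> vanish X (\<lambda>x. \<nu> x * dot c x \<phi>)" using prime_onD[OF X \<nu> _ _ \<nu>_nz] by blast
      then show ?thesis by (auto simp: vanish_def U_def)
    qed
  qed (rule concise)
  then show ?thesis
  proof
    assume "\<exists>w. (\<exists>i<a. w i \<noteq> 0) \<and> (\<forall>x\<in>U. \<forall>y. (\<forall>z. bil a b (pencil c T x) y z = 0) \<longrightarrow> dot a y w = 0)"
    then obtain w i where i: "i < a" "w i \<noteq> 0"
      and w: "\<And>x y. x \<in> U \<Longrightarrow> (\<And>z. bil a b (pencil c T x) y z = 0) \<Longrightarrow> dot a y w = 0" by blast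
    define \<phi> where "\<phi> = (\<lambda>k. if k = i then 1 / w i else 0)"
    have \<phi>: "dot a \<phi> w = 1"
      unfolding \<phi>_def using i by (subst dot_commute) (simp add: dot_unit)
    \<comment> \<open>Projecting the coefficient matrices shows that the projected matrices form a
      pencil again, so that its Gram determinants are polynomial in \<open>x\<close>.\<close>
    define T' where "T' = (\<lambda>k i j. T k i j - w i * (\<Sum>l<a. \<phi> l * T k l j))"
    have T': "pencil c T' x = (\<lambda>i j. pencil c T x i j - w i * (\<Sum>l<a. \<phi> l * pencil c T x l j))" for x
    proof (intro ext)
      fix i j
      have "(\<Sum>k<c. x k * (\<Sum>l<a. \<phi> l * T k l j)) = (\<Sum>l<a. \<phi> l * pencil c T x l j)"
        unfolding pencil_def sum_distrib_left by (subst sum.swap) (simp add: mult.left_commute)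
      then show "pencil c T' x i j = pencil c T x i j - w i * (\<Sum>l<a. \<phi> l * pencil c T x l j)"
        by (simp add: pencil_def T'_def right_diff_distrib sum_subtractf mult.left_commute
            flip: sum_distrib_left)
    qed
    have "rk_le a b (r - 1) (pencil c T' x)" if "x \<in> X" for x
    proof (rule rk_le_generic[OF X \<nu> \<nu>_nz _ that])
      fix x assume "x \<in> X" "\<nu> x \<noteq> 0"
      then have x: "x \<in> U" by (simp add: U_def)
      obtain Y' Z' where d: "dual_sys a b s (pencil c T x) Y' Z'" using \<mu>(3)[OF U(3)[OF x]] by blast
      from rk_le_project_out(2)[OF s(2)[OF U(1)[OF x]] d \<phi> w[OF x]]
      have "rk_le a b (s - 1) (pencil c T' x)" by (simp add: T')
      then show "rk_le a b (r - 1) (pencil c T' x)" by (rule rk_le_mono) (use s(1) in simp)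
    qed
    then show ?thesis using \<phi> unfolding X_def T' by blast
  qed simp
qed

section \<open>Chains of primes and the Krull dimension\<close>

lemma closedin_zariski:
  "closedin (zariski G) Z \<longleftrightarrow> (\<exists>P \<subseteq> poly_fun G. Z = {x. \<forall>p\<in>P. p x = 0})"
proof -
  have "openin (zariski G) UNIV"
    unfolding openin_zariski by (intro exI[of _ "{\<lambda>_. 1}"]) (auto intro: poly_fun.const)
  then have "topspace (zariski G) = UNIV" using openin_subset by blast
  then show ?thesis unfolding closedin_def openin_zariski by (simp flip: Compl_eq_Diff_UNIV)
qed

lemma closedin_subtopology_zariski:
  "closedin (subtopology (zariski G) S) Y \<longleftrightarrow>
     Y \<subseteq> S \<and> (\<forall>x\<in>S - Y. \<exists>p\<in>poly_fun G. p x \<noteq> 0 \<and> vanish Y p)" (is "?L \<longleftrightarrow> ?R")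
proof
  assume ?L
  then obtain P where "P \<subseteq> poly_fun G" "Y = {x. \<forall>p\<in>P. p x = 0} \<inter> S"
    unfolding closedin_subtopology closedin_zariski by auto
  then show ?R by (fastforce simp: vanish_def)
next
  assume R: ?R
  define P where "P = {p \<in> poly_fun G. vanish Y p}"
  have "Y = {x. \<forall>p\<in>P. p x = 0} \<inter> S" using R by (auto simp: P_def vanish_def)
  moreover have "P \<subseteq> poly_fun G" by (auto simp: P_def)
  ultimately show ?L unfolding closedin_subtopology closedin_zariski by blast
qed

text \<open>If a product vanishes on \<open>Y\<close>, the zero sets of its factors cover
  \<open>Y\<close>. Conversely, for a covering by proper closed subsets \<open>C\<close> and
  \<open>D\<close>, functions vanishing on \<open>C\<close> and on \<open>D\<close> but not on
  \<open>Y\<close> have a product that vanishes on \<open>Y\<close>.\<close>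

lemma irreducible_closedin_zariski:
  "irreducible_closedin (subtopology (zariski G) S) Y \<longleftrightarrow>
     closedin (subtopology (zariski G) S) Y \<and> prime_on (poly_fun G) Y" (is "?L \<longleftrightarrow> ?R")
proof
  assume L: ?L
  note cl = L[unfolded irreducible_closedin_def, THEN conjunct1]
    and ne = L[unfolded irreducible_closedin_def, THEN conjunct2, THEN conjunct1]
    and irr = L[unfolded irreducible_closedin_def, THEN conjunct2, THEN conjunct2, rule_format]
  have cut: "closedin (subtopology (zariski G) S) {y \<in> Y. p y = 0}" if p: "p \<in> poly_fun G" for p
    unfolding closedin_subtopology_zariski
  proof (intro conjI ballI)
    fix x assume x: "x \<in> S - {y \<in> Y. p y = 0}"
    show "\<exists>q\<in>poly_fun G. q x \<noteq> 0 \<and> vanish {y \<in> Y. p y = 0} q"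
    proof (cases "x \<in> Y")
      case True
      then show ?thesis using x p by (intro bexI[of _ p]) (auto simp: vanish_def)
    next
      case False
      then obtain q where "q \<in> poly_fun G" "q x \<noteq> 0" "vanish Y q"
        using cl x unfolding closedin_subtopology_zariski by blast
      then show ?thesis by (intro bexI[of _ q]) (auto simp: vanish_def)
    qed
  qed (use cl in \<open>auto simp: closedin_subtopology_zariski\<close>)
  have "vanish Y p \<or> vanish Y q"
    if "p \<in> poly_fun G" "q \<in> poly_fun G" "vanish Y (\<lambda>x. p x * q x)" for p q
  proof -
    have "Y = {y \<in> Y. p y = 0} \<union> {y \<in> Y. q y = 0}" using that(3) by (auto simp: vanish_def)
    then have "{y \<in> Y. p y = 0} = Y \<or> {y \<in> Y. q y = 0} = Y" using cut that(1,2) by (intro irr) blast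
    then show ?thesis by (auto simp: vanish_def)
  qed
  then show ?R using cl ne by (simp add: prime_on_def)
next
  assume R: ?R
  have "C = Y \<or> D = Y"
    if C: "closedin (subtopology (zariski G) S) C" and D: "closedin (subtopology (zariski G) S) D"
      and Y: "Y = C \<union> D" for C D
  proof (rule ccontr)
    assume "\<not> ?thesis"
    then obtain x y where xy: "x \<in> Y" "x \<notin> C" "y \<in> Y" "y \<notin> D" using Y by blast
    have "Y \<subseteq> S" using R by (simp add: closedin_subtopology_zariski)
    then obtain p where p: "p \<in> poly_fun G" "p x \<noteq> 0" "vanish C p"
      using C xy(1,2) unfolding closedin_subtopology_zariski by blast
    obtain q where q: "q \<in> poly_fun G" "q y \<noteq> 0" "vanish D q"
      using D xy(3,4) \<open>Y \<subseteq> S\<close> unfolding closedin_subtopology_zariski by blast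
    have "vanish Y (\<lambda>x. p x * q x)" using p(3) q(3) by (auto simp: vanish_def Y)
    then have "vanish Y p \<or> vanish Y q" using R p(1) q(1) by (auto simp: prime_on_def)
    then show False using p(2) q(2) xy by (auto simp: vanish_def)
  qed
  moreover have "Y \<noteq> {}" using R by (simp add: prime_on_def)
  ultimately show ?L unfolding irreducible_closedin_def using R by (intro conjI allI impI) auto
qed

text \<open>Strictness is demanded of the vanishing ideals: for sets that are not closed, strict
  inclusion would not imply it.\<close>

definition prime_chain :: "('x \<Rightarrow> complex) set \<Rightarrow> 'x set \<Rightarrow> nat \<Rightarrow> (nat \<Rightarrow> 'x set) \<Rightarrow> bool" where
  "prime_chain G S d Y \<longleftrightarrow> (\<forall>k\<le>d. Y k \<subseteq> S \<and> prime_on (poly_fun G) (Y k)) \<and>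
     (\<forall>k<d. Y k \<subseteq> Y (Suc k) \<and> (\<exists>p\<in>poly_fun G. vanish (Y k) p \<and> \<not> vanish (Y (Suc k)) p))"

lemma prime_chainD:
  assumes "prime_chain G S d Y"
  shows "k \<le> d \<Longrightarrow> Y k \<subseteq> S" and "k \<le> d \<Longrightarrow> prime_on (poly_fun G) (Y k)"
    and "k < d \<Longrightarrow> Y k \<subseteq> Y (Suc k)"
    and "k < d \<Longrightarrow> \<exists>p\<in>poly_fun G. vanish (Y k) p \<and> \<not> vanish (Y (Suc k)) p"
  using assms unfolding prime_chain_def by simp_all

lemma prime_chain_mono: "prime_chain G S d Y \<Longrightarrow> S \<subseteq> S' \<Longrightarrow> prime_chain G S' d Y"
  unfolding prime_chain_def by (simp add: subset_trans[of _ S S'])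

lemma prime_chain_top: "prime_chain G S d Y \<Longrightarrow> prime_chain G (Y d) d Y"
proof -
  assume c: "prime_chain G S d Y"
  have "Y k \<subseteq> Y d" if "k \<le> d" for k
    using that
  proof (induction rule: inc_induct)
    case (step k)
    then show ?case using prime_chainD(3)[OF c, of k] by (meson subset_trans)
  qed simp
  then show ?thesis using prime_chainD[OF c] by (simp add: prime_chain_def)
qed

lemma prime_chain_truncate: "prime_chain G S d Y \<Longrightarrow> d' \<le> d \<Longrightarrow> prime_chain G S d' Y"
  unfolding prime_chain_def by simp

lemma prime_chain_snoc:
  assumes Y: "prime_chain G S d Y" and Z: "prime_on (poly_fun G) Z" "Z \<subseteq> S" "Y d \<subseteq> Z"
    and p: "p \<in> poly_fun G" "vanish (Y d) p" "\<not> vanish Z p"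
  shows "prime_chain G S (Suc d) (Y(Suc d := Z))"
proof -
  have "\<exists>p\<in>poly_fun G. vanish (Y d) p \<and> \<not> vanish Z p" using p by blast
  then show ?thesis
    using prime_chainD[OF Y] Z unfolding prime_chain_def by (simp add: le_Suc_eq less_Suc_eq)
qed

definition zariski_closure :: "('x \<Rightarrow> complex) set \<Rightarrow> 'x set \<Rightarrow> 'x set \<Rightarrow> 'x set" where
  "zariski_closure G S Y = {x \<in> S. \<forall>p\<in>poly_fun G. vanish Y p \<longrightarrow> p x = 0}"

text \<open>The members of a chain of primes need not be closed; taking closures makes them so without
  changing the polynomial functions vanishing on them. Hence the Krull dimension can be computed with
  arbitrary chains of primes and is monotone in the subset.\<close>

lemma krull_dim_ge_iff:
  assumes "d > 0 \<or> (\<exists>Y\<subseteq>S. prime_on (poly_fun G) Y)"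
  shows "enat d \<le> krull_dim (subtopology (zariski G) S) \<longleftrightarrow> (\<exists>Y. prime_chain G S d Y)" (is "?L \<longleftrightarrow> ?R")
proof
  assume L: ?L
  show ?R
  proof (cases "d = 0")
    case True
    \<comment> \<open>The empty supremum is \<open>0\<close>, so for \<open>d = 0\<close> the
      inequality carries no information and the chain comes from the assumption.\<close>
    then obtain Y where "Y \<subseteq> S" "prime_on (poly_fun G) Y" using assms by blast
    then show ?thesis using True by (intro exI[of _ "\<lambda>_. Y"]) (simp add: prime_chain_def)
  next
    case False
    \<comment> \<open>The supremum may be infinite and need not be attained. A chain longer than
      \<open>d - 1\<close> exists in any case and is truncated.\<close>
    then have "enat (d - 1) < krull_dim (subtopology (zariski G) S)"
      using L by (cases "krull_dim (subtopology (zariski G) S)") auto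
    define C where "C = (\<lambda>m. \<exists>Y. (\<forall>k\<le>m. irreducible_closedin (subtopology (zariski G) S) (Y k)) \<and>
        (\<forall>k<m. Y k \<subset> Y (Suc k)))"
    have "krull_dim (subtopology (zariski G) S) = Sup {enat m | m. C m}"
      by (simp add: krull_dim_def C_def)
    then obtain m where m1: "d - 1 < m" and "C m"
      using \<open>enat (d - 1) < _\<close> by (auto simp: less_Sup_iff)
    then obtain Y where "\<forall>k\<le>m. irreducible_closedin (subtopology (zariski G) S) (Y k)"
      "\<forall>k<m. Y k \<subset> Y (Suc k)"
      unfolding C_def by (elim exE conjE)
    then have m: "d - 1 < m"
      "\<And>k. k \<le> m \<Longrightarrow> irreducible_closedin (subtopology (zariski G) S) (Y k)"
      "\<And>k. k < m \<Longrightarrow> Y k \<subset> Y (Suc k)"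
      using m1 by auto
    have "prime_chain G S m Y"
      unfolding prime_chain_def
    proof (intro conjI allI impI)
      fix k assume "k \<le> m"
      then show "Y k \<subseteq> S" "prime_on (poly_fun G) (Y k)"
        using m(2) by (auto simp: irreducible_closedin_zariski closedin_subtopology_zariski)
    next
      fix k assume k: "k < m"
      then obtain x where "x \<in> Y (Suc k)" "x \<notin> Y k" using m(3) by blast
      moreover have "Y (Suc k) \<subseteq> S" "closedin (subtopology (zariski G) S) (Y k)"
        using m(2)[of "Suc k"] m(2)[of k] k
        by (auto simp: irreducible_closedin_zariski closedin_subtopology_zariski)
      ultimately show "\<exists>p\<in>poly_fun G. vanish (Y k) p \<and> \<not> vanish (Y (Suc k)) p"
        unfolding closedin_subtopology_zariski vanish_def by blast
      show "Y k \<subseteq> Y (Suc k)" using m(3)[OF k] by blast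
    qed
    then have "prime_chain G S d Y" using m(1) by (elim prime_chain_truncate) simp
    then show ?thesis by (intro exI[of _ Y])
  qed
next
  assume ?R
  then obtain Y where Y: "prime_chain G S d Y" by blast
  define Z where "Z = (\<lambda>k. zariski_closure G S (Y k))"
  have sub: "Y k \<subseteq> Z k" if "k \<le> d" for k
    using prime_chainD(1)[OF Y that] by (auto simp: Z_def zariski_closure_def vanish_def)
  have van: "vanish (Z k) p \<longleftrightarrow> vanish (Y k) p" if "k \<le> d" "p \<in> poly_fun G" for k p
    using sub[OF that(1)] that(2) by (auto simp: Z_def zariski_closure_def vanish_def)
  have "prime_on (poly_fun G) (Z k)" if "k \<le> d" for k
  proof -
    note prime = prime_chainD(2)[OF Y that]
    show ?thesis
      unfolding prime_on_def
    proof (intro conjI ballI impI)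
      show "Z k \<noteq> {}" using prime sub[OF that] by (auto simp: prime_on_def)
      fix p q assume pq: "p \<in> poly_fun G" "q \<in> poly_fun G" "vanish (Z k) (\<lambda>x. p x * q x)"
      then have "vanish (Y k) (\<lambda>x. p x * q x)" using sub[OF that] by (auto simp: vanish_def)
      then show "vanish (Z k) p \<or> vanish (Z k) q"
        using prime_onD[OF prime pq(1,2)] van[OF that] pq(1,2) by blast
    qed
  qed
  moreover have "closedin (subtopology (zariski G) S) (Z k)" if "k \<le> d" for k
    unfolding closedin_subtopology_zariski using van[OF that] by (auto simp: Z_def zariski_closure_def)
  moreover have "Z k \<subset> Z (Suc k)" if "k < d" for k
  proof -
    obtain p where p: "p \<in> poly_fun G" "vanish (Y k) p" "\<not> vanish (Y (Suc k)) p" "Y k \<subseteq> Y (Suc k)"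
      using prime_chainD(3,4)[OF Y \<open>k < d\<close>] by blast
    have "vanish (Y k) q" if "vanish (Y (Suc k)) q" for q using p(4) that by (auto simp: vanish_def)
    then have "Z k \<subseteq> Z (Suc k)" unfolding Z_def zariski_closure_def by blast
    moreover have "Z k \<noteq> Z (Suc k)"
    proof
      assume "Z k = Z (Suc k)"
      then show False using p(1-3) van[of k p] van[of "Suc k" p] \<open>k < d\<close> by simp
    qed
    ultimately show ?thesis by blast
  qed
  ultimately show ?L
    unfolding krull_dim_def irreducible_closedin_zariski
    by (intro Sup_upper CollectI exI[of _ d] exI[of _ Z] conjI allI impI) simp_all
qed

lemma krull_dim_leI:
  assumes "\<And>d Y. prime_chain G S d Y \<Longrightarrow> d \<le> m"
  shows "krull_dim (subtopology (zariski G) S) \<le> enat m"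
proof (rule ccontr)
  assume "\<not> ?thesis"
  then have "enat (Suc m) \<le> krull_dim (subtopology (zariski G) S)"
    by (simp add: not_le Suc_ile_eq)
  then obtain Y where "prime_chain G S (Suc m) Y" using krull_dim_ge_iff[of "Suc m" S G] by blast
  then show False using assms[of "Suc m" Y] by simp
qed

lemma prime_chain_le_krull_dim:
  assumes "prime_chain G S d Y"
  shows "enat d \<le> krull_dim (subtopology (zariski G) S)"
proof -
  have "Y 0 \<subseteq> S" "prime_on (poly_fun G) (Y 0)" using assms by (auto simp: prime_chain_def)
  then show ?thesis using krull_dim_ge_iff[of d S G] assms by blast
qed

section \<open>Transport of chains along polynomial maps\<close>

lemma poly_fun_compose:
  assumes "\<And>g. g \<in> G \<Longrightarrow> (\<lambda>y. g (h y)) \<in> poly_fun G'" and "p \<in> poly_fun G"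
  shows "(\<lambda>y. p (h y)) \<in> poly_fun G'"
  using assms(2) by induction (auto intro: assms(1) poly_fun.intros)

lemma vanish_image: "vanish (h ` Y) p \<longleftrightarrow> vanish Y (\<lambda>x. p (h x))"
  by (auto simp: vanish_def)

lemma prime_on_image:
  assumes "\<And>g. g \<in> G' \<Longrightarrow> (\<lambda>x. g (h x)) \<in> poly_fun G" and "prime_on (poly_fun G) Y"
  shows "prime_on (poly_fun G') (h ` Y)"
  unfolding prime_on_def
proof (intro conjI ballI impI)
  show "h ` Y \<noteq> {}" using assms(2) by (simp add: prime_on_def)
  fix p q assume pq: "p \<in> poly_fun G'" "q \<in> poly_fun G'" "vanish (h ` Y) (\<lambda>x. p x * q x)"
  then have "(\<lambda>x. p (h x)) \<in> poly_fun G" "(\<lambda>x. q (h x)) \<in> poly_fun G"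
    using poly_fun_compose[of G' h G] assms(1) by auto
  moreover have "vanish Y (\<lambda>x. p (h x) * q (h x))" using pq(3) by (simp add: vanish_image)
  ultimately show "vanish (h ` Y) p \<or> vanish (h ` Y) q"
    using prime_onD[OF assms(2)] unfolding vanish_image by blast
qed

text \<open>\<open>h'\<close> carries the separating functions over to the image. It has to invert
  \<open>h\<close> only on \<open>S\<close> and only as seen by the coordinates in \<open>G\<close>,
  which suits types whose elements have entries beyond the coordinates.\<close>

lemma prime_chain_image:
  assumes h: "\<And>g. g \<in> G' \<Longrightarrow> (\<lambda>x. g (h x)) \<in> poly_fun G"
    and h': "\<And>g. g \<in> G \<Longrightarrow> (\<lambda>y. g (h' y)) \<in> poly_fun G'"
    and inv: "\<And>x g. x \<in> S \<Longrightarrow> g \<in> G \<Longrightarrow> g (h' (h x)) = g x" and Y: "prime_chain G S d Y"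
  shows "prime_chain G' (h ` S) d (\<lambda>k. h ` Y k)"
  unfolding prime_chain_def
proof (intro conjI allI impI)
  fix k assume "k \<le> d"
  then show "h ` Y k \<subseteq> h ` S" "prime_on (poly_fun G') (h ` Y k)"
    using prime_chainD(1,2)[OF Y, of k] prime_on_image[of G' h G "Y k", OF h] by auto
next
  fix k assume k: "k < d"
  then show "h ` Y k \<subseteq> h ` Y (Suc k)" using prime_chainD(3)[OF Y k] by blast
  obtain p where p: "p \<in> poly_fun G" "vanish (Y k) p" "\<not> vanish (Y (Suc k)) p"
    using prime_chainD(4)[OF Y k] by blast
  have eq: "p (h' (h x)) = p x" if "x \<in> S" for x
    using p(1) by induction (simp_all add: inv that)
  have sub: "Y k \<subseteq> S" "Y (Suc k) \<subseteq> S" using prime_chainD(1)[OF Y] k by auto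
  have "vanish (h ` Y k) (\<lambda>y. p (h' y))" using p(2) eq sub by (auto simp: vanish_def)
  moreover have "\<not> vanish (h ` Y (Suc k)) (\<lambda>y. p (h' y))"
  proof -
    obtain x where "x \<in> Y (Suc k)" "p x \<noteq> 0" using p(3) by (auto simp: vanish_def)
    then show ?thesis using eq[of x] sub by (auto simp: vanish_image vanish_def intro!: bexI[of _ x])
  qed
  ultimately show "\<exists>p\<in>poly_fun G'. vanish (h ` Y k) p \<and> \<not> vanish (h ` Y (Suc k)) p"
    using poly_fun_compose[of G h' G' p, OF h' p(1)] by blast
qed

section \<open>Affine space: a lower bound for its dimension\<close>

abbreviation vec_coords :: "nat \<Rightarrow> (complex vec \<Rightarrow> complex) set" where
  "vec_coords c \<equiv> {\<lambda>x. x $ k | k. k < c}"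

abbreviation mat_coords :: "nat \<Rightarrow> nat \<Rightarrow> (complex mat \<Rightarrow> complex) set" where
  "mat_coords a b \<equiv> {\<lambda>M. M $$ (i, j) | i j. i < a \<and> j < b}"

lemma poly_fun_line:
  assumes "p \<in> poly_fun (vec_coords c)"
  shows "\<exists>P. \<forall>t. p (vec c (\<lambda>k. x k + t * v k)) = poly P t"
  using assms
proof (induction rule: poly_fun.induct)
  case (coord g)
  then obtain k where "k < c" "g = (\<lambda>x. x $ k)" by auto
  then show ?case by (intro exI[of _ "[:x k, v k:]"]) simp
next
  case (const z)
  show ?case by (intro exI[of _ "[:z:]"]) simp
next
  case (add p q)
  then obtain P Q where "\<And>t. p (vec c (\<lambda>k. x k + t * v k)) = poly P t"
    "\<And>t. q (vec c (\<lambda>k. x k + t * v k)) = poly Q t" by blast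
  then show ?case by (intro exI[of _ "P + Q"]) simp
next
  case (mult p q)
  then obtain P Q where "\<And>t. p (vec c (\<lambda>k. x k + t * v k)) = poly P t"
    "\<And>t. q (vec c (\<lambda>k. x k + t * v k)) = poly Q t" by blast
  then show ?case by (intro exI[of _ "P * Q"]) simp
qed

text \<open>Linear subspaces are prime: the line joining a point with \<open>p\<close> nonzero to
  one with \<open>q\<close> nonzero stays in the subspace, and along it the product is a nonzero
  polynomial in one variable.\<close>

lemma coordinate_subspace_chain:
  "prime_chain (vec_coords c) (carrier_vec c) c (\<lambda>k. {x \<in> carrier_vec c. \<forall>i<c. k \<le> i \<longrightarrow> x $ i = 0})"
  unfolding prime_chain_def
proof (intro conjI allI impI)
  fix k
  define V where "V = {x \<in> carrier_vec c. \<forall>i<c. k \<le> i \<longrightarrow> x $ i = (0 :: complex)}"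
  have "vanish V p \<or> vanish V q"
    if p: "p \<in> poly_fun (vec_coords c)" and q: "q \<in> poly_fun (vec_coords c)"
      and pq: "vanish V (\<lambda>x. p x * q x)" for p q
  proof (rule ccontr)
    assume "\<not> ?thesis"
    then obtain x y where x: "x \<in> V" "p x \<noteq> 0" and y: "y \<in> V" "q y \<noteq> 0" by (auto simp: vanish_def)
    define z where "z = (\<lambda>t. vec c (\<lambda>k. x $ k + t * (y $ k - x $ k)))"
    have "z 0 = x" "z 1 = y" using x(1) y(1) by (auto simp: z_def V_def)
    obtain P where P: "\<And>t. p (z t) = poly P t" using poly_fun_line[OF p, of "\<lambda>k. x $ k" "\<lambda>k. y $ k - x $ k"] unfolding z_def by blast
    obtain Q where Q: "\<And>t. q (z t) = poly Q t" using poly_fun_line[OF q, of "\<lambda>k. x $ k" "\<lambda>k. y $ k - x $ k"] unfolding z_def by blast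
    have "poly P 0 \<noteq> 0" "poly Q 1 \<noteq> 0"
      using x(2) y(2) \<open>z 0 = x\<close> \<open>z 1 = y\<close> by (auto simp flip: P Q)
    then have "P * Q \<noteq> 0" by auto
    then obtain t where "poly (P * Q) t \<noteq> 0" using poly_all_0_iff_0 by blast
    moreover have "z t \<in> V" using x(1) y(1) by (auto simp: V_def z_def)
    ultimately show False using pq P Q by (auto simp: vanish_def)
  qed
  moreover have "0\<^sub>v c \<in> V" by (auto simp: V_def)
  ultimately show "prime_on (poly_fun (vec_coords c)) {x \<in> carrier_vec c. \<forall>i<c. k \<le> i \<longrightarrow> x $ i = 0}"
    unfolding prime_on_def V_def[symmetric] by blast
next
  fix k assume k: "k < c"
  show "{x \<in> carrier_vec c. \<forall>i<c. k \<le> i \<longrightarrow> x $ i = 0} \<subseteq> {x \<in> carrier_vec c. \<forall>i<c. Suc k \<le> i \<longrightarrow> x $ i = (0::complex)}"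
    by auto
  show "\<exists>p\<in>poly_fun (vec_coords c). vanish {x \<in> carrier_vec c. \<forall>i<c. k \<le> i \<longrightarrow> x $ i = 0} p \<and>
      \<not> vanish {x \<in> carrier_vec c. \<forall>i<c. Suc k \<le> i \<longrightarrow> x $ i = 0} p"
  proof (intro bexI[of _ "\<lambda>x. x $ k"] conjI)
    show "\<not> vanish {x \<in> carrier_vec c. \<forall>i<c. Suc k \<le> i \<longrightarrow> x $ i = (0::complex)} (\<lambda>x. x $ k)"
      using k by (auto simp: vanish_def intro!: exI[of _ "unit_vec c k"])
  qed (use k in \<open>auto simp: vanish_def intro: poly_fun.coord\<close>)
qed auto

section \<open>Matrices: rank, conciseness, hyperplanes\<close>

lemma rk_leI:
  assumes "finite S" and "card S \<le> k" and "\<And>i j. i < a \<Longrightarrow> j < b \<Longrightarrow> m i j = (\<Sum>v\<in>S. \<alpha> v i * \<beta> v j)"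
  shows "rk_le a b k m"
proof -
  obtain h where h: "bij_betw h {..<card S} S"
    using ex_bij_betw_nat_finite[OF \<open>finite S\<close>] by (auto simp: lessThan_atLeast0)
  have "m i j = (\<Sum>l<card S. \<alpha> (h l) i * \<beta> (h l) j)" if "i < a" "j < b" for i j
    using assms(3)[OF that] sum.reindex_bij_betw[OF h, of "\<lambda>v. \<alpha> v i * \<beta> v j"] by simp
  then have "rk_le a b (card S) m"
    unfolding rk_le_def by (intro exI[of _ "\<lambda>l. \<alpha> (h l)"] exI[of _ "\<lambda>l. \<beta> (h l)"]) simp
  then show ?thesis using assms(2) by (rule rk_le_mono)
qed

text \<open>The rank is the size of a maximal independent set \<open>S\<close> of columns.
  Coordinates of the columns with respect to \<open>S\<close> form a factorization; conversely, a
  factorization shorter than \<open>card S\<close> gives fewer equations than unknowns and hence a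
  dependence in \<open>S\<close>.\<close>

lemma rank_le_iff:
  fixes M :: "complex mat"
  assumes M: "M \<in> carrier_mat a b"
  shows "vec_space.rank a M \<le> k \<longleftrightarrow> rk_le a b k (\<lambda>i j. M $$ (i, j))"
proof -
  interpret vec_space "TYPE(complex)" a .
  have carr: "set (cols M) \<subseteq> carrier_vec a" using M cols_dim by blast
  obtain S where S: "finite S" "maximal S (\<lambda>T. T \<subseteq> set (cols M) \<and> lin_indpt T)"
    using maximal_exists_superset[of "set (cols M)" "\<lambda>T. T \<subseteq> set (cols M) \<and> lin_indpt T" "{}"]
      finite_lin_indpt2[of "{}"] by auto
  have rank: "rank M = card S" by (rule rank_card_indpt[OF M S(2)])
  have sub: "S \<subseteq> set (cols M)" and ind: "lin_indpt S" using S(2) by (auto simp: maximal_def)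
  then have Sc: "S \<subseteq> carrier_vec a" using carr by blast
  show ?thesis
  proof
    assume le: "rank M \<le> k"
    have "\<exists>u. lincomb u S = col M j" if "j < b" for j
    proof -
      have c: "col M j \<in> set (cols M)" using that M by (auto simp: cols_def)
      have "col M j \<in> span S"
      proof (cases "col M j \<in> S")
        case True
        then show ?thesis using in_own_span[of S] Sc by auto
      next
        case False
        have "\<not> lin_indpt (S \<union> {col M j})"
        proof
          assume "lin_indpt (S \<union> {col M j})"
          then have "S = S \<union> {col M j}" using S(2) sub c unfolding maximal_def by blast
          then show False using False by blast
        qed
        moreover have "col M j \<in> carrier_vec a" using c carr by blast
        ultimately show ?thesis using lin_dep_iff_in_span[of S "col M j"] Sc ind False by auto
      qed
      then show ?thesis using finite_in_span[OF S(1), of "col M j"] Sc by auto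
    qed
    then obtain u where u: "\<And>j. j < b \<Longrightarrow> lincomb (u j) S = col M j" by metis
    show "rk_le a b k (\<lambda>i j. M $$ (i, j))"
    proof (rule rk_leI[OF S(1)])
      fix i j assume "i < a" "j < b"
      then have "M $$ (i, j) = lincomb (u j) S $ i" using M u by simp
      also have "\<dots> = (\<Sum>v\<in>S. u j v * v $ i)" by (rule lincomb_index[OF \<open>i < a\<close> Sc])
      finally show "M $$ (i, j) = (\<Sum>v\<in>S. v $ i * u j v)" by (simp add: mult.commute)
    qed (use le rank in simp)
  next
    assume "rk_le a b k (\<lambda>i j. M $$ (i, j))"
    then obtain \<alpha> \<beta> where ab: "\<And>i j. i < a \<Longrightarrow> j < b \<Longrightarrow> M $$ (i, j) = (\<Sum>l<k. \<alpha> l i * \<beta> l j)"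
      unfolding rk_le_def by blast
    show "rank M \<le> k"
    proof (rule ccontr)
      assume "\<not> rank M \<le> k"
      then have "card {..<k} < card S" using rank by simp
      have "\<forall>v\<in>S. \<exists>j. j < b \<and> v = col M j"
      proof
        fix v assume "v \<in> S"
        then have "v \<in> col M ` {0..<b}" using sub M by (auto simp: cols_def)
        then show "\<exists>j. j < b \<and> v = col M j" by auto
      qed
      from bchoice[OF this] obtain J where J: "\<And>v. v \<in> S \<Longrightarrow> J v < b \<and> v = col M (J v)" by blast
      obtain u where u: "\<exists>v\<in>S. u v \<noteq> 0" "\<And>l. l < k \<Longrightarrow> (\<Sum>v\<in>S. u v * \<beta> l (J v)) = 0"
        using homogeneous_solution[OF _ S(1) \<open>card {..<k} < card S\<close>, of "\<lambda>v l. \<beta> l (J v)"] by auto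
      have "lincomb u S = 0\<^sub>v a"
      proof (rule eq_vecI)
        fix i assume "i < dim_vec (0\<^sub>v a :: complex vec)"
        then have i: "i < a" by simp
        have "lincomb u S $ i = (\<Sum>v\<in>S. u v * v $ i)" by (rule lincomb_index[OF i Sc])
        also have "\<dots> = (\<Sum>v\<in>S. \<Sum>l<k. \<alpha> l i * (u v * \<beta> l (J v)))"
        proof (intro sum.cong refl)
          fix v assume "v \<in> S"
          then have "J v < b" "v = col M (J v)" using J by auto
          then have "v $ i = (\<Sum>l<k. \<alpha> l i * \<beta> l (J v))" using ab[OF i, of "J v"] M i
            by (metis carrier_matD(1) carrier_matD(2) index_col)
          then show "u v * v $ i = (\<Sum>l<k. \<alpha> l i * (u v * \<beta> l (J v)))"
            by (simp add: sum_distrib_left mult.left_commute)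
        qed
        also have "\<dots> = (\<Sum>l<k. \<alpha> l i * (\<Sum>v\<in>S. u v * \<beta> l (J v)))"
          by (subst sum.swap) (simp add: sum_distrib_left)
        finally show "lincomb u S $ i = 0\<^sub>v a $ i" using u(2) i by simp
      qed (use lincomb_dim[OF S(1) Sc] in simp)
      moreover obtain v where "v \<in> S" "u v \<noteq> 0" using u(1) by blast
      ultimately have "lin_dep S" using lin_dep_crit[where A = S and S = S and a = u and v = v] S(1) by auto
      then show False using ind by blast
    qed
  qed
qed

section \<open>Conciseness in terms of functionals\<close>

lemma subspace_vecI:
  fixes W :: "complex vec set"
  assumes "W \<subseteq> carrier_vec a" and "0\<^sub>v a \<in> W" and "\<And>v w. v \<in> W \<Longrightarrow> w \<in> W \<Longrightarrow> v + w \<in> W"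
    and "\<And>t v. v \<in> W \<Longrightarrow> t \<cdot>\<^sub>v v \<in> W"
  shows "linear_subspace (vec_sp a) W"
  using assms vec_vs[of a, where 'a = complex] vec_module[of a, where 'a = complex]
  by (auto simp: VectorSpace.subspace_def submodule_def module_vec_simps class_ring_simps)

text \<open>Otherwise the hyperplane orthogonal to \<open>y\<close>, a proper subspace, would
  contain all columns of \<open>E\<close>.\<close>

lemma concise_columns:
  assumes E: "concise a b E" "E \<subseteq> carrier_mat a b" and y: "\<exists>i<a. y i \<noteq> 0"
  shows "\<exists>M\<in>E. \<exists>j<b. (\<Sum>i<a. y i * M $$ (i, j)) \<noteq> 0"
proof (rule ccontr)
  assume neg: "\<not> ?thesis"
  define W where "W = {w \<in> carrier_vec a. (\<Sum>i<a. y i * w $ i) = 0}"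
  have "linear_subspace (vec_sp a) W"
    by (rule subspace_vecI)
       (auto simp: W_def distrib_left sum.distrib mult.left_commute simp flip: sum_distrib_left)
  moreover have "W \<subset> carrier_vec a"
  proof -
    obtain i where i: "i < a" "y i \<noteq> 0" using y by blast
    have "(\<Sum>l<a. y l * unit_vec a i $ l) = y i"
      using i by (simp add: unit_vec_def if_distrib cong: if_cong)
    then have "unit_vec a i \<notin> W" using i by (simp add: W_def)
    moreover have "unit_vec a i \<in> carrier_vec a" by simp
    ultimately show ?thesis unfolding W_def by blast
  qed
  moreover have "E \<subseteq> tensor_left a b W"
  proof
    fix M assume M: "M \<in> E"
    then have "(\<Sum>i<a. y i * M $$ (i, j)) = 0" if "j < b" for j using neg that by blast
    then show "M \<in> tensor_left a b W" using M E(2) by (auto simp: tensor_left_def W_def)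
  qed
  ultimately show False using E(1) by (auto simp: concise_def)
qed

lemma concise_rows:
  assumes E: "concise a b E" "E \<subseteq> carrier_mat a b" and z: "\<exists>j<b. z j \<noteq> 0"
  shows "\<exists>M\<in>E. \<exists>i<a. (\<Sum>j<b. z j * M $$ (i, j)) \<noteq> 0"
proof (rule ccontr)
  assume neg: "\<not> ?thesis"
  define W where "W = {w \<in> carrier_vec b. (\<Sum>i<b. z i * w $ i) = 0}"
  have "linear_subspace (vec_sp b) W"
    by (rule subspace_vecI)
       (auto simp: W_def distrib_left sum.distrib mult.left_commute simp flip: sum_distrib_left)
  moreover have "W \<subset> carrier_vec b"
  proof -
    obtain i where i: "i < b" "z i \<noteq> 0" using z by blast
    have "(\<Sum>l<b. z l * unit_vec b i $ l) = z i"
      using i by (simp add: unit_vec_def if_distrib cong: if_cong)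
    then have "unit_vec b i \<notin> W" using i by (simp add: W_def)
    moreover have "unit_vec b i \<in> carrier_vec b" by simp
    ultimately show ?thesis unfolding W_def by blast
  qed
  moreover have "E \<subseteq> tensor_right a b W"
  proof
    fix M assume M: "M \<in> E"
    then have "(\<Sum>j<b. z j * M $$ (i, j)) = 0" if "i < a" for i using neg that by blast
    then show "M \<in> tensor_right a b W" using M E(2) by (auto simp: tensor_right_def W_def)
  qed
  ultimately show False using E(1) by (auto simp: concise_def)
qed

section \<open>Lines, coordinates and hyperplanes\<close>

lemma line_subspace:
  fixes w :: "complex vec"
  assumes w: "w \<in> carrier_vec a" "w \<noteq> 0\<^sub>v a"
  defines "L \<equiv> {t \<cdot>\<^sub>v w | t. True}"
  shows "linear_subspace (vec_sp a) L" and "lin_dim (vec_sp a) L = 1"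
proof -
  interpret V: vec_space "TYPE(complex)" a .
  have "0\<^sub>v a = 0 \<cdot>\<^sub>v w" using w by (intro eq_vecI) auto
  then have zero: "0\<^sub>v a \<in> L" unfolding L_def by blast
  show sub: "linear_subspace (vec_sp a) L"
  proof (rule subspace_vecI)
    show "u + v \<in> L" if "u \<in> L" "v \<in> L" for u v
      using that unfolding L_def by (auto simp flip: add_smult_distrib_vec)
    show "t \<cdot>\<^sub>v v \<in> L" if "v \<in> L" for t v using that unfolding L_def by (auto simp: smult_smult_assoc)
  qed (use w zero in \<open>auto simp: L_def\<close>)
  have submod: "submodule class_ring L (vec_sp a)" using sub by (simp add: VectorSpace.subspace_def)
  have vs: "vectorspace class_ring ((vec_sp a)\<lparr>carrier := L\<rparr>)"
    using vectorspace.subspace_is_vs[OF vec_vs sub] .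
  have "w = 1 \<cdot>\<^sub>v w" by simp
  then have wL: "w \<in> L" unfolding L_def by blast
  have "LinearCombinations.module.span class_ring ((vec_sp a)\<lparr>carrier := L\<rparr>) {w} = V.span {w}"
    using V.span_li_not_depend(1)[OF _ submod, of "{w}"] wL by simp
  also have "V.span {w} = L"
  proof -
    have "V.lincomb u {w} = u w \<cdot>\<^sub>v w" for u
      using w by (intro eq_vecI) (auto simp: V.lincomb_index V.lincomb_dim)
    then show ?thesis using V.finite_span[of "{w}"] w by (auto simp: L_def)
  qed
  finally show "lin_dim (vec_sp a) L = 1"
    using w wL by (intro vectorspace.dim1I[OF vs, of w]) (simp_all add: module_vec_simps)
qed

lemma mat_finsum_index:
  fixes f :: "'v \<Rightarrow> complex mat"
  assumes "finite A" and "f \<in> A \<rightarrow> carrier_mat a b" and "i < a" and "j < b"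
  shows "finsum (mat_sp a b) f A \<in> carrier_mat a b \<and> finsum (mat_sp a b) f A $$ (i, j) = (\<Sum>v\<in>A. f v $$ (i, j))"
proof -
  interpret matrix_vs a b "TYPE(complex)" .
  show ?thesis
    using assms(1,2)
  proof (induction A rule: finite_induct)
    case empty
    then show ?case using assms(3,4) by simp
  next
    case (insert v A)
    then have f: "f \<in> A \<rightarrow> carrier_mat a b" "f v \<in> carrier_mat a b" by auto
    have "finsum (mat_sp a b) f (insert v A) = f v + finsum (mat_sp a b) f A"
      using finsum_insert[OF insert.hyps(1,2) f] .
    moreover have "finsum (mat_sp a b) f A \<in> carrier_mat a b"
      and "finsum (mat_sp a b) f A $$ (i, j) = (\<Sum>v\<in>A. f v $$ (i, j))"
      using insert.IH f(1) by blast+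
    ultimately show ?case using insert.hyps f(2) assms(3,4) carrier_matD by (auto simp del: finsum_closed)
  qed
qed

lemma linear_subspace_matD:
  assumes "linear_subspace (mat_sp a b) E"
  shows "E \<subseteq> carrier_mat a b" and "0\<^sub>m a b \<in> E" and "M \<in> E \<Longrightarrow> N \<in> E \<Longrightarrow> M + N \<in> E"
    and "M \<in> E \<Longrightarrow> t \<cdot>\<^sub>m M \<in> E"
  using assms unfolding VectorSpace.subspace_def submodule_def
  by (auto simp: module_mat_simps class_ring_simps)

lemma subspace_matI:
  fixes W :: "complex mat set"
  assumes "W \<subseteq> carrier_mat a b" and "0\<^sub>m a b \<in> W" and "\<And>v w. v \<in> W \<Longrightarrow> w \<in> W \<Longrightarrow> v + w \<in> W"
    and "\<And>t v. v \<in> W \<Longrightarrow> t \<cdot>\<^sub>m v \<in> W"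
  shows "linear_subspace (mat_sp a b) W"
  using assms matrix_vs[of a b, where 'a = complex]
  by (auto simp: VectorSpace.subspace_def submodule_def module_mat_simps class_ring_simps vectorspace_def)

lemma lin_mat_carrier [simp]: "lin_mat a b c P x \<in> carrier_mat a b"
  by (simp add: lin_mat_def)

lemma lin_mat_index: "i < a \<Longrightarrow> j < b \<Longrightarrow> lin_mat a b c P x $$ (i, j) = (\<Sum>k<c. x $ k * P k $$ (i, j))"
  by (simp add: lin_mat_def)

lemma basis_coordinates:
  assumes sub: "linear_subspace (mat_sp a b) E" and bas: "basis_of a b E c e"
  shows "k < c \<Longrightarrow> e k \<in> E"
    and "x \<in> carrier_vec c \<Longrightarrow> lin_mat a b c e x \<in> E"
    and "M \<in> E \<Longrightarrow> \<exists>x\<in>carrier_vec c. M = lin_mat a b c e x"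
    and "x \<in> carrier_vec c \<Longrightarrow> lin_mat a b c e x = 0\<^sub>m a b \<Longrightarrow> k < c \<Longrightarrow> x $ k = 0"
    and "vectorspace.fin_dim class_ring ((mat_sp a b)\<lparr>carrier := E\<rparr>)"
proof -
  define A where "A = e ` {..<c}"
  have inj: "inj_on e {..<c}" using bas by (simp add: basis_of_def)
  have finA: "finite A" by (simp add: A_def)
  have vs: "vectorspace class_ring ((mat_sp a b)\<lparr>carrier := E\<rparr>)"
    by (rule vectorspace.subspace_is_vs[OF matrix_vs sub])
  interpret V: vectorspace class_ring "(mat_sp a b)\<lparr>carrier := E\<rparr>" by (rule vs)
  interpret M: matrix_vs a b "TYPE(complex)" .
  have basA: "V.basis A" using bas by (simp add: basis_of_def A_def)
  then have AE: "A \<subseteq> E" by (simp add: V.basis_def)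
  then show eE: "e k \<in> E" if "k < c" for k using that by (auto simp: A_def)
  have EM: "E \<subseteq> carrier_mat a b" by (rule linear_subspace_matD[OF sub])
  have submod: "submodule class_ring E (mat_sp a b)" using sub by (simp add: VectorSpace.subspace_def)
  have lc: "V.lincomb u A = lin_mat a b c e (vec c (\<lambda>k. u (e k)))" for u
  proof -
    have f: "(\<lambda>v. u v \<cdot>\<^sub>m v) \<in> A \<rightarrow> carrier_mat a b" using AE EM by auto
    have *: "V.lincomb u A = finsum (mat_sp a b) (\<lambda>v. u v \<cdot>\<^sub>m v) A"
      using M.lincomb_not_depend[OF finA AE submod, of u]
      by (simp add: M.lincomb_def module_mat_simps class_ring_simps)
    have "V.lincomb u A \<in> E"
      using V.lincomb_closed[of A u] AE by (simp add: class_ring_simps)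
    then have carr: "V.lincomb u A \<in> carrier_mat a b" using EM by blast
    show ?thesis
    proof (rule eq_matI)
      fix i j assume "i < dim_row (lin_mat a b c e (vec c (\<lambda>k. u (e k))))"
        "j < dim_col (lin_mat a b c e (vec c (\<lambda>k. u (e k))))"
      then have ij: "i < a" "j < b" by (simp_all add: lin_mat_def)
      have "V.lincomb u A $$ (i, j) = (\<Sum>v\<in>A. (u v \<cdot>\<^sub>m v) $$ (i, j))"
        unfolding * using mat_finsum_index[OF finA f ij] by blast
      also have "\<dots> = (\<Sum>k<c. (u (e k) \<cdot>\<^sub>m e k) $$ (i, j))"
        unfolding A_def by (subst sum.reindex[OF inj]) simp
      also have "\<dots> = (\<Sum>k<c. vec c (\<lambda>k. u (e k)) $ k * e k $$ (i, j))"
      proof (intro sum.cong refl)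
        fix k assume "k \<in> {..<c}"
        then have "e k \<in> carrier_mat a b" using eE EM by auto
        then show "(u (e k) \<cdot>\<^sub>m e k) $$ (i, j) = vec c (\<lambda>k. u (e k)) $ k * e k $$ (i, j)"
          using ij \<open>k \<in> {..<c}\<close> by auto
      qed
      finally show "V.lincomb u A $$ (i, j) = lin_mat a b c e (vec c (\<lambda>k. u (e k))) $$ (i, j)"
        using ij by (simp add: lin_mat_index)
    qed (use carr in \<open>auto simp: lin_mat_def\<close>)
  qed
  have crit: "\<exists>!u. u \<in> A \<rightarrow>\<^sub>E UNIV \<and> V.lincomb u A = M" if "M \<in> E" for M
    using V.basis_criterion[OF finA] basA AE that by (simp add: class_ring_simps)
  \<comment> \<open>The basis criterion is about extensional coefficient functions on the basis;
    this turns a coordinate vector into one of them.\<close>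
  have coeffs: "\<exists>u. u \<in> A \<rightarrow>\<^sub>E UNIV \<and> (\<forall>k<c. u (e k) = x $ k)" for x :: "complex vec"
  proof (intro exI conjI allI impI)
    define u where "u = restrict (\<lambda>v. x $ inv_into {..<c} e v) A"
    show "u \<in> A \<rightarrow>\<^sub>E UNIV" by (auto simp: u_def)
    show "u (e k) = x $ k" if "k < c" for k
      using that inj by (simp add: u_def A_def)
  qed
  show "lin_mat a b c e x \<in> E" if x: "x \<in> carrier_vec c" for x
  proof -
    obtain u where u: "\<And>k. k < c \<Longrightarrow> u (e k) = x $ k" using coeffs by blast
    have "vec c (\<lambda>k. u (e k)) = x" using u x by (intro eq_vecI) auto
    then have "lin_mat a b c e x = V.lincomb u A" by (simp add: lc)
    also have "\<dots> \<in> E" using V.lincomb_closed[of A u] AE by (simp add: class_ring_simps)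
    finally show ?thesis .
  qed
  show "\<exists>x\<in>carrier_vec c. M = lin_mat a b c e x" if M: "M \<in> E" for M
  proof -
    obtain u where "V.lincomb u A = M" using crit[OF M] by blast
    then show ?thesis by (intro bexI[of _ "vec c (\<lambda>k. u (e k))"]) (simp_all add: lc)
  qed
  show "x $ k = 0" if x: "x \<in> carrier_vec c" "lin_mat a b c e x = 0\<^sub>m a b" "k < c" for x k
  proof -
    obtain u where u: "u \<in> A \<rightarrow>\<^sub>E UNIV" "\<And>k. k < c \<Longrightarrow> u (e k) = x $ k" using coeffs by blast
    obtain u0 where u0: "u0 \<in> A \<rightarrow>\<^sub>E UNIV" "\<And>k. k < c \<Longrightarrow> u0 (e k) = (0 :: complex)"
      using coeffs[of "0\<^sub>v c"] by auto
    have "vec c (\<lambda>k. u (e k)) = x" using u(2) x(1) by (intro eq_vecI) auto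
    then have "V.lincomb u A = 0\<^sub>m a b" using x(2) by (simp add: lc)
    moreover have "V.lincomb u0 A = 0\<^sub>m a b"
      unfolding lc using u0(2) by (intro eq_matI) (auto simp: lin_mat_def)
    ultimately have "u \<in> A \<rightarrow>\<^sub>E UNIV \<and> V.lincomb u A = 0\<^sub>m a b" "u0 \<in> A \<rightarrow>\<^sub>E UNIV \<and> V.lincomb u0 A = 0\<^sub>m a b"
      using u(1) u0(1) by simp_all
    then have "u = u0" using crit[OF linear_subspace_matD(2)[OF sub]] by metis
    then show ?thesis using u(2)[OF x(3)] u0(2)[OF x(3)] x(3) by simp
  qed
  show "V.fin_dim" 
  proof -
    have "A \<subseteq> carrier ((mat_sp a b)\<lparr>carrier := E\<rparr>)" and "V.gen_set A"
      using basA unfolding V.basis_def by simp_all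
    then show ?thesis unfolding V.fin_dim_def using finA by (intro exI[of _ A]) simp
  qed
qed

definition mat_functional :: "nat \<Rightarrow> nat \<Rightarrow> (nat \<Rightarrow> nat \<Rightarrow> complex) \<Rightarrow> complex mat \<Rightarrow> complex" where
  "mat_functional a b \<delta> M = (\<Sum>i<a. \<Sum>j<b. \<delta> i j * M $$ (i, j))"

lemma mat_functional_add: "M \<in> carrier_mat a b \<Longrightarrow> N \<in> carrier_mat a b \<Longrightarrow>
    mat_functional a b \<delta> (M + N) = mat_functional a b \<delta> M + mat_functional a b \<delta> N"
  by (simp add: mat_functional_def distrib_left sum.distrib)

lemma mat_functional_smult: "M \<in> carrier_mat a b \<Longrightarrow>
    mat_functional a b \<delta> (t \<cdot>\<^sub>m M) = t * mat_functional a b \<delta> M"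
  by (simp add: mat_functional_def mult.left_commute sum_distrib_left)

text \<open>Rank-nullity for the functional as a map to the one-dimensional space
  \<open>carrier_vec 1\<close>; \<open>M0\<close> makes it surjective.\<close>

lemma hyperplane_functional:
  assumes sub: "linear_subspace (mat_sp a b) E"
    and fd: "vectorspace.fin_dim class_ring ((mat_sp a b)\<lparr>carrier := E\<rparr>)"
    and M0: "M0 \<in> E" "mat_functional a b \<delta> M0 \<noteq> 0"
  shows "hyperplane a b E {M \<in> E. mat_functional a b \<delta> M = 0}"
proof -
  define T where "T = (\<lambda>M. vec 1 (\<lambda>_. mat_functional a b \<delta> M))"
  define F where "F = {M \<in> E. mat_functional a b \<delta> M = 0}"
  note ED = linear_subspace_matD[OF sub]
  have vs: "vectorspace class_ring ((mat_sp a b)\<lparr>carrier := E\<rparr>)"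
    by (rule vectorspace.subspace_is_vs[OF matrix_vs sub])
  have hom: "T \<in> LinearCombinations.module_hom class_ring ((mat_sp a b)\<lparr>carrier := E\<rparr>) (vec_sp 1)"
    using ED(1)
    by (auto simp: LinearCombinations.module_hom_def T_def module_vec_simps module_mat_simps mat_functional_add
        mat_functional_smult subset_iff intro!: eq_vecI)
  interpret T: linear_map class_ring "(mat_sp a b)\<lparr>carrier := E\<rparr>" "vec_sp 1" T
    using vs vec_vs[of 1, where 'a = complex] hom
    by (simp add: linear_map_def mod_hom_def mod_hom_axioms_def vectorspace_def)
  have ker: "T.kerT = F"
    unfolding T.ker_def by (auto simp: F_def T_def module_vec_simps vec_eq_iff)
  have im: "T.imT = carrier_vec 1"
  proof
    show "carrier_vec 1 \<subseteq> T.imT"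
    proof
      fix w :: "complex vec" assume w: "w \<in> carrier_vec 1"
      have "T ((w $ 0 / mat_functional a b \<delta> M0) \<cdot>\<^sub>m M0) = w"
        using w M0 ED(1) by (auto simp: T_def mat_functional_smult subset_iff intro!: eq_vecI)
      moreover have "(w $ 0 / mat_functional a b \<delta> M0) \<cdot>\<^sub>m M0 \<in> E" using ED(4) M0(1) by blast
      ultimately show "w \<in> T.imT" unfolding T.im_def by force
    qed
    show "T.imT \<subseteq> carrier_vec 1" unfolding T.im_def by (auto simp: T_def)
  qed
  have "lin_dim (vec_sp 1) T.imT + lin_dim (mat_sp a b) E - lin_dim (mat_sp a b) E = 1"
  proof -
    have "(vec_sp 1)\<lparr>carrier := carrier_vec 1\<rparr> = (vec_sp 1 :: (complex, complex vec) module)"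
      by (simp add: module_vec_def)
    then show ?thesis unfolding im using vec_space.dim_is_n[of 1, where 'a = complex] by simp
  qed
  moreover have "lin_dim (vec_sp 1) T.imT + lin_dim (mat_sp a b) F = lin_dim (mat_sp a b) E"
    using T.rank_nullity_main(1)[OF fd, unfolded ker] by simp
  ultimately have "lin_dim (mat_sp a b) E = lin_dim (mat_sp a b) F + 1" by simp
  moreover have "linear_subspace (mat_sp a b) F"
  proof -
    have "0\<^sub>m a b \<in> F" using ED(2) by (simp add: F_def mat_functional_def)
    moreover have "M \<in> carrier_mat a b" if "M \<in> F" for M using that ED(1) by (auto simp: F_def)
    ultimately show ?thesis
      using ED(3,4)
      by (intro subspace_matI) (auto simp: F_def mat_functional_add mat_functional_smult)
  qed
  ultimately show ?thesis unfolding hyperplane_def F_def by blast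
qed

section \<open>The main argument\<close>

lemma rk_le_cong:
  assumes "\<And>i j. i < a \<Longrightarrow> j < b \<Longrightarrow> m i j = m' i j"
  shows "rk_le a b k m \<longleftrightarrow> rk_le a b k m'"
  unfolding rk_le_def using assms by simp

lemma lin_mat_dim [simp]: "dim_row (lin_mat a b c P x) = a" "dim_col (lin_mat a b c P x) = b"
  by (simp_all add: lin_mat_def)

lemma pencil_lin_mat:
  "i < a \<Longrightarrow> j < b \<Longrightarrow> lin_mat a b c P (vec c x) $$ (i, j) = pencil c (\<lambda>k i j. P k $$ (i, j)) x i j"
  by (simp add: lin_mat_index pencil_def)

lemma mat_functional_poly: "mat_functional a b \<delta> \<in> poly_fun (mat_coords a b)"
proof -
  have "(\<lambda>M. \<Sum>i<a. \<Sum>j<b. \<delta> i j * M $$ (i, j)) \<in> poly_fun (mat_coords a b)"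
    by (intro poly_fun_sum poly_fun_scale poly_fun.coord) auto
  then show ?thesis by (simp add: mat_functional_def[abs_def])
qed

lemma prime_on_singleton: "prime_on R {x}"
  by (simp add: prime_on_def vanish_def)

text \<open>By injectivity every coordinate vanishes on the common kernel of the entries, viewed as
  linear forms, and so lies in their span. This makes the inverse of the pencil linear in the
  entries, hence polynomial.\<close>

lemma injective_pencil_coordinates:
  assumes "\<And>x k. (\<And>i j. i < a \<Longrightarrow> j < b \<Longrightarrow> pencil c T x i j = 0) \<Longrightarrow> k < c \<Longrightarrow> x k = 0"
  shows "\<exists>\<gamma>. \<forall>x. \<forall>k<c. (\<Sum>i<a. \<Sum>j<b. \<gamma> k i j * pencil c T x i j) = x k"
proof -
  have "\<exists>\<gamma>. \<forall>x. (\<Sum>i<a. \<Sum>j<b. \<gamma> i j * pencil c T x i j) = x k" if k: "k < c" for k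
  proof -
    define l where "l = (\<lambda>(i, j) k. T k i j)"
    have l: "dot c (l (i, j)) v = pencil c T v i j" for i j v
      by (simp add: dot_def l_def pencil_def mult.commute)
    have unit: "dot c (unitf k) v = v k" for v using k by (subst dot_commute) (simp add: dot_unit)
    have "\<exists>\<gamma>. \<forall>m<c. unitf k m = (\<Sum>ij\<in>{..<a} \<times> {..<b}. \<gamma> ij * l ij m)"
    proof (rule functional_in_span)
      fix v assume "\<forall>ij\<in>{..<a} \<times> {..<b}. dot c (l ij) v = 0"
      then have "pencil c T v i j = 0" if "i < a" "j < b" for i j using that by (auto simp flip: l)
      then have "v k = 0" using assms[of v k] k by blast
      then show "dot c (unitf k) v = 0" by (simp add: unit)
    qed simp
    then obtain \<gamma> where \<gamma>: "\<And>m. m < c \<Longrightarrow> unitf k m = (\<Sum>ij\<in>{..<a} \<times> {..<b}. \<gamma> ij * l ij m)" by blast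
    have "(\<Sum>i<a. \<Sum>j<b. \<gamma> (i, j) * pencil c T x i j) = x k" for x
    proof -
      have "x k = (\<Sum>m<c. unitf k m * x m)" using unit[of x] by (simp add: dot_def)
      also have "\<dots> = (\<Sum>m<c. (\<Sum>ij\<in>{..<a} \<times> {..<b}. \<gamma> ij * l ij m) * x m)" using \<gamma> by simp
      also have "\<dots> = (\<Sum>ij\<in>{..<a} \<times> {..<b}. \<gamma> ij * dot c (l ij) x)"
        unfolding dot_def sum_distrib_left sum_distrib_right by (subst sum.swap) (simp add: mult.assoc)
      also have "\<dots> = (\<Sum>i<a. \<Sum>j<b. \<gamma> (i, j) * pencil c T x i j)"
        by (subst sum.cartesian_product') (simp add: l)
      finally show ?thesis by simp
    qed
    then show ?thesis by (intro exI[of _ "\<lambda>i j. \<gamma> (i, j)"]) simp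
  qed
  then have "\<forall>k\<in>{..<c}. \<exists>\<gamma>. \<forall>x. (\<Sum>i<a. \<Sum>j<b. \<gamma> i j * pencil c T x i j) = x k" by blast
  from bchoice[OF this] show ?thesis by auto
qed

lemma enat_diff_le_iff: "enat k - m \<le> enat n \<longleftrightarrow> enat (k - n) \<le> m"
  by (cases m) auto

lemma bounded_size_or_hyperplane_or_decomposition:
  fixes E :: "complex mat set" and r n :: nat
  assumes "r > 0" and "n > 0" and sub: "linear_subspace (mat_sp a b) E" and con: "concise a b E"
    and bas: "basis_of a b E c e"
    and cod: "codim (zariski_mat a b) E (rank_locus a E r) \<le> enat n"
  shows "(a \<le> (r + 1) * (n + 1) * r \<and> b \<le> (r + 1) * (n + 1) * r) \<or>
         (\<exists>F. hyperplane a b E F \<and>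
            codim (zariski_mat a b) F (rank_locus a F r) \<le> enat (n - 1)) \<or>
         (\<exists>i\<in>{1..r}. \<exists>H H' :: nat \<Rightarrow> complex mat.
            (\<forall>k<c. H k \<in> carrier_mat a b \<and> H' k \<in> carrier_mat a b) \<and>
            (\<forall>x\<in>carrier_vec c. lin_mat a b c e x = lin_mat a b c H x + lin_mat a b c H' x) \<and>
            codim (zariski_vec c) (carrier_vec c) (lin_mat_locus a b c H' (r - i)) \<le> enat n \<and>
            ((\<exists>A'. linear_subspace (vec_sp a) A' \<and> lin_dim (vec_sp a) A' = i \<and>
                lin_mat_space a b c H \<subseteq> tensor_left a b A') \<or>
             (\<exists>B'. linear_subspace (vec_sp b) B' \<and> lin_dim (vec_sp b) B' = i \<and>
                lin_mat_space a b c H \<subseteq> tensor_right a b B')))"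
    (is "?bounded \<or> ?hyperplane \<or> (\<exists>i\<in>{1..r}. ?decomposition i)")
proof -
  define T where "T = (\<lambda>k i j. e k $$ (i, j))"
  define L where "L = lin_mat a b c e"
  define G where "G = mat_coords a b"
  note ED = linear_subspace_matD[OF sub]
  note bc = basis_coordinates[OF sub bas, folded L_def]
  have L_index: "L (vec c x) $$ (i, j) = pencil c T x i j" if "i < a" "j < b" for x i j
    using that by (simp add: L_def T_def pencil_lin_mat)
  have inj: "x k = 0" if "\<And>i j. i < a \<Longrightarrow> j < b \<Longrightarrow> pencil c T x i j = 0" "k < c" for x k
  proof -
    have "L (vec c x) = 0\<^sub>m a b"
      by (intro eq_matI) (auto simp: L_index that(1), auto simp: L_def lin_mat_def)
    from bc(4)[OF _ this that(2)] show ?thesis using that(2) by simp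
  qed
  have "\<exists>\<gamma>. \<forall>x. \<forall>k<c. (\<Sum>i<a. \<Sum>j<b. \<gamma> k i j * pencil c T x i j) = x k"
    by (rule injective_pencil_coordinates) (use inj in blast)
  then obtain \<gamma> where \<gamma>: "\<And>x k. k < c \<Longrightarrow> (\<Sum>i<a. \<Sum>j<b. \<gamma> k i j * pencil c T x i j) = x k"
    by blast
  \<comment> \<open>Inverse of \<open>L\<close> on \<open>E\<close>, extended to all matrices by the
    same functionals in the entries.\<close>
  define \<psi> where "\<psi> = (\<lambda>M k. if k < c then mat_functional a b (\<gamma> k) M else 0)"
  have \<psi>L: "\<psi> (L (vec c x)) k = x k" if "k < c" for x k
    using \<gamma>[OF that, of x] that by (simp add: \<psi>_def mat_functional_def L_index)
  have L\<psi>: "L (vec c (\<psi> M)) = M" if M: "M \<in> E" for M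
  proof -
    obtain x where x: "x \<in> carrier_vec c" "M = L x" using bc(3)[OF M] by blast
    then have vec: "vec c (\<lambda>k. x $ k) = x" by (intro eq_vecI) auto
    have "vec c (\<psi> M) = x"
      unfolding x(2) using \<psi>L[of _ "\<lambda>k. x $ k"] x(1) by (intro eq_vecI) (auto simp: vec)
    then show ?thesis using x(2) by simp
  qed
  have entry_poly: "(\<lambda>M. M $$ (i, j)) \<in> poly_fun G" if "i < a" "j < b" for i j
    using that by (auto simp: G_def intro!: poly_fun.coord)
  have G_L: "(\<lambda>x. g (L x)) \<in> poly_fun (vec_coords c)" if g_in: "g \<in> G" for g
  proof -
    obtain i j where ij: "i < a" "j < b" and g: "g = (\<lambda>M. M $$ (i, j))" using g_in by (auto simp: G_def)
    have "(\<lambda>x. \<Sum>k<c. x $ k * T k i j) \<in> poly_fun (vec_coords c)"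
      by (intro poly_fun_sum poly_fun.mult poly_fun.const poly_fun.coord) auto
    then show ?thesis using ij by (simp add: g L_def lin_mat_index T_def)
  qed
  have G_L': "(\<lambda>x. g (L (vec c x))) \<in> pf c" if g_in: "g \<in> G" for g
  proof -
    obtain i j where ij: "i < a" "j < b" and g: "g = (\<lambda>M. M $$ (i, j))" using g_in by (auto simp: G_def)
    have "(\<lambda>x. \<Sum>k<c. x k * T k i j) \<in> pf c"
      by (intro poly_fun_sum poly_fun.mult poly_fun.const pf_coord) simp
    then show ?thesis using ij by (simp add: g L_index pencil_def)
  qed
  have \<psi>_poly: "(\<lambda>M. \<psi> M k) \<in> poly_fun G" if "k < c" for k
    using that mat_functional_poly[of a b "\<gamma> k"] by (simp add: \<psi>_def G_def)
  have E_eq: "E = L ` carrier_vec c" using bc(2,3) by blast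
  define kd where "kd = (\<lambda>S. krull_dim (subtopology (zariski G) S))"
  define Er where "Er = rank_locus a E r"
  have zG: "zariski_mat a b = zariski G" by (simp add: zariski_mat_def G_def)
  have cod': "kd E - kd Er \<le> enat n" using cod by (simp add: codim_def zG kd_def Er_def)
  \<comment> \<open>In \<open>enat\<close> the difference \<open>\<infinity> - m\<close> is
    \<open>\<infinity>\<close>, so the bound on the codimension includes finiteness of the dimension
    of \<open>E\<close>.\<close>
  obtain K where K: "kd E = enat K" using cod' by (cases "kd E") auto
  have le_K: "m \<le> K" if "prime_chain G E m Y" for m Y
    using prime_chain_le_krull_dim[OF that] K by (simp add: kd_def)
  have vec_chain: "m \<le> K" if Y: "prime_chain (vec_coords c) (carrier_vec c) m Y" for m Y
  proof -
    have "prime_chain G (L ` carrier_vec c) m (\<lambda>k. L ` Y k)"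
    proof (rule prime_chain_image[OF G_L _ _ Y])
      show "(\<lambda>M. g (vec c (\<psi> M))) \<in> poly_fun G" if g: "g \<in> vec_coords c" for g
      proof -
        obtain k where "k < c" "g = (\<lambda>x. x $ k)" using g by auto
        then show ?thesis using \<psi>_poly by simp
      qed
      show "g (vec c (\<psi> (L x))) = g x" if x: "x \<in> carrier_vec c" and g: "g \<in> vec_coords c" for x g
      proof -
        have "vec c (\<lambda>k. x $ k) = x" using x by (intro eq_vecI) auto
        moreover obtain k where "k < c" "g = (\<lambda>x. x $ k)" using g by auto
        ultimately show ?thesis using \<psi>L[of k "\<lambda>k. x $ k"] by simp
      qed
    qed
    then show ?thesis using le_K E_eq by simp
  qed
  \<comment> \<open>Codimension is measured from the Krull dimension \<open>K\<close>, the tangent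
    bound from \<open>c\<close>. This inequality turns a chain of length \<open>K - n\<close> into
    one with \<open>c \<le> d + n\<close>.\<close>
  have "c \<le> K" using vec_chain[OF coordinate_subspace_chain] .
  have "prime_on (poly_fun (vec_coords c)) (carrier_vec c)"
  proof -
    have "{x \<in> carrier_vec c. \<forall>i<c. c \<le> i \<longrightarrow> x $ i = 0} = (carrier_vec c :: complex vec set)" by auto
    then show ?thesis using prime_chainD(2)[OF coordinate_subspace_chain[of c] order_refl] by simp
  qed
  from prime_on_image[OF G_L this] have primeE: "prime_on (poly_fun G) E" using E_eq by simp
  define d where "d = K - n"
  have "enat d \<le> kd Er" using cod' by (simp add: K enat_diff_le_iff d_def)
  then have d_le: "enat d \<le> krull_dim (subtopology (zariski G) Er)" unfolding kd_def .
  \<comment> \<open>The zero matrix provides a prime subset, so that a chain exists also for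
    \<open>d = 0\<close>.\<close>
  have "\<exists>Y\<subseteq>Er. prime_on (poly_fun G) Y"
  proof -
    have "rk_le a b 0 (\<lambda>i j. 0\<^sub>m a b $$ (i, j))" by (auto simp: rk_le_def)
    then have "vec_space.rank a (0\<^sub>m a b :: complex mat) \<le> r"
      using rank_le_iff[of "0\<^sub>m a b" a b 0] by simp
    then have "{0\<^sub>m a b} \<subseteq> Er" using ED(2) by (simp add: Er_def rank_locus_def)
    then show ?thesis by (intro exI[of _ "{0\<^sub>m a b}"] conjI prime_on_singleton)
  qed
  then have "\<exists>Y. prime_chain G Er d Y" by (intro krull_dim_ge_iff[THEN iffD1, OF _ d_le] disjI2)
  then obtain Y0 where Y0: "prime_chain G Er d Y0" ..
  define Y where "Y = Y0 d"
  have Y: "prime_chain G Y d Y0" unfolding Y_def using prime_chain_top[OF Y0] .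
  have "Y \<subseteq> Er" unfolding Y_def using prime_chainD(1)[OF Y0] by blast
  then have YE: "Y \<subseteq> E" by (auto simp: Er_def rank_locus_def)
  have kd_ge: "enat d \<le> kd S" if "Y \<subseteq> S" for S
    unfolding kd_def using prime_chain_le_krull_dim[OF prime_chain_mono[OF Y that]] .
  define X where "X = \<psi> ` Y"
  have X: "prime_chain {\<lambda>x. x k | k. k < c} X d (\<lambda>k. \<psi> ` Y0 k)"
    unfolding X_def
  proof (rule prime_chain_image[where h' = "\<lambda>x. L (vec c x)", OF _ G_L' _ Y])
    show "(\<lambda>M. g (\<psi> M)) \<in> poly_fun G" if g: "g \<in> {\<lambda>x. x k | k. k < c}" for g
    proof -
      obtain k where "k < c" "g = (\<lambda>x. x k)" using g by auto
      then show ?thesis using \<psi>_poly by simp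
    qed
    show "g (L (vec c (\<psi> M))) = g M" if "M \<in> Y" for g M using L\<psi> that YE by auto
  qed
  have X_top: "\<psi> ` Y0 d = X" by (simp add: X_def Y_def)
  have rk: "rk_le a b r (pencil c T x)" if "x \<in> X" for x
  proof -
    obtain M where M: "M \<in> Y" "x = \<psi> M" using \<open>x \<in> X\<close> by (auto simp: X_def)
    then have "vec_space.rank a M \<le> r" "M \<in> carrier_mat a b"
      using \<open>Y \<subseteq> Er\<close> ED(1) by (auto simp: Er_def rank_locus_def)
    then have "rk_le a b r (\<lambda>i j. M $$ (i, j))" by (simp add: rank_le_iff)
    moreover have "M $$ (i, j) = pencil c T x i j" if "i < a" "j < b" for i j
      using L\<psi>[of M] M YE L_index[OF that, of x] by auto
    ultimately show ?thesis using rk_le_cong[of a b "\<lambda>i j. M $$ (i, j)"] by blast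
  qed
  show ?thesis
  proof (cases "\<exists>\<phi>. (\<exists>k<c. \<phi> k \<noteq> 0) \<and> (\<forall>x\<in>X. dot c x \<phi> = 0)")
    case True
    then obtain \<phi> k where k: "k < c" "\<phi> k \<noteq> 0" and \<phi>: "\<And>x. x \<in> X \<Longrightarrow> dot c x \<phi> = 0" by blast
    \<comment> \<open>The linear form \<open>\<phi>\<close> in the coordinates, rewritten in the
      matrix entries, so that it is a polynomial function on matrices.\<close>
    define \<delta> where "\<delta> = (\<lambda>i j. \<Sum>k<c. \<phi> k * \<gamma> k i j)"
    have \<delta>: "mat_functional a b \<delta> M = dot c (\<psi> M) \<phi>" for M
    proof -
      have "mat_functional a b \<delta> M = (\<Sum>i<a. \<Sum>j<b. \<Sum>k<c. \<phi> k * (\<gamma> k i j * M $$ (i, j)))"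
        by (simp add: mat_functional_def \<delta>_def sum_distrib_right mult.assoc)
      also have "\<dots> = (\<Sum>k<c. \<Sum>i<a. \<Sum>j<b. \<phi> k * (\<gamma> k i j * M $$ (i, j)))"
        by (simp only: sum.swap[of _ _ "{..<c}"])
      finally show ?thesis
        by (simp add: dot_def \<psi>_def mat_functional_def sum_distrib_left mult.commute[of _ "\<phi> _"])
    qed
    define F where "F = {M \<in> E. mat_functional a b \<delta> M = 0}"
    define M0 where "M0 = L (vec c (unitf k))"
    have M0: "M0 \<in> E" unfolding M0_def by (rule bc(2)) simp
    have "dot c (\<psi> M0) \<phi> = (\<Sum>l<c. unitf k l * \<phi> l)"
      unfolding dot_def M0_def by (intro sum.cong refl) (simp only: \<psi>L lessThan_iff)
    also have "\<dots> = \<phi> k" using k(1) dot_unit[OF k(1), of \<phi> 1] by (simp add: dot_def mult.commute)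
    finally have M0': "mat_functional a b \<delta> M0 \<noteq> 0" using k(2) \<delta> by simp
    have hyp: "hyperplane a b E F"
      unfolding F_def by (rule hyperplane_functional[OF sub bc(5) M0 M0'])
    \<comment> \<open>Appending \<open>E\<close> lengthens every chain in \<open>F\<close>, because
      the functional vanishes on \<open>F\<close> but not on \<open>E\<close>.\<close>
    have "kd F \<le> enat (K - 1)"
      unfolding kd_def
    proof (rule krull_dim_leI)
      fix m Z assume Z: "prime_chain G F m Z"
      have "Z m \<subseteq> F" using prime_chainD(1)[OF Z] by blast
      have "prime_chain G E (Suc m) (Z(Suc m := E))"
      proof (rule prime_chain_snoc[OF prime_chain_mono[OF Z] primeE order_refl])
        show "F \<subseteq> E" "Z m \<subseteq> E" using \<open>Z m \<subseteq> F\<close> by (auto simp: F_def)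
        show "mat_functional a b \<delta> \<in> poly_fun G" by (simp add: G_def mat_functional_poly)
        show "vanish (Z m) (mat_functional a b \<delta>)" using \<open>Z m \<subseteq> F\<close> by (auto simp: vanish_def F_def)
        show "\<not> vanish E (mat_functional a b \<delta>)" using M0 M0' by (auto simp: vanish_def)
      qed
      then show "m \<le> K - 1" using le_K by fastforce
    qed
    moreover have "enat d \<le> kd (rank_locus a F r)"
    proof (rule kd_ge)
      show "Y \<subseteq> rank_locus a F r"
        using \<open>Y \<subseteq> Er\<close> \<phi> \<delta> by (auto simp: Er_def rank_locus_def F_def X_def)
    qed
    ultimately have "kd F - kd (rank_locus a F r) \<le> enat (n - 1)"
    proof -
      obtain f where f: "kd F = enat f" "f \<le> K - 1"
        using \<open>kd F \<le> enat (K - 1)\<close> by (cases "kd F") auto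
      \<comment> \<open>The dimension drops by one while the locus still contains \<open>Y\<close>;
        for positive \<open>n\<close>, \<open>(K - 1) - (n - 1)\<close> is again
        \<open>K - n\<close>.\<close>
      have "f - (n - 1) \<le> d" using f(2) \<open>n > 0\<close> by (simp add: d_def)
      then have "enat (f - (n - 1)) \<le> kd (rank_locus a F r)"
        using \<open>enat d \<le> kd (rank_locus a F r)\<close> order_trans enat_ord_simps(1) by blast
      then show ?thesis unfolding f(1) enat_diff_le_iff .
    qed
    then have "codim (zariski_mat a b) F (rank_locus a F r) \<le> enat (n - 1)"
      by (simp add: codim_def zG kd_def)
    then show ?thesis using hyp by blast
  next
    case False
    then have spanning: "\<exists>x\<in>X. dot c x \<phi> \<noteq> 0" if "\<exists>k<c. \<phi> k \<noteq> 0" for \<phi> using that by blast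
    have "c \<le> d + n" using \<open>c \<le> K\<close> by (simp add: d_def)
    have left: "b \<le> (r + 1) * (n + 1) * r \<or>
      (\<exists>w \<phi>. dot a \<phi> w = 1 \<and> (\<forall>x\<in>X. rk_le a b (r - 1)
         (\<lambda>i j. pencil c T x i j - w i * (\<Sum>l<a. \<phi> l * pencil c T x l j))))"
    proof (rule few_columns_or_project[where Y = "\<lambda>k. \<psi> ` Y0 k" and k = d, unfolded X_top])
      fix z :: "nat \<Rightarrow> complex" assume z: "\<exists>j<b. z j \<noteq> 0"
      obtain M i where M: "M \<in> E" "i < a" "(\<Sum>j<b. z j * M $$ (i, j)) \<noteq> 0"
        using concise_rows[OF con ED(1) z] by blast
      have "bil a b (pencil c T (\<psi> M)) (unitf i) z = (\<Sum>j<b. z j * M $$ (i, j))"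
        using M(2) L_index[OF M(2), of _ "\<psi> M"] L\<psi>[OF M(1)]
        by (simp add: bil_unit_left mult.commute)
      then show "\<exists>v y. bil a b (pencil c T v) y z \<noteq> 0" using M(3) by metis
    qed (use prime_chainD(2-4)[OF X] \<open>c \<le> d + n\<close> rk spanning in auto)
    define T' where "T' = (\<lambda>k j i. T k i j)"
    have T': "pencil c T' x j i = pencil c T x i j" for x i j by (simp add: pencil_def T'_def)
    have right: "a \<le> (r + 1) * (n + 1) * r \<or>
      (\<exists>w \<phi>. dot b \<phi> w = 1 \<and> (\<forall>x\<in>X. rk_le b a (r - 1)
         (\<lambda>j i. pencil c T' x j i - w j * (\<Sum>l<b. \<phi> l * pencil c T' x l i))))"
    proof (rule few_columns_or_project[where Y = "\<lambda>k. \<psi> ` Y0 k" and k = d, unfolded X_top])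
      show "rk_le b a r (pencil c T' x)" if "x \<in> X" for x
        using rk_le_swap[OF rk[OF that]] by (simp add: T'[abs_def])
      fix z :: "nat \<Rightarrow> complex" assume z: "\<exists>i<a. z i \<noteq> 0"
      obtain M j where M: "M \<in> E" "j < b" "(\<Sum>i<a. z i * M $$ (i, j)) \<noteq> 0"
        using concise_columns[OF con ED(1) z] by blast
      have "bil b a (pencil c T' (\<psi> M)) (unitf j) z = (\<Sum>i<a. z i * M $$ (i, j))"
        using M(2) L_index[OF _ M(2), of _ "\<psi> M"] L\<psi>[OF M(1)]
        by (simp add: bil_unit_left T' mult.commute)
      then show "\<exists>v y. bil b a (pencil c T' v) y z \<noteq> 0" using M(3) by metis
    qed (use prime_chainD(2-4)[OF X] \<open>c \<le> d + n\<close> spanning in auto)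
    \<comment> \<open>Common end of the row and the column case, with \<open>i = 1\<close>: if
      subtracting \<open>H\<close> lowers the rank on \<open>X\<close>, the chain below
      \<open>X\<close>, carried to coordinate vectors, lies in the locus of \<open>H'\<close> and
      bounds its codimension.\<close>
    have decomposition: "\<exists>i\<in>{1..r}. ?decomposition i"
      if H: "\<And>k. H k \<in> carrier_mat a b"
        and rkH: "\<And>x. x \<in> X \<Longrightarrow> rk_le a b (r - 1) (\<lambda>i j. pencil c T x i j - lin_mat a b c H (vec c x) $$ (i, j))"
        and line: "(\<exists>A'. linear_subspace (vec_sp a) A' \<and> lin_dim (vec_sp a) A' = 1 \<and>
                lin_mat_space a b c H \<subseteq> tensor_left a b A') \<or>
             (\<exists>B'. linear_subspace (vec_sp b) B' \<and> lin_dim (vec_sp b) B' = 1 \<and>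
                lin_mat_space a b c H \<subseteq> tensor_right a b B')" for H
    proof (intro bexI[of _ 1] exI conjI)
      define H' where "H' = (\<lambda>k. mat a b (\<lambda>(i, j). e k $$ (i, j) - H k $$ (i, j)))"
      show "\<forall>k<c. H k \<in> carrier_mat a b \<and> H' k \<in> carrier_mat a b" using H by (simp add: H'_def)
      have index: "lin_mat a b c H' x $$ (i, j) = L x $$ (i, j) - lin_mat a b c H x $$ (i, j)"
        if "i < a" "j < b" for x i j
        using that by (simp add: lin_mat_index L_def H'_def right_diff_distrib sum_subtractf)
      show "\<forall>x\<in>carrier_vec c. lin_mat a b c e x = lin_mat a b c H x + lin_mat a b c H' x"
      proof
        fix x :: "complex vec"
        show "lin_mat a b c e x = lin_mat a b c H x + lin_mat a b c H' x"
          by (intro eq_matI) (simp_all add: index L_def)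
      qed
      have in_locus: "(\<lambda>M. vec c (\<psi> M)) ` Y \<subseteq> lin_mat_locus a b c H' (r - 1)"
      proof
        fix v assume "v \<in> (\<lambda>M. vec c (\<psi> M)) ` Y"
        then obtain x where x: "x \<in> X" "v = vec c x" by (auto simp: X_def)
        have "rk_le a b (r - 1) (\<lambda>i j. lin_mat a b c H' v $$ (i, j))"
          using rkH[OF x(1)] by (subst rk_le_cong[OF index]) (simp_all add: x(2) L_index cong: rk_le_cong)
        then show "v \<in> lin_mat_locus a b c H' (r - 1)"
          by (simp add: lin_mat_locus_def rank_le_iff[OF lin_mat_carrier] x(2))
      qed
      have chain: "prime_chain (vec_coords c) ((\<lambda>M. vec c (\<psi> M)) ` Y) d (\<lambda>k. (\<lambda>M. vec c (\<psi> M)) ` Y0 k)"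
      proof (rule prime_chain_image[OF _ G_L _ Y])
        show "(\<lambda>M. g (vec c (\<psi> M))) \<in> poly_fun G" if g: "g \<in> vec_coords c" for g
        proof -
          obtain k where "k < c" "g = (\<lambda>x. x $ k)" using g by auto
          then show ?thesis using \<psi>_poly by simp
        qed
        show "g (L (vec c (\<psi> M))) = g M" if "M \<in> Y" for g M using L\<psi> that YE by auto
      qed
      have "enat d \<le> krull_dim (subtopology (zariski (vec_coords c)) (lin_mat_locus a b c H' (r - 1)))"
        by (rule prime_chain_le_krull_dim[OF prime_chain_mono[OF chain in_locus]])
      moreover have "krull_dim (subtopology (zariski (vec_coords c)) (carrier_vec c)) \<le> enat K"
        by (rule krull_dim_leI) (rule vec_chain)
      ultimately show "codim (zariski_vec c) (carrier_vec c) (lin_mat_locus a b c H' (r - 1)) \<le> enat n"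
        unfolding codim_def zariski_vec_def
        by (cases "krull_dim (subtopology (zariski (vec_coords c)) (carrier_vec c))";
            cases "krull_dim (subtopology (zariski (vec_coords c)) (lin_mat_locus a b c H' (r - 1)))")
           (auto simp: d_def)
    qed (use line \<open>r > 0\<close> in auto)
    show ?thesis
    proof (cases ?bounded)
      case False
      then consider "\<not> b \<le> (r + 1) * (n + 1) * r" | "\<not> a \<le> (r + 1) * (n + 1) * r" by blast
      then have "\<exists>i\<in>{1..r}. ?decomposition i"
      proof cases
        case 1
        then obtain w \<phi> where w: "dot a \<phi> w = 1" and rkw: "\<And>x. x \<in> X \<Longrightarrow> rk_le a b (r - 1)
         (\<lambda>i j. pencil c T x i j - w i * (\<Sum>l<a. \<phi> l * pencil c T x l j))" using left by blast
        \<comment> \<open>The part that the projection along \<open>w\<close> removes: each of its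
          columns is a multiple of \<open>w\<close>.\<close>
        define H where "H = (\<lambda>k. mat a b (\<lambda>(i, j). w i * (\<Sum>l<a. \<phi> l * e k $$ (l, j))))"
        have H: "lin_mat a b c H v $$ (i, j) = w i * (\<Sum>l<a. \<phi> l * L v $$ (l, j))"
          if "i < a" "j < b" for v i j
        proof -
          have "lin_mat a b c H v $$ (i, j) = w i * (\<Sum>k<c. \<Sum>l<a. \<phi> l * (v $ k * e k $$ (l, j)))"
            using that by (simp add: lin_mat_index H_def sum_distrib_left mult_ac)
          also have "(\<Sum>k<c. \<Sum>l<a. \<phi> l * (v $ k * e k $$ (l, j))) = (\<Sum>l<a. \<phi> l * L v $$ (l, j))"
            using that by (subst sum.swap) (simp add: L_def lin_mat_index sum_distrib_left)
          finally show ?thesis .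
        qed
        show ?thesis
        proof (rule decomposition[of H])
          show "rk_le a b (r - 1) (\<lambda>i j. pencil c T x i j - lin_mat a b c H (vec c x) $$ (i, j))"
            if "x \<in> X" for x
            using rkw[OF that] by (simp add: H L_index cong: rk_le_cong)
          have "vec a w \<noteq> 0\<^sub>v a"
          proof
            assume "vec a w = 0\<^sub>v a"
            then have "w i = 0" if "i < a" for i using that by (metis index_vec index_zero_vec(1))
            then show False using w by (simp add: dot_def)
          qed
          note line = line_subspace[OF vec_carrier this]
          have "lin_mat_space a b c H \<subseteq> tensor_left a b {t \<cdot>\<^sub>v vec a w | t. True}"
          proof
            fix M assume "M \<in> lin_mat_space a b c H"
            then obtain v where v: "M = lin_mat a b c H v" by (auto simp: lin_mat_space_def)
            have "col M j = (\<Sum>l<a. \<phi> l * L v $$ (l, j)) \<cdot>\<^sub>v vec a w" if "j < b" for j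
              using that by (intro eq_vecI) (simp_all add: v H mult.commute)
            then show "M \<in> tensor_left a b {t \<cdot>\<^sub>v vec a w | t. True}"
              by (auto simp: tensor_left_def v)
          qed
          then show "(\<exists>A'. linear_subspace (vec_sp a) A' \<and> lin_dim (vec_sp a) A' = 1 \<and>
                lin_mat_space a b c H \<subseteq> tensor_left a b A') \<or>
             (\<exists>B'. linear_subspace (vec_sp b) B' \<and> lin_dim (vec_sp b) B' = 1 \<and>
                lin_mat_space a b c H \<subseteq> tensor_right a b B')"
            using line by blast
        qed (simp add: H_def)
      next
        case 2
        then obtain w \<phi> where w: "dot b \<phi> w = 1" and rkw: "\<And>x. x \<in> X \<Longrightarrow> rk_le b a (r - 1)
         (\<lambda>j i. pencil c T' x j i - w j * (\<Sum>l<b. \<phi> l * pencil c T' x l i))" using right by blast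
        define H where "H = (\<lambda>k. mat a b (\<lambda>(i, j). w j * (\<Sum>l<b. \<phi> l * e k $$ (i, l))))"
        have H: "lin_mat a b c H v $$ (i, j) = w j * (\<Sum>l<b. \<phi> l * L v $$ (i, l))"
          if "i < a" "j < b" for v i j
        proof -
          have "lin_mat a b c H v $$ (i, j) = w j * (\<Sum>k<c. \<Sum>l<b. \<phi> l * (v $ k * e k $$ (i, l)))"
            using that by (simp add: lin_mat_index H_def sum_distrib_left mult_ac)
          also have "(\<Sum>k<c. \<Sum>l<b. \<phi> l * (v $ k * e k $$ (i, l))) = (\<Sum>l<b. \<phi> l * L v $$ (i, l))"
            using that by (subst sum.swap) (simp add: L_def lin_mat_index sum_distrib_left)
          finally show ?thesis .
        qed
        show ?thesis
        proof (rule decomposition[of H])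
          show "rk_le a b (r - 1) (\<lambda>i j. pencil c T x i j - lin_mat a b c H (vec c x) $$ (i, j))"
            if "x \<in> X" for x
            using rk_le_swap[OF rkw[OF that]] by (simp add: H L_index T' cong: rk_le_cong)
          have "vec b w \<noteq> 0\<^sub>v b"
          proof
            assume "vec b w = 0\<^sub>v b"
            then have "w i = 0" if "i < b" for i using that by (metis index_vec index_zero_vec(1))
            then show False using w by (simp add: dot_def)
          qed
          note line = line_subspace[OF vec_carrier this]
          have "lin_mat_space a b c H \<subseteq> tensor_right a b {t \<cdot>\<^sub>v vec b w | t. True}"
          proof
            fix M assume "M \<in> lin_mat_space a b c H"
            then obtain v where v: "M = lin_mat a b c H v" by (auto simp: lin_mat_space_def)
            have "row M i = (\<Sum>l<b. \<phi> l * L v $$ (i, l)) \<cdot>\<^sub>v vec b w" if "i < a" for i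
              using that by (intro eq_vecI) (simp_all add: v H mult.commute)
            then show "M \<in> tensor_right a b {t \<cdot>\<^sub>v vec b w | t. True}"
              by (auto simp: tensor_right_def v)
          qed
          then show "(\<exists>A'. linear_subspace (vec_sp a) A' \<and> lin_dim (vec_sp a) A' = 1 \<and>
                lin_mat_space a b c H \<subseteq> tensor_left a b A') \<or>
             (\<exists>B'. linear_subspace (vec_sp b) B' \<and> lin_dim (vec_sp b) B' = 1 \<and>
                lin_mat_space a b c H \<subseteq> tensor_right a b B')"
            using line by blast
        qed (simp add: H_def)
      qed
      then show ?thesis by blast
    qed blast
  qed
qed

theorem proposition13:
  fixes r n :: nat
  assumes "r > 0" and "n > 0"
  shows "\<exists>M1 M2 :: nat. M1 > 0 \<and> M2 > 0 \<and>
    (\<forall>(a::nat) (b::nat) (E :: complex mat set) (c::nat) (e :: nat \<Rightarrow> complex mat).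
       linear_subspace (mat_sp a b) E \<and> concise a b E \<and> basis_of a b E c e \<and>
       codim (zariski_mat a b) E (rank_locus a E r) \<le> enat n \<longrightarrow>
         (a \<le> M1 \<or> b \<le> M1) \<or>
         (a \<le> M2 \<and> b \<le> M2) \<or>
         (\<exists>F. hyperplane a b E F \<and>
            codim (zariski_mat a b) F (rank_locus a F r) \<le> enat (n - 1)) \<or>
         (\<exists>i\<in>{1..r}. \<exists>H H' :: nat \<Rightarrow> complex mat.
            (\<forall>k<c. H k \<in> carrier_mat a b \<and> H' k \<in> carrier_mat a b) \<and>
            (\<forall>x\<in>carrier_vec c. lin_mat a b c e x = lin_mat a b c H x + lin_mat a b c H' x) \<and>
            codim (zariski_vec c) (carrier_vec c) (lin_mat_locus a b c H' (r - i)) \<le> enat n \<and>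
            ((\<exists>A'. linear_subspace (vec_sp a) A' \<and> lin_dim (vec_sp a) A' = i \<and>
                lin_mat_space a b c H \<subseteq> tensor_left a b A') \<or>
             (\<exists>B'. linear_subspace (vec_sp b) B' \<and> lin_dim (vec_sp b) B' = i \<and>
                lin_mat_space a b c H \<subseteq> tensor_right a b B'))))"
proof (intro exI conjI allI impI)
  show "(1 :: nat) > 0" "(r + 1) * (n + 1) * r > 0" using assms by simp_all
  fix a b c :: nat and E :: "complex mat set" and e
  assume "linear_subspace (mat_sp a b) E \<and> concise a b E \<and> basis_of a b E c e \<and>
    codim (zariski_mat a b) E (rank_locus a E r) \<le> enat n"
  then show "(a \<le> 1 \<or> b \<le> 1) \<or>
         (a \<le> (r + 1) * (n + 1) * r \<and> b \<le> (r + 1) * (n + 1) * r) \<or>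
         (\<exists>F. hyperplane a b E F \<and>
            codim (zariski_mat a b) F (rank_locus a F r) \<le> enat (n - 1)) \<or>
         (\<exists>i\<in>{1..r}. \<exists>H H' :: nat \<Rightarrow> complex mat.
            (\<forall>k<c. H k \<in> carrier_mat a b \<and> H' k \<in> carrier_mat a b) \<and>
            (\<forall>x\<in>carrier_vec c. lin_mat a b c e x = lin_mat a b c H x + lin_mat a b c H' x) \<and>
            codim (zariski_vec c) (carrier_vec c) (lin_mat_locus a b c H' (r - i)) \<le> enat n \<and>
            ((\<exists>A'. linear_subspace (vec_sp a) A' \<and> lin_dim (vec_sp a) A' = i \<and>
                lin_mat_space a b c H \<subseteq> tensor_left a b A') \<or>
             (\<exists>B'. linear_subspace (vec_sp b) B' \<and> lin_dim (vec_sp b) B' = i \<and>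
                lin_mat_space a b c H \<subseteq> tensor_right a b B')))"
    by (intro disjI2 bounded_size_or_hyperplane_or_decomposition[OF assms]) (elim conjE, assumption)+
qed

end
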